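(* Consider a confounded M2DP satisfying the front-door criterion, with the standing assumptions in the context, and suppose the following. (a) Pointwise uncertainty quantification: there is some $\alpha>0$ such that for every $s,a,m$, $\mathbb P\big[|\hat p_m(m|s,a)-p_m(m|s,a)|\le\Delta(s,a,m)\big]\ge1-\alpha$. (b) Coverage: $c_1=\sup_{s,\pi}\rho^\pi(s)/\rho^{\mathcal D}(s)<\infty$ (supremum over states and stationary policies) and $c_3=\sup_sp_b^{-1}(\pi^*(s)|s)<\infty$. (c) The initial Q-estimator $\hat Q$ is bounded by $V_{\max}$. Then there is a constant $C>0$ (not depending on the sample size, the dataset, $\alpha$, or the estimators $\hat Q,\hat p_b,\hat p_m,\Delta$) such that the policy $\tilde\pi$ produced by the PESCAL algorithm satisfies $$\mathbb E[J(\pi^* )-J(\tilde\pi)]\le\frac{C}{1-\gamma}\sqrt{c_1\,\mathbb E\|Q^*-\hat Q\|^2_{\rho^{\mathcal D}\times p_b\times p_m}}+\frac{CV_{\max}}{1-\gamma}\Big[\sqrt{c_1\,\mathbb E\,\mathbb E_{S\sim\rho^{\mathcal D}}\mathrm{KL}(p_b(\cdot|S)\|\hat p_b(\cdot|S))}$$ $$\qquad+\sum_{m\in\mathcal M}\sqrt{c_1c_3\,\mathbb E\,\mathbb E_{S\sim\rho^{\mathcal D},A\sim p_b(\cdot|S)}\Delta^2(S,A,m)}+\alpha(|\mathcal M|+|\mathcal A|)\Big].$$ Outer expectations $\mathbb E$ are over the data.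
   Context: **Confounded M2DP.** The model is a tuple $(\mathcal S,\mathcal C,\mathcal A,\mathcal M,p_s,p_c,p_m,p_r,\gamma,\rho_0)$: state space $\mathcal S$ and unmeasured-confounder space $\mathcal C$ (discrete or continuous), finite action space $\mathcal A$, finite mediator space $\mathcal M$, discount factor $\gamma\in[0,1)$, initial state distribution $\rho_0$. Offline data follow: $S_0\sim\rho_0$, and at each time $t\ge 0$: $C_t\sim p_c(\cdot|S_t)$; $A_t\sim p_a(\cdot|S_t,C_t)$ (behavior policy); $M_t\sim p_m(\cdot|S_t,C_t,A_t)$; $R_t\sim p_r(\cdot|S_t,C_t,A_t,M_t)$; $S_{t+1}\sim p_s(\cdot|S_t,C_t,A_t,M_t)$; each draw is independent of the past given the displayed conditioning variables. $C_t$ is unobserved. Rewards satisfy $|R_t|\le R_{\max}<\infty$ almost surely; $V_{\max}=R_{\max}/(1-\gamma)$. Mediator probabilities are bounded below: $p_m\ge p_{m^-}$ for a fixed small threshold $p_{m^-}>0$. Write $p_b(a|s)=\mathbb P(A_t=a|S_t=s)$ for the observed-data conditional action probability. **Front-door criterion.** (i) $M_t$ intercepts every directed path from $A_t$ to $S_{t+1}$ or $R_t$; (ii) conditioning on $S_t$, no path between $A_t$ and $M_t$ has an incoming arrow into $A_t$; (iii) conditioning on $S_t$, $A_t$ blocks every path between $M_t$ and $S_{t+1}$ or $R_t$ that has an incoming arrow into $M_t$. In this model: $A_t$ has no direct effect on $R_t$ or $S_{t+1}$ (so $p_r,p_s$ depend on $(S_t,C_t,M_t)$ only), and $p_m(m|s,c,a)=p_m(m|s,a)$.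 **Policies and values.** An online policy $\pi=\{\pi_t\}_{t\ge0}$ is a sequence of conditional probability mass functions on $\mathcal A$ given the observed history $H_t$ (all observed variables up to time $t$, including $S_t$); under $\pi$, trajectories are generated by $S_0\sim\rho_0$ and, at each time $t\ge0$: $C_t\sim p_c(\cdot|S_t)$; $A_t\sim\pi_t(\cdot|H_t)$, without any influence of $C_t$; $M_t\sim p_m(\cdot|S_t,A_t)$; $R_t\sim p_r(\cdot|S_t,C_t,A_t,M_t)$; $S_{t+1}\sim p_s(\cdot|S_t,C_t,A_t,M_t)$; $\mathbb E^\pi$ is the resulting expectation. A stationary policy has $\pi_t(\cdot|H_t)=\pi(\cdot|S_t)$ with the same $\pi$ for all $t$. $J(\pi)=\sum_{t\ge0}\gamma^t\mathbb E^\pi(R_t)$. The mediated Q-function is $Q^\pi(s,a,m)=\sum_{t\ge0}\gamma^t\mathbb E^\pi(R_t|S_0=s,A_0=a,M_0=m,do(A_{1:\infty}\sim\pi))$, where only actions at times $t\ge1$ are intervened on and $(S_0,A_0,M_0)$ is conditioned on under the offline distribution; $Q^*=\sup_\pi Q^\pi$. The optimal policy is the deterministic stationary policy $\pi^*(s)=\arg\max_a\sum_{\tilde a,m}p_m(m|s,a)p_b(\tilde a|s)Q^*(s,\tilde a,m)$, which maximizes $J$. $\rho^\pi(s)=(1-\gamma)\sum_{t\ge0}\gamma^t\rho^\pi_t(s)$ is the $\gamma$-discounted visitation distribution, where $\rho_t^\pi$ is the mass/density function of $S_t$ under $\pi$; $\rho^{\mathcal D}$ is the mixture (average over trajectories)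 of the state distributions in the dataset. **PESCAL algorithm.** From an offline dataset $\mathcal D$ of $N$ tuples (state, action, mediator, reward, next state): compute estimators $\hat p_b,\hat p_m$ of $p_b,p_m$; compute an initial estimator $\hat Q$ of the mediated optimal Q-function by some base causal Q-learning algorithm; compute an uncertainty quantifier $\Delta(s,a,m)$; set $\tilde Q(s,a,m)=\hat Q(s,a,m)-\inf_{(s',a',m')}\hat Q(s',a',m')$; output $$\tilde\pi(s)=\arg\max_a\sum_{\tilde a,m}\{\hat p_m(m|s,a)-\Delta(s,a,m)\}\,\hat p_b(\tilde a|s)\,\tilde Q(s,\tilde a,m).$$ **Norm and KL.** $\|f\|^2_{\rho^{\mathcal D}\times p_b\times p_m}=\mathbb E_{S\sim\rho^{\mathcal D},A\sim p_b(\cdot|S),M\sim p_m(\cdot|S,A)}|f(S,A,M)|^2$ and $\mathrm{KL}(p_1\|p_2)=\sum_xp_1(x)\ln(p_1(x)/p_2(x))$. *)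

theory Defs
  imports "HOL-Probability.Probability"
begin

section \<open>Extended-valued auxiliary functions\<close>

definition esqrt :: "ennreal \<Rightarrow> ennreal" where
  "esqrt x = (if x = \<top> then \<top> else ennreal (sqrt (enn2real x)))"

text \<open>\<open>KL p q\<close> is infinite as soon as \<open>q\<close> vanishes at a point charged by \<open>p\<close>; a purely real-valued
  sum would silently drop such points, because \<open>x / 0 = 0\<close> and \<open>ln 0 = 0\<close>. For probability
  vectors the real sum is nonnegative, so that \<^const>\<open>ennreal\<close> does not truncate it.\<close>

definition KL :: "('x::finite \<Rightarrow> real) \<Rightarrow> ('x \<Rightarrow> real) \<Rightarrow> ennreal" where
  "KL p q = (if \<exists>x. p x > 0 \<and> q x = 0 then \<top> else ennreal (\<Sum>x\<in>UNIV. p x * ln (p x / q x)))"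

section \<open>The model\<close>

text \<open>\<open>state_base\<close> is the state space with its reference measure (counting measure for a discrete
  space, Lebesgue measure for a continuous one); \<open>init_dens\<close> (the initial distribution) and
  \<open>p_s s c a m\<close> (the transition law) are mass/density functions with respect to it.
  The finite action and mediator spaces are the types \<open>'a\<close> and \<open>'m\<close>.\<close>

record ('s, 'c, 'a, 'm) m2dp =
  state_base :: "'s measure"
  conf_space :: "'c measure"
  init_dens :: "'s \<Rightarrow> ennreal"
  p_c :: "'s \<Rightarrow> 'c measure"
  p_a :: "'s \<Rightarrow> 'c \<Rightarrow> 'a pmf"
  p_m :: "'s \<Rightarrow> 'c \<Rightarrow> 'a \<Rightarrow> 'm pmf"
  p_r :: "'s \<Rightarrow> 'c \<Rightarrow> 'a \<Rightarrow> 'm \<Rightarrow> real measure"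
  p_s :: "'s \<Rightarrow> 'c \<Rightarrow> 'a \<Rightarrow> 'm \<Rightarrow> 's \<Rightarrow> ennreal"
  disc :: real

locale confounded_m2dp =
  fixes G :: "('s, 'c, 'a::finite, 'm::finite) m2dp" and Rmax pmin :: real
  assumes state_base: "sigma_finite_measure (state_base G)"
    and init_meas: "init_dens G \<in> borel_measurable (state_base G)"
    and init_total: "(\<integral>\<^sup>+s. init_dens G s \<partial>state_base G) = 1"
    and p_c_kernel: "p_c G \<in> state_base G \<rightarrow>\<^sub>M prob_algebra (conf_space G)"
    and p_a_meas: "\<And>a. (\<lambda>(s, c). pmf (p_a G s c) a)
          \<in> borel_measurable (state_base G \<Otimes>\<^sub>M conf_space G)"
    and p_m_meas: "\<And>a m. (\<lambda>(s, c). pmf (p_m G s c a) m)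
          \<in> borel_measurable (state_base G \<Otimes>\<^sub>M conf_space G)"
    and p_r_kernel: "\<And>a m. (\<lambda>(s, c). p_r G s c a m)
          \<in> state_base G \<Otimes>\<^sub>M conf_space G \<rightarrow>\<^sub>M prob_algebra borel"
    and p_s_meas: "\<And>a m. (\<lambda>((s, c), s'). p_s G s c a m s')
          \<in> borel_measurable ((state_base G \<Otimes>\<^sub>M conf_space G) \<Otimes>\<^sub>M state_base G)"
    and p_s_total: "\<And>s c a m. s \<in> space (state_base G) \<Longrightarrow> c \<in> space (conf_space G) \<Longrightarrow>
          (\<integral>\<^sup>+s'. p_s G s c a m s' \<partial>state_base G) = 1"
    and disc: "0 \<le> disc G" "disc G < 1"
    and reward_bound: "\<And>s c a m. s \<in> space (state_base G) \<Longrightarrow> c \<in> space (conf_space G) \<Longrightarrow>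
          AE r in p_r G s c a m. \<bar>r\<bar> \<le> Rmax"
    and pmin_pos: "0 < pmin"
    and p_m_lower: "\<And>s c a m. s \<in> space (state_base G) \<Longrightarrow> c \<in> space (conf_space G) \<Longrightarrow>
          pmin \<le> pmf (p_m G s c a) m"

definition Vmax :: "('s, 'c, 'a, 'm) m2dp \<Rightarrow> real \<Rightarrow> real" where
  "Vmax G Rmax = Rmax / (1 - disc G)"

definition front_door :: "('s, 'c, 'a, 'm) m2dp \<Rightarrow> bool" where
  "front_door G \<longleftrightarrow>
    (\<forall>s\<in>space (state_base G). \<forall>c\<in>space (conf_space G).
      (\<forall>a a' m. p_r G s c a m = p_r G s c a' m) \<and>
      (\<forall>a a' m. \<forall>s'\<in>space (state_base G). p_s G s c a m s' = p_s G s c a' m s') \<and>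
      (\<forall>a. \<forall>c'\<in>space (conf_space G). p_m G s c a = p_m G s c' a))"

definition p_b :: "('s, 'c, 'a, 'm) m2dp \<Rightarrow> 's \<Rightarrow> 'a \<Rightarrow> real" where
  "p_b G s a = (\<integral>c. pmf (p_a G s c) a \<partial>p_c G s)"

text \<open>The mediator probability given state and action, \<open>p\<^sub>m(m | s, a)\<close>. Under the front-door
  criterion the integrand is constant in \<open>c\<close>.\<close>

definition p_med :: "('s, 'c, 'a, 'm) m2dp \<Rightarrow> 's \<Rightarrow> 'a \<Rightarrow> 'm \<Rightarrow> real" where
  "p_med G s a m = (\<integral>c. pmf (p_m G s c a) m \<partial>p_c G s)"

section \<open>Trajectories\<close>

type_synonym ('s, 'c, 'a, 'm) step = "'s \<times> 'c \<times> 'a \<times> 'm \<times> real"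
type_synonym ('s, 'a, 'm) obs = "'s \<times> 'a \<times> 'm \<times> real"

definition step_space :: "('s, 'c, 'a, 'm) m2dp \<Rightarrow> ('s, 'c, 'a, 'm) step measure" where
  "step_space G = state_base G \<Otimes>\<^sub>M (conf_space G \<Otimes>\<^sub>M
     (count_space UNIV \<Otimes>\<^sub>M (count_space UNIV \<Otimes>\<^sub>M borel)))"

definition obs_space :: "('s, 'c, 'a, 'm) m2dp \<Rightarrow> ('s, 'a, 'm) obs measure" where
  "obs_space G = state_base G \<Otimes>\<^sub>M
     (count_space UNIV \<Otimes>\<^sub>M (count_space UNIV \<Otimes>\<^sub>M borel))"

definition traj_space :: "('s, 'c, 'a, 'm) m2dp \<Rightarrow> (nat \<Rightarrow> ('s, 'c, 'a, 'm) step) measure" where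
  "traj_space G = PiM UNIV (\<lambda>_. step_space G)"

definition reward :: "('s, 'c, 'a, 'm) step \<Rightarrow> real" where
  "reward x = (case x of (s, c, a, m, r) \<Rightarrow> r)"

definition observe :: "('s, 'c, 'a, 'm) step \<Rightarrow> ('s, 'a, 'm) obs" where
  "observe x = (case x of (s, c, a, m, r) \<Rightarrow> (s, a, m, r))"

definition next_dens :: "('s, 'c, 'a, 'm) m2dp \<Rightarrow> ('s, 'c, 'a, 'm) step \<Rightarrow> 's \<Rightarrow> ennreal" where
  "next_dens G x s' = (case x of (s, c, a, m, r) \<Rightarrow> p_s G s c a m s')"

definition reward_step ::
  "('s, 'c, 'a, 'm) m2dp \<Rightarrow> 's \<Rightarrow> 'c \<Rightarrow> 'a \<Rightarrow> 'm \<Rightarrow> ('s, 'c, 'a, 'm) step measure" where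
  "reward_step G s c a m = distr (p_r G s c a m) (step_space G) (\<lambda>r. (s, c, a, m, r))"

text \<open>Law of the step at time \<open>t\<close> given the steps \<open>w 0, \<dots>, w (t - 1)\<close>, when the action is drawn
  from \<open>act t w s c\<close>.\<close>

definition step_kernel ::
  "('s, 'c, 'a, 'm) m2dp \<Rightarrow> (nat \<Rightarrow> (nat \<Rightarrow> ('s, 'c, 'a, 'm) step) \<Rightarrow> 's \<Rightarrow> 'c \<Rightarrow> 'a pmf)
    \<Rightarrow> nat \<Rightarrow> (nat \<Rightarrow> ('s, 'c, 'a, 'm) step) \<Rightarrow> ('s, 'c, 'a, 'm) step measure" where
  "step_kernel G act t w =
     density (state_base G) (if t = 0 then init_dens G else next_dens G (w (t - 1))) \<bind> (\<lambda>s.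
     p_c G s \<bind> (\<lambda>c.
     measure_pmf (act t w s c) \<bind> (\<lambda>a.
     measure_pmf (p_m G s c a) \<bind> (\<lambda>m.
     reward_step G s c a m))))"

text \<open>The law on infinite trajectories with given step kernels (Ionescu-Tulcea).\<close>

definition traj_law ::
  "('s, 'c, 'a, 'm) m2dp
    \<Rightarrow> (nat \<Rightarrow> (nat \<Rightarrow> ('s, 'c, 'a, 'm) step) \<Rightarrow> ('s, 'c, 'a, 'm) step measure)
    \<Rightarrow> (nat \<Rightarrow> ('s, 'c, 'a, 'm) step) measure" where
  "traj_law G K = projective_family.lim UNIV
     (Ionescu_Tulcea.CI K (\<lambda>_. step_space G)) (\<lambda>_. step_space G)"

definition offline_law :: "('s, 'c, 'a, 'm) m2dp \<Rightarrow> (nat \<Rightarrow> ('s, 'c, 'a, 'm) step) measure" where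
  "offline_law G = traj_law G (step_kernel G (\<lambda>t w s c. p_a G s c))"

section \<open>Online policies and their values\<close>

text \<open>\<open>\<pi> t h s\<close> is the conditional distribution of the action at time \<open>t\<close>, given the past
  observations \<open>h 0, \<dots>, h (t - 1)\<close> and the current state \<open>s\<close>; it does not see the confounders.\<close>

type_synonym ('s, 'a, 'm) policy = "nat \<Rightarrow> (nat \<Rightarrow> ('s, 'a, 'm) obs) \<Rightarrow> 's \<Rightarrow> 'a pmf"

definition policies :: "('s, 'c, 'a, 'm) m2dp \<Rightarrow> ('s, 'a, 'm) policy set" where
  "policies G = {\<pi>. \<forall>t a. (\<lambda>(h, s). pmf (\<pi> t h s) a)
     \<in> borel_measurable (PiM {0..<t} (\<lambda>_. obs_space G) \<Otimes>\<^sub>M state_base G)}"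

definition stationary_policies :: "('s, 'c, 'a, 'm) m2dp \<Rightarrow> ('s \<Rightarrow> 'a pmf) set" where
  "stationary_policies G = {\<pi>. \<forall>a. (\<lambda>s. pmf (\<pi> s) a) \<in> borel_measurable (state_base G)}"

definition stationary :: "('s \<Rightarrow> 'a pmf) \<Rightarrow> ('s, 'a, 'm) policy" where
  "stationary \<pi> = (\<lambda>t h s. \<pi> s)"

definition deterministic :: "('s \<Rightarrow> 'a) \<Rightarrow> ('s, 'a, 'm) policy" where
  "deterministic d = stationary (\<lambda>s. return_pmf (d s))"

definition online_kernel ::
  "('s, 'c, 'a, 'm) m2dp \<Rightarrow> ('s, 'a, 'm) policy
    \<Rightarrow> nat \<Rightarrow> (nat \<Rightarrow> ('s, 'c, 'a, 'm) step) \<Rightarrow> ('s, 'c, 'a, 'm) step measure" where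
  "online_kernel G \<pi> = step_kernel G (\<lambda>t w s c. \<pi> t (\<lambda>i\<in>{0..<t}. observe (w i)) s)"

definition online_law ::
  "('s, 'c, 'a, 'm) m2dp \<Rightarrow> ('s, 'a, 'm) policy \<Rightarrow> (nat \<Rightarrow> ('s, 'c, 'a, 'm) step) measure" where
  "online_law G \<pi> = traj_law G (online_kernel G \<pi>)"

definition disc_return :: "('s, 'c, 'a, 'm) m2dp \<Rightarrow> (nat \<Rightarrow> ('s, 'c, 'a, 'm) step) measure \<Rightarrow> real"
  where "disc_return G L = (\<Sum>t. disc G ^ t * (\<integral>w. reward (w t) \<partial>L))"

definition J :: "('s, 'c, 'a, 'm) m2dp \<Rightarrow> ('s, 'a, 'm) policy \<Rightarrow> real" where
  "J G \<pi> = disc_return G (online_law G \<pi>)"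

text \<open>Offline conditional law of the confounder given state, action and mediator (Bayes' rule).
  If the conditioning event is null, the value is immaterial and we take the prior \<open>p_c\<close>.\<close>

definition conf_posterior :: "('s, 'c, 'a, 'm) m2dp \<Rightarrow> 's \<Rightarrow> 'a \<Rightarrow> 'm \<Rightarrow> 'c measure" where
  "conf_posterior G s a m =
    (let z = (\<integral>c. pmf (p_a G s c) a * pmf (p_m G s c a) m \<partial>p_c G s)
     in if z = 0 then p_c G s
        else density (p_c G s) (\<lambda>c. ennreal (pmf (p_a G s c) a * pmf (p_m G s c a) m / z)))"

text \<open>Law of the trajectory when \<open>(S\<^sub>0, A\<^sub>0, M\<^sub>0) = (s, a, m)\<close> is conditioned on under the
  offline distribution and the actions at times \<open>t \<ge> 1\<close> follow \<open>\<pi>\<close>.\<close>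

definition mediated_law ::
  "('s, 'c, 'a, 'm) m2dp \<Rightarrow> ('s, 'a, 'm) policy \<Rightarrow> 's \<Rightarrow> 'a \<Rightarrow> 'm
    \<Rightarrow> (nat \<Rightarrow> ('s, 'c, 'a, 'm) step) measure" where
  "mediated_law G \<pi> s a m = traj_law G (\<lambda>t w.
     if t = 0 then conf_posterior G s a m \<bind> (\<lambda>c. reward_step G s c a m)
     else online_kernel G \<pi> t w)"

definition Q :: "('s, 'c, 'a, 'm) m2dp \<Rightarrow> ('s, 'a, 'm) policy \<Rightarrow> 's \<Rightarrow> 'a \<Rightarrow> 'm \<Rightarrow> real" where
  "Q G \<pi> s a m = disc_return G (mediated_law G \<pi> s a m)"

definition Qstar :: "('s, 'c, 'a, 'm) m2dp \<Rightarrow> 's \<Rightarrow> 'a \<Rightarrow> 'm \<Rightarrow> real" where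
  "Qstar G s a m = (SUP \<pi>\<in>policies G. Q G \<pi> s a m)"

text \<open>The arg max need not be unique: any measurable selection qualifies.\<close>

definition optimal_policy :: "('s, 'c, 'a::finite, 'm::finite) m2dp \<Rightarrow> ('s \<Rightarrow> 'a) \<Rightarrow> bool" where
  "optimal_policy G d \<longleftrightarrow>
     d \<in> state_base G \<rightarrow>\<^sub>M count_space UNIV \<and>
     (\<forall>s\<in>space (state_base G). is_arg_max
       (\<lambda>a. \<Sum>a'\<in>UNIV. \<Sum>m\<in>UNIV. p_med G s a m * p_b G s a' * Qstar G s a' m) (\<lambda>_. True) (d s))"

section \<open>State distributions and coverage\<close>

text \<open>The mass/density function of \<open>S\<^sub>t\<close> under a trajectory law.\<close>

fun state_dens ::
  "('s, 'c, 'a, 'm) m2dp \<Rightarrow> (nat \<Rightarrow> ('s, 'c, 'a, 'm) step) measure \<Rightarrow> nat \<Rightarrow> 's \<Rightarrow> ennreal" where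
  "state_dens G L 0 s = init_dens G s"
| "state_dens G L (Suc t) s = (\<integral>\<^sup>+w. next_dens G (w t) s \<partial>L)"

definition visit_dens :: "('s, 'c, 'a, 'm) m2dp \<Rightarrow> ('s, 'a, 'm) policy \<Rightarrow> 's \<Rightarrow> ennreal" where
  "visit_dens G \<pi> s =
     ennreal (1 - disc G) * (\<Sum>t. ennreal (disc G ^ t) * state_dens G (online_law G \<pi>) t s)"

text \<open>The dataset records the first \<open>T i \<ge> 1\<close> transitions of trajectory \<open>i\<close>, for \<open>i < n\<close>.
  Its state distribution is the average over the trajectories of their state distributions.\<close>

definition data_dens :: "('s, 'c, 'a, 'm) m2dp \<Rightarrow> nat \<Rightarrow> (nat \<Rightarrow> nat) \<Rightarrow> 's \<Rightarrow> ennreal" where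
  "data_dens G n T s =
     (\<Sum>i<n. (\<Sum>t<T i. state_dens G (offline_law G) t s) / of_nat (T i)) / of_nat n"

definition data_states :: "('s, 'c, 'a, 'm) m2dp \<Rightarrow> nat \<Rightarrow> (nat \<Rightarrow> nat) \<Rightarrow> 's measure" where
  "data_states G n T = density (state_base G) (data_dens G n T)"

text \<open>In \<^typ>\<open>ennreal\<close>, \<open>x / 0 = \<top>\<close> for \<open>x \<noteq> 0\<close>, whereas \<open>0 / 0 = 0\<close>.\<close>

definition c1 :: "('s, 'c, 'a, 'm) m2dp \<Rightarrow> nat \<Rightarrow> (nat \<Rightarrow> nat) \<Rightarrow> ennreal" where
  "c1 G n T = (SUP s\<in>space (state_base G). SUP \<pi>\<in>stationary_policies G.
     visit_dens G (stationary \<pi>) s / data_dens G n T s)"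

definition c3 :: "('s, 'c, 'a, 'm) m2dp \<Rightarrow> ('s \<Rightarrow> 'a) \<Rightarrow> ennreal" where
  "c3 G d = (SUP s\<in>space (state_base G). inverse (ennreal (p_b G s (d s))))"

definition norm_sq ::
  "('s, 'c, 'a::finite, 'm::finite) m2dp \<Rightarrow> 's measure \<Rightarrow> ('s \<Rightarrow> 'a \<Rightarrow> 'm \<Rightarrow> real) \<Rightarrow> ennreal" where
  "norm_sq G \<rho> f =
     (\<integral>\<^sup>+s. (\<Sum>a\<in>UNIV. \<Sum>m\<in>UNIV. ennreal (p_b G s a * p_med G s a m * (f s a m)\<^sup>2)) \<partial>\<rho>)"

section \<open>Offline data and the PESCAL policy\<close>

text \<open>Joint law of \<open>n\<close> trajectories of the offline process; their dependence is left open.\<close>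

definition data_law ::
  "('s, 'c, 'a, 'm) m2dp \<Rightarrow> nat \<Rightarrow> (nat \<Rightarrow> nat \<Rightarrow> ('s, 'c, 'a, 'm) step) measure \<Rightarrow> bool" where
  "data_law G n P \<longleftrightarrow> prob_space P \<and> sets P = sets (PiM {..<n} (\<lambda>_. traj_space G)) \<and>
     (\<forall>i<n. distr P (traj_space G) (\<lambda>\<omega>. \<omega> i) = offline_law G)"

type_synonym ('s, 'a, 'm) dataset = "('s \<times> 'a \<times> 'm \<times> real \<times> 's) list"

definition record_tuple ::
  "(nat \<Rightarrow> ('s, 'c, 'a, 'm) step) \<Rightarrow> nat \<Rightarrow> 's \<times> 'a \<times> 'm \<times> real \<times> 's" where
  "record_tuple w t = (case w t of (s, c, a, m, r) \<Rightarrow> (s, a, m, r, fst (w (Suc t))))"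

definition dataset ::
  "nat \<Rightarrow> (nat \<Rightarrow> nat) \<Rightarrow> (nat \<Rightarrow> nat \<Rightarrow> ('s, 'c, 'a, 'm) step) \<Rightarrow> ('s, 'a, 'm) dataset" where
  "dataset n T \<omega> = concat (map (\<lambda>i. map (record_tuple (\<omega> i)) [0..<T i]) [0..<n])"

text \<open>\<open>d\<close> is an output of the algorithm for the estimates \<open>pbh\<close>, \<open>pmh\<close>, \<open>Qh\<close> and the
  uncertainty quantifier \<open>\<Delta>\<close>; ties in the arg max may be broken arbitrarily.\<close>

definition pescal_policy ::
  "('s, 'c, 'a::finite, 'm::finite) m2dp \<Rightarrow> ('s \<Rightarrow> 'a pmf) \<Rightarrow> ('s \<Rightarrow> 'a \<Rightarrow> 'm \<Rightarrow> real)
    \<Rightarrow> ('s \<Rightarrow> 'a \<Rightarrow> 'm \<Rightarrow> real) \<Rightarrow> ('s \<Rightarrow> 'a \<Rightarrow> 'm \<Rightarrow> real) \<Rightarrow> ('s \<Rightarrow> 'a) \<Rightarrow> bool" where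
  "pescal_policy G pbh pmh Qh \<Delta> d \<longleftrightarrow>
    (let Qt = (\<lambda>s a m. Qh s a m - (INF (s', a', m')\<in>space (state_base G) \<times> UNIV. Qh s' a' m'))
     in \<forall>s\<in>space (state_base G). is_arg_max
       (\<lambda>a. \<Sum>a'\<in>UNIV. \<Sum>m\<in>UNIV. (pmh s a m - \<Delta> s a m) * pmf (pbh s) a' * Qt s a' m)
       (\<lambda>_. True) (d s))"

end

theory Submission
  imports Defs
begin

text \<open>
  By the front-door criterion, intervening on the actions turns the model into an ordinary Markov
  decision process in which the mediator value of \<open>m\<close> at \<open>s\<close> is \<open>\<Sum>a. p_b(a | s) Q\<^sup>*(s, a, m)\<close>: averaging
  the confounder posterior over the behaviour policy gives back the prior. Hence \<open>Q\<^sup>*\<close> is expressed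
  through the fixed point of the Bellman operator, and telescoping along a trajectory of \<open>\<pi>_til\<close>
  shows that its regret is \<open>1 / (1 - \<gamma>)\<close> times the mean, under its visitation density, of the
  one-step gap between \<open>\<pi>_opt\<close> and \<open>\<pi>_til\<close>. Where the confidence bounds hold at both actions,
  pessimism bounds this gap by the errors of \<open>Qh\<close> and \<open>pbh\<close> and by \<open>\<Delta>\<close> at \<open>\<pi>_opt\<close>; elsewhere it is at
  most \<open>2 Vmax\<close>. The visitation density is then dominated by the data density and Jensen's inequality
  is applied over states and over the data. The visitation density depends on the data, so the
  failure probability \<open>\<alpha>\<close> enters through a coverage bound as well; one fixed sampling scheme with
  finite \<open>c1\<close> provides it, which makes the constant depend on the model only.
\<close>

section \<open>Square roots, relative entropy and kernels\<close>

text \<open>\<open>Qstar\<close> is a supremum over all history-dependent policies, so stationary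
  policies alone do not determine it. The obstacle is met by a verification argument: an action rule
  that does not see the confounder cannot gain on \<open>opt_value\<close> in any single step,
  whatever its history, and the stationary policy \<open>greedy\<close> loses nothing. These two
  facts and the regret itself are instances of one balance equation,
  \<open>discounted_telescope\<close>, whose defect is a nonnegative summand. Working with sums of
  nonnegative terms avoids summability conditions and almost all subtraction in
  \<open>ennreal\<close>. Value iteration starts at 0, below all shifted values, so monotonicity
  yields its limit and monotone convergence makes it a fixed point; no contraction argument enters.
  On the statistical side, expectations over the data can be taken term by term only after the
  visitation density of the learned policy, a random object, has been dominated by a nonrandom
  density; this order of steps decides where each coverage constant appears.\<close>

lemma esqrt_mono: "x \<le> y \<Longrightarrow> esqrt x \<le> esqrt y"
  by (auto simp: esqrt_def top_unique enn2real_mono less_top intro!: ennreal_leI)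

lemma esqrt_ennreal: "0 \<le> x \<Longrightarrow> esqrt (ennreal x) = ennreal (sqrt x)"
  by (simp add: esqrt_def)

lemma borel_measurable_esqrt[measurable]: "esqrt \<in> borel_measurable borel"
  unfolding esqrt_def[abs_def] by measurable

text \<open>Tangent-line bound for the square root. Its right-hand side is affine in
  \<open>x\<close>, so it can be integrated without integrability hypotheses.\<close>

lemma esqrt_le_AM_GM:
  assumes "t > 0"
  shows "esqrt x \<le> ennreal (1 / (2 * t)) * x + ennreal (t / 2)"
proof (cases x)
  case (real r)
  have "0 \<le> (sqrt r - t)\<^sup>2" by simp
  then have "2 * t * sqrt r \<le> r + t\<^sup>2" using real by (simp add: power2_diff algebra_simps)
  then have "sqrt r \<le> 1 / (2 * t) * r + t / 2"
    using assms by (simp add: field_simps power2_eq_square)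
  then show ?thesis using real assms
    by (simp add: esqrt_ennreal ennreal_mult[symmetric] ennreal_plus[symmetric] ennreal_leI
        del: ennreal_plus)
next
  case top
  then show ?thesis using assms by (simp add: ennreal_mult_top)
qed

lemma nn_integral_esqrt_le:
  assumes M: "emeasure M (space M) \<le> 1" and f[measurable]: "f \<in> borel_measurable M"
  shows "(\<integral>\<^sup>+x. esqrt (f x) \<partial>M) \<le> esqrt (\<integral>\<^sup>+x. f x \<partial>M)"
proof (cases "\<integral>\<^sup>+x. f x \<partial>M")
  case top
  then show ?thesis by (simp add: esqrt_def)
next
  case (real r)
  show ?thesis
  proof (cases "r = 0")
    case True
    then have "AE x in M. f x = 0"
      using real by (simp add: nn_integral_0_iff_AE)
    then have "(\<integral>\<^sup>+x. esqrt (f x) \<partial>M) = (\<integral>\<^sup>+x. 0 \<partial>M)"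
      by (intro nn_integral_cong_AE) (auto simp: esqrt_def)
    then show ?thesis by simp
  next
    case False
    then have r: "r > 0" using real by simp
    \<comment> \<open>The tangent at the mean is the one that makes the integrated bound sharp: both
      of its halves equal \<open>t / 2\<close>. A mean of 0 was treated apart because the tangent
      needs \<open>t > 0\<close>.\<close>
    define t where "t = sqrt r"
    have t: "t > 0" "t * t = r" using r by (auto simp: t_def)
    have "(\<integral>\<^sup>+x. esqrt (f x) \<partial>M) \<le> (\<integral>\<^sup>+x. ennreal (1 / (2 * t)) * f x + ennreal (t / 2) \<partial>M)"
      using t by (intro nn_integral_mono esqrt_le_AM_GM)
    also have "\<dots> = ennreal (1 / (2 * t)) * ennreal r + ennreal (t / 2) * emeasure M (space M)"
      using real by (simp add: nn_integral_add nn_integral_cmult)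
    also have "\<dots> \<le> ennreal (1 / (2 * t)) * ennreal r + ennreal (t / 2)"
      using mult_left_mono[OF M, of "ennreal (t / 2)"] by (intro add_left_mono) simp
    also have "\<dots> = ennreal (1 / (2 * t) * r + t / 2)"
      using t r by (simp add: ennreal_mult[symmetric] ennreal_plus[symmetric] del: ennreal_plus)
    also have "1 / (2 * t) * r + t / 2 = t"
      using t by (simp add: field_simps)
    finally show ?thesis using real r by (simp add: t_def esqrt_ennreal)
  qed
qed

lemma ennreal_abs_eq_esqrt: "ennreal \<bar>x\<bar> = esqrt (ennreal (x\<^sup>2))"
  by (simp add: esqrt_ennreal)

text \<open>The relative entropy dominates the squared Hellinger distance, which dominates the squared
  \<open>L\<^sup>1\<close> distance up to a factor 4.\<close>

lemma L1_le_KL: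
  fixes p q :: "'x::finite \<Rightarrow> real"
  assumes p: "\<And>x. 0 \<le> p x" "sum p UNIV = 1" and q: "\<And>x. 0 \<le> q x" "sum q UNIV = 1"
  shows "ennreal (\<Sum>x\<in>UNIV. \<bar>p x - q x\<bar>) \<le> 2 * esqrt (KL p q)"
proof (cases "\<exists>x. p x > 0 \<and> q x = 0")
  case True
  then show ?thesis by (simp add: KL_def esqrt_def ennreal_mult_top)
next
  case False
  then have pq: "p x > 0 \<Longrightarrow> q x > 0" for x using q(1)[of x] by force
  define H where "H = (\<Sum>x\<in>UNIV. (sqrt (p x) - sqrt (q x))\<^sup>2)"
  have H0: "0 \<le> H" unfolding H_def by (simp add: sum_nonneg)
  have H: "H = 2 - 2 * (\<Sum>x\<in>UNIV. sqrt (p x) * sqrt (q x))"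
    unfolding H_def using p q
    by (simp add: power2_diff sum.distrib sum_subtractf sum_distrib_left[symmetric] mult.assoc)
  have "2 * p x - 2 * (sqrt (p x) * sqrt (q x)) \<le> p x * ln (p x / q x)" for x
  proof (cases "p x > 0")
    case True
    note qx = pq[OF True]
    \<comment> \<open>With \<open>u = sqrt (q x / p x)\<close> the summand is
      \<open>- 2 * p x * ln u\<close>, and \<open>ln u \<le> u - 1\<close> turns it into the lower
      bound \<open>2 * p x - 2 * sqrt (p x * q x)\<close>. Summed over \<open>x\<close>, these lower
      bounds give exactly \<open>H\<close>.\<close>
    define u where "u = sqrt (q x) / sqrt (p x)"
    have u: "u > 0" using True qx by (simp add: u_def)
    have "u\<^sup>2 = q x / p x" using True qx by (simp add: u_def power_divide)
    then have "ln (p x / q x) = - ln (u\<^sup>2)"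
      using True qx by (simp add: ln_div)
    also have "\<dots> = - 2 * ln u" using u by (simp add: ln_realpow)
    finally have "ln (p x / q x) \<ge> - 2 * (u - 1)"
      using ln_le_minus_one[OF u] by simp
    then have "p x * ln (p x / q x) \<ge> p x * (- 2 * (u - 1))"
      using True by (intro mult_left_mono) auto
    moreover have "p x * u = sqrt (p x) * sqrt (q x)"
    proof -
      have "sqrt (p x) * u = sqrt (q x)" using True by (simp add: u_def)
      moreover have "p x * u = sqrt (p x) * (sqrt (p x) * u)"
        using p(1)[of x] by (simp add: mult.assoc[symmetric])
      ultimately show ?thesis by simp
    qed
    ultimately show ?thesis by (simp add: algebra_simps)
  next
    case False
    then have "p x = 0" using p(1)[of x] by simp
    then show ?thesis by simp
  qed
  then have "(\<Sum>x\<in>UNIV. 2 * p x - 2 * (sqrt (p x) * sqrt (q x))) \<le> (\<Sum>x\<in>UNIV. p x * ln (p x / q x))"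
    by (intro sum_mono)
  then have HKL: "H \<le> (\<Sum>x\<in>UNIV. p x * ln (p x / q x))"
    using p unfolding H by (simp add: sum_subtractf sum_distrib_left[symmetric])
  \<comment> \<open>Factor the difference of squares and apply Cauchy-Schwarz; the sum of the
    squared second factors is at most 4.\<close>
  have "(\<Sum>x\<in>UNIV. \<bar>p x - q x\<bar>) = (\<Sum>x\<in>UNIV. \<bar>sqrt (p x) - sqrt (q x)\<bar> * \<bar>sqrt (p x) + sqrt (q x)\<bar>)"
  proof (intro sum.cong refl)
    fix x
    have "p x - q x = (sqrt (p x) - sqrt (q x)) * (sqrt (p x) + sqrt (q x))"
      using p(1)[of x] q(1)[of x] by (simp add: algebra_simps)
    then show "\<bar>p x - q x\<bar> = \<bar>sqrt (p x) - sqrt (q x)\<bar> * \<bar>sqrt (p x) + sqrt (q x)\<bar>"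
      by (simp only: abs_mult)
  qed
  also have "\<dots> \<le> L2_set (\<lambda>x. sqrt (p x) - sqrt (q x)) UNIV * L2_set (\<lambda>x. sqrt (p x) + sqrt (q x)) UNIV"
    by (rule L2_set_mult_ineq)
  also have "\<dots> \<le> sqrt H * sqrt 4"
    unfolding L2_set_def H_def
  proof (intro mult_left_mono real_sqrt_le_mono)
    have "(\<Sum>x\<in>UNIV. (sqrt (p x) + sqrt (q x))\<^sup>2) \<le> (\<Sum>x\<in>UNIV. 2 * p x + 2 * q x)"
    proof (intro sum_mono)
      fix x
      have "0 \<le> (sqrt (p x) - sqrt (q x))\<^sup>2" by simp
      then show "(sqrt (p x) + sqrt (q x))\<^sup>2 \<le> 2 * p x + 2 * q x"
        using p(1)[of x] q(1)[of x] by (simp add: power2_diff power2_sum)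
    qed
    then show "(\<Sum>x\<in>UNIV. (sqrt (p x) + sqrt (q x))\<^sup>2) \<le> 4"
      using p q by (simp add: sum.distrib sum_distrib_left[symmetric])
  qed (simp add: sum_nonneg)
  finally have "(\<Sum>x\<in>UNIV. \<bar>p x - q x\<bar>) \<le> 2 * sqrt H"
    by simp
  also have "\<dots> \<le> 2 * sqrt (\<Sum>x\<in>UNIV. p x * ln (p x / q x))"
    using HKL by simp
  finally have "ennreal (\<Sum>x\<in>UNIV. \<bar>p x - q x\<bar>) \<le> ennreal (2 * sqrt (\<Sum>x\<in>UNIV. p x * ln (p x / q x)))"
    by (rule ennreal_leI)
  also have "\<dots> = 2 * esqrt (KL p q)"
    unfolding KL_def if_not_P[OF False] using H0 HKL by (simp add: esqrt_ennreal ennreal_mult)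
  finally show ?thesis .
qed

lemma measurable_density_kernel:
  assumes N: "sigma_finite_measure N"
    and f: "(\<lambda>(x, y). f x y) \<in> borel_measurable (M \<Otimes>\<^sub>M N)"
    and one: "\<And>x. x \<in> space M \<Longrightarrow> (\<integral>\<^sup>+y. f x y \<partial>N) = 1"
  shows "(\<lambda>x. density N (f x)) \<in> M \<rightarrow>\<^sub>M prob_algebra N"
proof -
  interpret sigma_finite_measure N by (rule N)
  note f[measurable]
  have fx[measurable]: "x \<in> space M \<Longrightarrow> f x \<in> borel_measurable N" for x
    by measurable
  have P: "prob_space (density N (f x))" if "x \<in> space M" for x
    using that one[OF that] by (intro prob_spaceI) (simp add: emeasure_density cong: nn_integral_cong)
  show ?thesis
  proof (rule measurable_prob_algebraI[OF P], assumption, rule measurable_subprob_algebra)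
    fix A assume A[measurable]: "A \<in> sets N"
    have "(\<lambda>x. \<integral>\<^sup>+y. f x y * indicator A y \<partial>N) \<in> borel_measurable M"
      by (rule borel_measurable_nn_integral) measurable
    then show "(\<lambda>a. emeasure (density N (f a)) A) \<in> borel_measurable M"
      by (rule measurable_cong[THEN iffD1, rotated]) (simp add: emeasure_density)
  qed (auto intro: prob_space_imp_subprob_space P)
qed

lemma measurable_pmf_kernel:
  fixes p :: "'x \<Rightarrow> 'y::finite pmf"
  assumes "\<And>y. (\<lambda>x. pmf (p x) y) \<in> borel_measurable M"
  shows "(\<lambda>x. measure_pmf (p x)) \<in> M \<rightarrow>\<^sub>M prob_algebra (count_space UNIV)"
proof (rule measurable_prob_algebraI)
  show "(\<lambda>x. measure_pmf (p x)) \<in> M \<rightarrow>\<^sub>M subprob_algebra (count_space UNIV)"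
  proof (rule measurable_subprob_algebra)
    fix A :: "'y set"
    note assms[measurable]
    have "(\<lambda>x. \<Sum>y\<in>A. ennreal (pmf (p x) y)) \<in> borel_measurable M" by measurable
    then show "(\<lambda>x. emeasure (measure_pmf (p x)) A) \<in> borel_measurable M"
      by (simp add: emeasure_measure_pmf_finite)
  qed (auto intro: measure_pmf.subprob_space_axioms)
qed (rule measure_pmf.prob_space_axioms)

lemma nn_integral_pmf_finite:
  fixes p :: "'y::finite pmf"
  shows "(\<integral>\<^sup>+y. f y \<partial>measure_pmf p) = (\<Sum>y\<in>UNIV. ennreal (pmf p y) * f y)"
  by (subst nn_integral_measure_pmf_support[of UNIV]) (simp_all add: mult.commute)

section \<open>One-step conditioning under the Ionescu-Tulcea law\<close>

context Ionescu_Tulcea begin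

text \<open>\<open>CI J\<close> restricts the law of the first \<open>up_to J\<close> coordinates to
  \<open>J\<close>; on an initial segment nothing is cut off.\<close>

lemma CI_initial: "CI {0..<n} = C 0 n (\<lambda>x. undefined)"
proof -
  have "up_to {0..<n} = n"
    using up_to[of "{0..<n}"] by (intro antisym) (auto simp: up_to_iff_Ico)
  moreover have "distr (C 0 n (\<lambda>x. undefined)) (PiM {0..<n} M) (\<lambda>f. restrict f {0..<n}) =
      distr (C 0 n (\<lambda>x. undefined)) (C 0 n (\<lambda>x. undefined)) (\<lambda>f. f)"
    by (intro distr_cong) (auto simp: sets_C space_C space_PiM PiE_def extensional_restrict)
  ultimately show ?thesis
    by (simp add: CI_def)
qed

lemma prob_space_lim: "prob_space PF.lim"
proof -
  have "(\<lambda>x. restrict x {0..<0}) \<in> PF.lim \<rightarrow>\<^sub>M PiM {0..<0} M"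
    by (simp add: measurable_cong_sets[OF PF.sets_lim refl])
  then show ?thesis
    by (rule prob_space_distrD) (subst distr_lim, auto intro: PF.prob_space_P)
qed

lemma measurable_restrict_lim[measurable]: "(\<lambda>w. restrict w {0..<t}) \<in> PF.lim \<rightarrow>\<^sub>M PiM {0..<t} M"
  by (auto simp: measurable_cong_sets[OF PF.sets_lim refl] intro!: measurable_restrict_subset)

text \<open>The tower property: coordinate \<open>t\<close> is integrated against its kernel given
  the past. Every later statement about expectations along trajectories passes through this
  identity.\<close>

lemma nn_integral_lim_step:
  assumes g[measurable]: "g \<in> borel_measurable (M t)"
  shows "(\<integral>\<^sup>+w. g (w t) \<partial>PF.lim) = (\<integral>\<^sup>+w. \<integral>\<^sup>+x. g x \<partial>P t (restrict w {0..<t}) \<partial>PF.lim)"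
proof -
  have gt: "(\<lambda>w. g (w t)) \<in> borel_measurable (PiM {0..<Suc t} M)" by measurable
  have C1: "distr PF.lim (PiM {0..<n} M) (\<lambda>x. restrict x {0..<n}) = C 0 n (\<lambda>x. undefined)" for n
    by (subst distr_lim) (simp_all add: CI_initial)
  have k: "(\<lambda>w. \<integral>\<^sup>+x. g x \<partial>P t w) \<in> borel_measurable (PiM {0..<t} M)" by measurable
  have "(\<integral>\<^sup>+w. g (w t) \<partial>PF.lim) = (\<integral>\<^sup>+w. g (restrict w {0..<Suc t} t) \<partial>PF.lim)"
    by simp
  also have "\<dots> = (\<integral>\<^sup>+w. g (w t) \<partial>distr PF.lim (PiM {0..<Suc t} M) (\<lambda>x. restrict x {0..<Suc t}))"
    by (subst nn_integral_distr[OF measurable_restrict_lim]) (use gt in auto)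
  also have "\<dots> = (\<integral>\<^sup>+w. g (w t) \<partial>(C 0 t (\<lambda>x. undefined) \<bind> eP t))"
    by (simp only: C1 C.simps add_0)
  also have "\<dots> = (\<integral>\<^sup>+w. \<integral>\<^sup>+w'. g (w' t) \<partial>eP t w \<partial>C 0 t (\<lambda>x. undefined))"
    by (intro nn_integral_bind[OF gt])
      (simp add: measurable_cong_sets[OF sets_C[of "\<lambda>x. undefined" 0 t, simplified]])
  also have "\<dots> = (\<integral>\<^sup>+w. \<integral>\<^sup>+x. g x \<partial>P t w \<partial>C 0 t (\<lambda>x. undefined))"
    using gt by (intro nn_integral_cong) (simp add: nn_integral_eP space_C)
  also have "\<dots> = (\<integral>\<^sup>+w. \<integral>\<^sup>+x. g x \<partial>P t (restrict w {0..<t}) \<partial>PF.lim)"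
    using k by (simp add: C1[symmetric] nn_integral_distr[OF measurable_restrict_lim])
  finally show ?thesis .
qed

end

section \<open>Trajectory laws\<close>

locale front_door_m2dp = confounded_m2dp G Rmax pmin
  for G :: "('s, 'c, 'a::finite, 'm::finite) m2dp" and Rmax pmin :: real +
  assumes fd: "front_door G"

section \<open>Kernels of a single step\<close>

context confounded_m2dp begin

abbreviation "S \<equiv> state_base G"
abbreviation "Cf \<equiv> conf_space G"

lemma sfin_S: "sigma_finite_measure S" by (rule state_base)

lemmas [measurable] = init_meas p_c_kernel

lemma p_c_subprob[measurable]: "p_c G \<in> S \<rightarrow>\<^sub>M subprob_algebra Cf"
  by (rule measurable_prob_algebraD) (rule p_c_kernel)

lemma p_c_prob: "s \<in> space S \<Longrightarrow> prob_space (p_c G s)"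
  using measurable_space[OF p_c_kernel] by (simp add: space_prob_algebra)

lemma sets_p_c[measurable_cong]: "s \<in> space S \<Longrightarrow> sets (p_c G s) = sets Cf"
  using measurable_space[OF p_c_kernel] by (simp add: space_prob_algebra)

lemma space_p_c: "s \<in> space S \<Longrightarrow> space (p_c G s) = space Cf"
  by (rule sets_eq_imp_space_eq) (rule sets_p_c)

lemma p_r_prob: "s \<in> space S \<Longrightarrow> c \<in> space Cf \<Longrightarrow> prob_space (p_r G s c a m)"
  using measurable_space[OF p_r_kernel, of "(s, c)"] by (simp add: space_prob_algebra space_pair_measure)

lemma sets_p_r: "s \<in> space S \<Longrightarrow> c \<in> space Cf \<Longrightarrow> sets (p_r G s c a m) = sets borel"
  using measurable_space[OF p_r_kernel, of "(s, c)"] by (simp add: space_prob_algebra space_pair_measure)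

lemma space_S_ne: "space S \<noteq> {}"
proof
  assume "space S = {}"
  then have "(\<integral>\<^sup>+s. init_dens G s \<partial>S) = 0" by (rule nn_integral_empty)
  then show False using init_total by simp
qed

lemma space_Cf_ne: "space Cf \<noteq> {}"
  using space_S_ne p_c_prob prob_space.not_empty space_p_c by fastforce

text \<open>A probability measure cannot satisfy \<open>\<bar>r\<bar> \<le> Rmax\<close> almost
  everywhere for a negative \<open>Rmax\<close>, so the reward law at any one point
  suffices.\<close>

lemma Rmax_nonneg: "0 \<le> Rmax"
proof -
  obtain s c where sc: "s \<in> space S" "c \<in> space Cf" using space_S_ne space_Cf_ne by blast
  interpret prob_space "p_r G s c undefined undefined" by (rule p_r_prob) fact+
  have "AE r in p_r G s c undefined undefined. \<bar>r\<bar> \<le> Rmax" by (rule reward_bound) fact+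
  then have "AE r in p_r G s c undefined undefined. 0 \<le> Rmax" by eventually_elim simp
  then show ?thesis by simp
qed

lemma Vmax_nonneg: "0 \<le> Vmax G Rmax"
  using Rmax_nonneg disc by (simp add: Vmax_def)

lemma space_step: "space (step_space G) = space S \<times> space Cf \<times> UNIV"
  by (simp add: step_space_def space_pair_measure)

lemma measurable_step_fst[measurable]: "fst \<in> step_space G \<rightarrow>\<^sub>M S"
  by (simp add: step_space_def)

lemma measurable_reward[measurable]: "reward \<in> borel_measurable (step_space G)"
  by (simp add: step_space_def reward_def[abs_def] split_beta')

lemma measurable_observe[measurable]: "observe \<in> step_space G \<rightarrow>\<^sub>M obs_space G"
  by (simp add: step_space_def obs_space_def observe_def[abs_def] split_beta')

lemma measurable_next_dens[measurable]:
  "(\<lambda>(x, s). next_dens G x s) \<in> borel_measurable (step_space G \<Otimes>\<^sub>M S)"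
proof -
  let ?M = "step_space G \<Otimes>\<^sub>M S"
  have a: "(\<lambda>z. fst (snd (snd (fst z)))) \<in> ?M \<rightarrow>\<^sub>M count_space UNIV"
    and m: "(\<lambda>z. fst (snd (snd (snd (fst z))))) \<in> ?M \<rightarrow>\<^sub>M count_space UNIV"
    by (simp_all add: step_space_def)
  have sc: "(\<lambda>z. ((fst (fst z), fst (snd (fst z))), snd z)) \<in> ?M \<rightarrow>\<^sub>M (S \<Otimes>\<^sub>M Cf) \<Otimes>\<^sub>M S"
    unfolding step_space_def by measurable
  have "(\<lambda>z. p_s G (fst (fst z)) (fst (snd (fst z))) a m (snd z)) \<in> borel_measurable ?M" for a m
    using measurable_compose[OF sc p_s_meas[of a m]] by simp
  \<comment> \<open>Measurability of \<open>p_s\<close> is given for each fixed pair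
    \<open>(a, m)\<close>. Finiteness of both types allows the discrete coordinates to be
    substituted one after the other.\<close>
  then have "(\<lambda>z. p_s G (fst (fst z)) (fst (snd (fst z))) (fst (snd (snd (fst z)))) m (snd z))
      \<in> borel_measurable ?M" for m
    by (rule measurable_compose_countable[OF _ a])
  then have "(\<lambda>z. p_s G (fst (fst z)) (fst (snd (fst z))) (fst (snd (snd (fst z))))
      (fst (snd (snd (snd (fst z))))) (snd z)) \<in> borel_measurable ?M"
    by (rule measurable_compose_countable[OF _ m])
  then show ?thesis by (simp add: next_dens_def split_beta')
qed

lemma next_dens_total: "x \<in> space (step_space G) \<Longrightarrow> (\<integral>\<^sup>+s. next_dens G x s \<partial>S) = 1"
  by (auto simp: next_dens_def space_step intro!: p_s_total)

lemma measurable_reward_step: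
  "(\<lambda>(s, c). reward_step G s c a m) \<in> S \<Otimes>\<^sub>M Cf \<rightarrow>\<^sub>M prob_algebra (step_space G)"
proof -
  have "(\<lambda>((s, c), r). (s, c, a, m, r)) \<in> (S \<Otimes>\<^sub>M Cf) \<Otimes>\<^sub>M borel \<rightarrow>\<^sub>M step_space G"
    unfolding step_space_def split_beta' by measurable
  then show ?thesis
    using measurable_distr_prob_space2[OF p_r_kernel[of a m], of "\<lambda>(s, c) r. (s, c, a, m, r)" "step_space G"]
    by (simp add: reward_step_def split_beta')
qed

lemma nn_integral_reward_step:
  assumes "s \<in> space S" "c \<in> space Cf" and g: "g \<in> borel_measurable (step_space G)"
  shows "(\<integral>\<^sup>+x. g x \<partial>reward_step G s c a m) = (\<integral>\<^sup>+r. g (s, c, a, m, r) \<partial>p_r G s c a m)"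
proof -
  have "(\<lambda>r. (s, c, a, m, r)) \<in> borel \<rightarrow>\<^sub>M step_space G"
    unfolding step_space_def using assms by measurable
  then have "(\<lambda>r. (s, c, a, m, r)) \<in> p_r G s c a m \<rightarrow>\<^sub>M step_space G"
    by (simp add: measurable_cong_sets[OF sets_p_r[OF assms(1,2)] refl])
  then show ?thesis unfolding reward_step_def by (subst nn_integral_distr) (use g in auto)
qed

text \<open>Isolates the part of a step after the state has been drawn. Only this part sees the
  action rule, so policies are compared through it.\<close>

definition state_step :: "('s \<Rightarrow> 'c \<Rightarrow> 'a pmf) \<Rightarrow> 's \<Rightarrow> ('s, 'c, 'a, 'm) step measure" where
  "state_step act s = p_c G s \<bind> (\<lambda>c. measure_pmf (act s c) \<bind> (\<lambda>a.
     measure_pmf (p_m G s c a) \<bind> (\<lambda>m. reward_step G s c a m)))"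

lemma step_kernel_state_step:
  "step_kernel G act t w =
    density S (if t = 0 then init_dens G else next_dens G (w (t - 1))) \<bind> state_step (act t w)"
  by (simp add: step_kernel_def state_step_def[abs_def])

lemma measurable_state_step_a:
  "(\<lambda>(s, c, a). measure_pmf (p_m G s c a) \<bind> (\<lambda>m. reward_step G s c a m))
    \<in> S \<Otimes>\<^sub>M (Cf \<Otimes>\<^sub>M count_space UNIV) \<rightarrow>\<^sub>M prob_algebra (step_space G)"
proof -
  have 1: "(\<lambda>z. measure_pmf (p_m G (fst z) (snd z) a)) \<in> S \<Otimes>\<^sub>M Cf \<rightarrow>\<^sub>M prob_algebra (count_space UNIV)" for a
    using p_m_meas[of a] by (intro measurable_pmf_kernel) (simp add: split_beta')
  have m: "snd \<in> (S \<Otimes>\<^sub>M Cf) \<Otimes>\<^sub>M count_space UNIV \<rightarrow>\<^sub>M (count_space UNIV :: 'm measure)" by simp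
  have "(\<lambda>y. reward_step G (fst (fst y)) (snd (fst y)) a m) \<in> (S \<Otimes>\<^sub>M Cf) \<Otimes>\<^sub>M count_space UNIV \<rightarrow>\<^sub>M prob_algebra (step_space G)" for a and m :: 'm
    using measurable_compose[OF measurable_fst measurable_reward_step[of a m]] by (simp add: split_beta')
  then have 2: "(\<lambda>(z, m). reward_step G (fst z) (snd z) a m) \<in> (S \<Otimes>\<^sub>M Cf) \<Otimes>\<^sub>M count_space UNIV \<rightarrow>\<^sub>M prob_algebra (step_space G)" for a
    unfolding split_beta' by (rule measurable_compose_countable[OF _ m])
  have 3: "(\<lambda>z. measure_pmf (p_m G (fst z) (snd z) a) \<bind> (\<lambda>m. reward_step G (fst z) (snd z) a m))
     \<in> S \<Otimes>\<^sub>M Cf \<rightarrow>\<^sub>M prob_algebra (step_space G)" for a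
    by (rule measurable_bind_prob_space2[OF 1 2])
  have 4: "(\<lambda>x. measure_pmf (p_m G (fst x) (fst (snd x)) a) \<bind> (\<lambda>m. reward_step G (fst x) (fst (snd x)) a m))
    \<in> S \<Otimes>\<^sub>M (Cf \<Otimes>\<^sub>M count_space UNIV) \<rightarrow>\<^sub>M prob_algebra (step_space G)" for a
    using measurable_compose[OF _ 3[of a], of "\<lambda>x. (fst x, fst (snd x))" "S \<Otimes>\<^sub>M (Cf \<Otimes>\<^sub>M count_space UNIV)"] by simp
  show ?thesis
    unfolding split_beta' by (rule measurable_compose_countable[OF 4]) simp
qed

text \<open>The parameter \<open>x\<close> stands for the history, on which an online policy may
  depend.\<close>

lemma measurable_state_step:
  assumes act: "\<And>a. (\<lambda>((x, s), c). pmf (act x s c) a) \<in> borel_measurable ((X \<Otimes>\<^sub>M S) \<Otimes>\<^sub>M Cf)"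
  shows "(\<lambda>(x, s). state_step (act x) s) \<in> X \<Otimes>\<^sub>M S \<rightarrow>\<^sub>M prob_algebra (step_space G)"
proof -
  have 1: "(\<lambda>z. measure_pmf (act (fst (fst z)) (snd (fst z)) (snd z))) \<in> (X \<Otimes>\<^sub>M S) \<Otimes>\<^sub>M Cf \<rightarrow>\<^sub>M prob_algebra (count_space UNIV)"
    using act by (intro measurable_pmf_kernel) (simp add: split_beta')
  have 2: "(\<lambda>(z, a). measure_pmf (p_m G (snd (fst z)) (snd z) a) \<bind> (\<lambda>m. reward_step G (snd (fst z)) (snd z) a m))
      \<in> ((X \<Otimes>\<^sub>M S) \<Otimes>\<^sub>M Cf) \<Otimes>\<^sub>M count_space UNIV \<rightarrow>\<^sub>M prob_algebra (step_space G)"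
    using measurable_compose[OF _ measurable_state_step_a, of "\<lambda>(((x, s), c), a). (s, c, a)" "((X \<Otimes>\<^sub>M S) \<Otimes>\<^sub>M Cf) \<Otimes>\<^sub>M count_space UNIV"]
    by (simp add: split_beta')
  have 3: "(\<lambda>(z, c). measure_pmf (act (fst z) (snd z) c) \<bind> (\<lambda>a. measure_pmf (p_m G (snd z) c a) \<bind> (\<lambda>m. reward_step G (snd z) c a m)))
      \<in> (X \<Otimes>\<^sub>M S) \<Otimes>\<^sub>M Cf \<rightarrow>\<^sub>M prob_algebra (step_space G)"
    using measurable_bind_prob_space2[OF 1 2] by (simp add: split_beta')
  have 4: "(\<lambda>z. p_c G (snd z)) \<in> X \<Otimes>\<^sub>M S \<rightarrow>\<^sub>M prob_algebra Cf"
    by measurable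
  show ?thesis
    using measurable_bind_prob_space2[OF 4 3] by (simp add: split_beta' state_step_def)
qed

lemma measurable_state_step1:
  assumes act: "\<And>a. (\<lambda>(s, c). pmf (act s c) a) \<in> borel_measurable (S \<Otimes>\<^sub>M Cf)"
  shows "state_step act \<in> S \<rightarrow>\<^sub>M prob_algebra (step_space G)"
proof -
  \<comment> \<open>A dummy parameter in \<open>nat\<close>, finally set to 0, reduces the claim to
    the parametrised lemma.\<close>
  have "(\<lambda>((x::nat, s), c). pmf (act s c) a) \<in> borel_measurable ((count_space UNIV \<Otimes>\<^sub>M S) \<Otimes>\<^sub>M Cf)" for a
    using measurable_compose[OF _ act[of a], of "\<lambda>((x, s), c). (s, c)" "((count_space UNIV :: nat measure) \<Otimes>\<^sub>M S) \<Otimes>\<^sub>M Cf"]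
    by (simp add: split_beta')
  from measurable_state_step[of "\<lambda>_. act", OF this]
  have "(\<lambda>(x::nat, s). state_step act s) \<in> count_space UNIV \<Otimes>\<^sub>M S \<rightarrow>\<^sub>M prob_algebra (step_space G)" .
  from measurable_compose[OF measurable_Pair1' this, of 0] show ?thesis by simp
qed

lemma nn_integral_state_step:
  assumes s: "s \<in> space S" and act: "\<And>a. (\<lambda>c. pmf (act s c) a) \<in> borel_measurable Cf"
    and g: "g \<in> borel_measurable (step_space G)"
  shows "(\<integral>\<^sup>+x. g x \<partial>state_step act s) = (\<integral>\<^sup>+c. (\<Sum>a\<in>UNIV. ennreal (pmf (act s c) a) *
     (\<Sum>m\<in>UNIV. ennreal (pmf (p_m G s c a) m) * (\<integral>\<^sup>+r. g (s, c, a, m, r) \<partial>p_r G s c a m))) \<partial>p_c G s)"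
proof -
  note [measurable_cong] = sets_p_c[OF s]
  have P: "Pair s \<in> (Cf \<Otimes>\<^sub>M count_space UNIV) \<rightarrow>\<^sub>M S \<Otimes>\<^sub>M (Cf \<Otimes>\<^sub>M count_space UNIV)"
    using s by (rule measurable_Pair1')
  have 2: "(\<lambda>(c, a). measure_pmf (p_m G s c a) \<bind> (\<lambda>m. reward_step G s c a m))
    \<in> Cf \<Otimes>\<^sub>M count_space UNIV \<rightarrow>\<^sub>M prob_algebra (step_space G)"
    using measurable_compose[OF P measurable_state_step_a] by simp
  have 3: "(\<lambda>c. measure_pmf (act s c) \<bind> (\<lambda>a. measure_pmf (p_m G s c a) \<bind> (\<lambda>m. reward_step G s c a m)))
    \<in> Cf \<rightarrow>\<^sub>M prob_algebra (step_space G)"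
    by (rule measurable_bind_prob_space2[OF measurable_pmf_kernel[OF act] 2])
  have 4: "reward_step G s c a m \<in> space (subprob_algebra (step_space G))" if "c \<in> space Cf" for c a m
    using measurable_space[OF measurable_prob_algebraD[OF measurable_reward_step[of a m]], of "(s, c)"] that s
    by (simp add: space_pair_measure)
  have 5: "measure_pmf (p_m G s c a) \<bind> (\<lambda>m. reward_step G s c a m) \<in> space (subprob_algebra (step_space G))"
    if "c \<in> space Cf" for c a
    using measurable_space[OF measurable_prob_algebraD[OF 2], of "(c, a)"] that by (simp add: space_pair_measure)
  have 6: "(\<lambda>c. measure_pmf (act s c) \<bind> (\<lambda>a. measure_pmf (p_m G s c a) \<bind> (\<lambda>m. reward_step G s c a m)))
    \<in> p_c G s \<rightarrow>\<^sub>M subprob_algebra (step_space G)"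
    using measurable_prob_algebraD[OF 3] by (simp add: measurable_cong_sets[OF sets_p_c[OF s] refl])
  show ?thesis
    unfolding state_step_def nn_integral_bind[OF g 6]
  proof (intro nn_integral_cong)
    fix c assume "c \<in> space (p_c G s)"
    then have c: "c \<in> space Cf" using s by (simp add: space_p_c)
    have 7: "(\<lambda>a. measure_pmf (p_m G s c a) \<bind> (\<lambda>m. reward_step G s c a m))
        \<in> measure_pmf (act s c) \<rightarrow>\<^sub>M subprob_algebra (step_space G)"
      using 5[OF c] by (simp add: measurable_pmf_measure1)
    have 8: "(\<lambda>m. reward_step G s c a m) \<in> measure_pmf (p_m G s c a) \<rightarrow>\<^sub>M subprob_algebra (step_space G)" for a
      using 4[OF c] by (simp add: measurable_pmf_measure1)
    show "(\<integral>\<^sup>+x. g x \<partial>(measure_pmf (act s c) \<bind> (\<lambda>a. measure_pmf (p_m G s c a) \<bind> (\<lambda>m. reward_step G s c a m)))) =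
      (\<Sum>a\<in>UNIV. ennreal (pmf (act s c) a) *
       (\<Sum>m\<in>UNIV. ennreal (pmf (p_m G s c a) m) * (\<integral>\<^sup>+r. g (s, c, a, m, r) \<partial>p_r G s c a m)))"
      by (simp add: nn_integral_bind[OF g 7] nn_integral_bind[OF g 8] nn_integral_pmf_finite
          nn_integral_reward_step[OF s c g])
  qed
qed

end

lemma sum_pmf_UNIV: "(\<Sum>x\<in>UNIV. pmf p x) = 1" for p :: "'y::finite pmf"
  by (rule sum_pmf_eq_1) auto

lemma sum_pmf_UNIV_ennreal: "(\<Sum>x\<in>UNIV. ennreal (pmf p x)) = 1" for p :: "'y::finite pmf"
  by (subst sum_ennreal) (auto simp: sum_pmf_UNIV)

lemma sum_pmf_mult_const: "(\<Sum>x\<in>UNIV. ennreal (pmf p x) * c) = c" for p :: "'y::finite pmf"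
  by (simp add: sum_distrib_right[symmetric] sum_pmf_UNIV_ennreal)

section \<open>Trajectory laws generated by action rules\<close>

context confounded_m2dp begin

abbreviation Hist :: "nat \<Rightarrow> (nat \<Rightarrow> ('s, 'c, 'a, 'm) step) measure" where
  "Hist t \<equiv> PiM {0..<t} (\<lambda>_. step_space G)"

definition state_cond_dens :: "nat \<Rightarrow> (nat \<Rightarrow> ('s, 'c, 'a, 'm) step) \<Rightarrow> 's \<Rightarrow> ennreal" where
  "state_cond_dens t w = (if t = 0 then init_dens G else next_dens G (w (t - 1)))"

lemma space_Hist_step: "w \<in> space (Hist t) \<Longrightarrow> i < t \<Longrightarrow> w i \<in> space (step_space G)"
  by (auto simp: space_PiM PiE_iff)

lemma measurable_state_cond_dens[measurable]:
  "(\<lambda>(w, s). state_cond_dens t w s) \<in> borel_measurable (Hist t \<Otimes>\<^sub>M S)"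
proof (cases "t = 0")
  case True
  then show ?thesis by (simp add: state_cond_dens_def)
next
  case False
  then have "(\<lambda>z. (fst z (t - 1), snd z)) \<in> Hist t \<Otimes>\<^sub>M S \<rightarrow>\<^sub>M step_space G \<Otimes>\<^sub>M S"
    by (intro measurable_Pair measurable_compose[OF measurable_fst measurable_component_singleton]) auto
  from measurable_compose[OF this measurable_next_dens] show ?thesis
    using False by (simp add: state_cond_dens_def split_beta')
qed

lemma state_cond_dens_total: "w \<in> space (Hist t) \<Longrightarrow> (\<integral>\<^sup>+s. state_cond_dens t w s \<partial>S) = 1"
  using space_Hist_step[of w t "t - 1"]
  by (cases "t = 0") (simp_all add: state_cond_dens_def init_total next_dens_total)

lemma measurable_state_cond_kernel:
  "(\<lambda>w. density S (state_cond_dens t w)) \<in> Hist t \<rightarrow>\<^sub>M prob_algebra S"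
  by (rule measurable_density_kernel[OF sfin_S measurable_state_cond_dens state_cond_dens_total])

text \<open>One measurability notion for both regimes: the behaviour policy sees \<open>c\<close>,
  an online policy sees the history.\<close>

definition admissible ::
  "(nat \<Rightarrow> (nat \<Rightarrow> ('s, 'c, 'a, 'm) step) \<Rightarrow> 's \<Rightarrow> 'c \<Rightarrow> 'a pmf) \<Rightarrow> bool" where
  "admissible act \<longleftrightarrow> (\<forall>t a. (\<lambda>((w, s), c). pmf (act t w s c) a)
     \<in> borel_measurable ((Hist t \<Otimes>\<^sub>M S) \<Otimes>\<^sub>M Cf))"

lemma admissible_section:
  assumes "admissible act" "w \<in> space (Hist t)"
  shows "(\<lambda>(s, c). pmf (act t w s c) a) \<in> borel_measurable (S \<Otimes>\<^sub>M Cf)"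
proof -
  have "(\<lambda>((w, s), c). pmf (act t w s c) a) \<in> borel_measurable ((Hist t \<Otimes>\<^sub>M S) \<Otimes>\<^sub>M Cf)"
    using assms(1) by (auto simp: admissible_def)
  from measurable_compose[OF _ this, of "\<lambda>(s, c). ((w, s), c)" "S \<Otimes>\<^sub>M Cf"] show ?thesis
    using assms(2) by (simp add: split_beta')
qed

lemma measurable_step_kernel:
  assumes "admissible act"
  shows "step_kernel G act t \<in> Hist t \<rightarrow>\<^sub>M prob_algebra (step_space G)"
proof -
  have "(\<lambda>(w, s). state_step (act t w) s) \<in> Hist t \<Otimes>\<^sub>M S \<rightarrow>\<^sub>M prob_algebra (step_space G)"
    by (rule measurable_state_step) (use assms in \<open>simp add: admissible_def\<close>)
  from measurable_bind_prob_space2[OF measurable_state_cond_kernel this] show ?thesis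
    by (simp add: step_kernel_state_step[abs_def] state_cond_dens_def)
qed

lemma nn_integral_step_kernel:
  assumes act: "admissible act" and w: "w \<in> space (Hist t)" and g: "g \<in> borel_measurable (step_space G)"
  shows "(\<integral>\<^sup>+x. g x \<partial>step_kernel G act t w) =
    (\<integral>\<^sup>+s. state_cond_dens t w s * (\<integral>\<^sup>+x. g x \<partial>state_step (act t w) s) \<partial>S)"
proof -
  have k: "state_step (act t w) \<in> S \<rightarrow>\<^sub>M subprob_algebra (step_space G)"
    by (intro measurable_prob_algebraD measurable_state_step1 admissible_section act w)
  then have "state_step (act t w) \<in> density S (state_cond_dens t w) \<rightarrow>\<^sub>M subprob_algebra (step_space G)"
    by simp
  moreover have "(\<lambda>s. \<integral>\<^sup>+x. g x \<partial>state_step (act t w) s) \<in> borel_measurable S"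
    by (rule measurable_compose[OF k nn_integral_measurable_subprob_algebra[OF g]])
  moreover have "state_cond_dens t w \<in> borel_measurable S"
    using w by measurable
  ultimately show ?thesis
    unfolding step_kernel_state_step
    by (simp add: nn_integral_bind[OF g] nn_integral_density state_cond_dens_def[symmetric])
qed

lemma act_state_step_measurable:
  assumes act: "admissible act" and w: "w \<in> space (Hist t)" and s: "s \<in> space S"
  shows "(\<lambda>c. pmf (act t w s c) a) \<in> borel_measurable Cf"
  using measurable_compose[OF measurable_Pair1'[OF s] admissible_section[OF act w]] by simp

lemma nn_integral_state_step_fst:
  assumes s: "s \<in> space S" and act: "\<And>a. (\<lambda>c. pmf (act s c) a) \<in> borel_measurable Cf"
    and W: "W \<in> borel_measurable S"
  shows "(\<integral>\<^sup>+x. W (fst x) \<partial>state_step act s) = W s"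
proof -
  have "(\<integral>\<^sup>+x. W (fst x) \<partial>state_step act s) = (\<integral>\<^sup>+c. W s \<partial>p_c G s)"
    unfolding nn_integral_state_step[where act=act and s=s, OF s act measurable_compose[OF measurable_step_fst W]]
  proof (intro nn_integral_cong)
    fix c assume "c \<in> space (p_c G s)"
    then have "emeasure (p_r G s c a m) (space (p_r G s c a m)) = 1" for a m
      using prob_space.emeasure_space_1[OF p_r_prob[OF s]] by (simp add: space_p_c[OF s])
    then show "(\<Sum>a\<in>UNIV. ennreal (pmf (act s c) a) * (\<Sum>m\<in>UNIV. ennreal (pmf (p_m G s c a) m) *
        (\<integral>\<^sup>+r. W (fst (s, c, a, m, r)) \<partial>p_r G s c a m))) = W s"
      by (simp add: sum_pmf_mult_const)
  qed
  also have "\<dots> = W s" using prob_space.emeasure_space_1[OF p_c_prob[OF s]] by simp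
  finally show ?thesis .
qed

text \<open>The almost sure reward bound is carried as a vanishing integral of the indicator of its
  violation. In this form it passes through iterated integrals like any other expectation.\<close>

lemma nn_integral_state_step_reward:
  assumes s: "s \<in> space S" and act: "\<And>a. (\<lambda>c. pmf (act s c) a) \<in> borel_measurable Cf"
  shows "(\<integral>\<^sup>+x. indicator {x. \<not> \<bar>reward x\<bar> \<le> Rmax} x \<partial>state_step act s) = 0"
proof -
  have m: "(\<lambda>x. indicator {x. \<not> \<bar>reward x\<bar> \<le> Rmax} x :: ennreal) \<in> borel_measurable (step_space G)"
    unfolding indicator_def by measurable
  have "(\<integral>\<^sup>+r. indicator {x. \<not> \<bar>reward x\<bar> \<le> Rmax} (s, c, a, m, r) \<partial>p_r G s c a m) = 0"
    if "c \<in> space Cf" for c a m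
  proof -
    have "AE r in p_r G s c a m. indicator {x. \<not> \<bar>reward x\<bar> \<le> Rmax} (s, c, a, m, r) = (0::ennreal)"
      using reward_bound[OF s that] by eventually_elim (simp add: reward_def)
    then show ?thesis by (simp add: nn_integral_cong_AE)
  qed
  then show ?thesis
    by (subst nn_integral_state_step[where act=act and s=s, OF s act m]) (auto simp: space_p_c[OF s] cong: nn_integral_cong_simp)
qed

text \<open>Wider than the kernels \<open>step_kernel G act\<close>: the mediated law starts with a
  kernel of another shape.\<close>

definition step_system ::
  "(nat \<Rightarrow> (nat \<Rightarrow> ('s, 'c, 'a, 'm) step) \<Rightarrow> ('s, 'c, 'a, 'm) step measure) \<Rightarrow> bool" where
  "step_system K \<longleftrightarrow> (\<forall>t. K t \<in> Hist t \<rightarrow>\<^sub>M prob_algebra (step_space G))"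

lemma step_system_Ionescu_Tulcea:
  assumes "step_system K" shows "Ionescu_Tulcea K (\<lambda>_. step_space G)"
proof (rule Ionescu_Tulcea.intro)
  have K: "K t \<in> Hist t \<rightarrow>\<^sub>M prob_algebra (step_space G)" for t
    using assms by (simp add: step_system_def)
  fix t
  show "K t \<in> Hist t \<rightarrow>\<^sub>M subprob_algebra (step_space G)"
    by (rule measurable_prob_algebraD[OF K])
  fix x assume "x \<in> space (Hist t)"
  from measurable_space[OF K this] show "prob_space (K t x)" by (simp add: space_prob_algebra)
qed

lemma traj_law_prob: "step_system K \<Longrightarrow> prob_space (traj_law G K)"
  unfolding traj_law_def by (intro Ionescu_Tulcea.prob_space_lim step_system_Ionescu_Tulcea)

lemma sets_traj_law[measurable_cong]: "step_system K \<Longrightarrow> sets (traj_law G K) = sets (PiM UNIV (\<lambda>_. step_space G))"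
proof -
  assume "step_system K"
  then interpret Ionescu_Tulcea K "\<lambda>_. step_space G" by (rule step_system_Ionescu_Tulcea)
  show ?thesis by (simp add: traj_law_def)
qed

lemma measurable_traj_component[measurable]:
  "step_system K \<Longrightarrow> (\<lambda>w. w t) \<in> traj_law G K \<rightarrow>\<^sub>M step_space G"
  by (simp add: measurable_cong_sets[OF sets_traj_law refl])

lemma measurable_traj_restrict[measurable]:
  "step_system K \<Longrightarrow> (\<lambda>w. restrict w {0..<t}) \<in> traj_law G K \<rightarrow>\<^sub>M Hist t"
  by (simp add: measurable_cong_sets[OF sets_traj_law refl] measurable_restrict_subset)

lemma traj_restrict_space: "step_system K \<Longrightarrow> w \<in> space (traj_law G K) \<Longrightarrow> restrict w {0..<t} \<in> space (Hist t)"
  using measurable_space[OF measurable_traj_restrict] by blast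

lemma traj_component_space: "step_system K \<Longrightarrow> w \<in> space (traj_law G K) \<Longrightarrow> w t \<in> space (step_space G)"
  using measurable_space[OF measurable_traj_component] by blast

lemma nn_integral_traj_step:
  assumes K: "step_system K" and g: "g \<in> borel_measurable (step_space G)"
  shows "(\<integral>\<^sup>+w. g (w t) \<partial>traj_law G K) = (\<integral>\<^sup>+w. \<integral>\<^sup>+x. g x \<partial>K t (restrict w {0..<t}) \<partial>traj_law G K)"
  unfolding traj_law_def
  by (rule Ionescu_Tulcea.nn_integral_lim_step[OF step_system_Ionescu_Tulcea[OF K] g])

text \<open>\<open>K\<close> is prescribed at the single time \<open>t\<close>, so the lemma also
  covers the mediated law at times \<open>t \<ge> 1\<close>. The draws after the state are
  probability measures and integrate out.\<close>

lemma nn_integral_traj_state: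
  assumes K: "step_system K" and act: "admissible act" and Kt: "K t = step_kernel G act t"
    and W: "W \<in> borel_measurable S"
  shows "(\<integral>\<^sup>+w. W (fst (w t)) \<partial>traj_law G K) =
    (\<integral>\<^sup>+w. \<integral>\<^sup>+s. state_cond_dens t (restrict w {0..<t}) s * W s \<partial>S \<partial>traj_law G K)"
proof -
  have g: "(\<lambda>x. W (fst x)) \<in> borel_measurable (step_space G)"
    by (rule measurable_compose[OF measurable_step_fst W])
  show ?thesis
    unfolding nn_integral_traj_step[OF K g] Kt
  proof (intro nn_integral_cong)
    fix w assume "w \<in> space (traj_law G K)"
    then have w: "restrict w {0..<t} \<in> space (Hist t)" by (rule traj_restrict_space[OF K])
    show "(\<integral>\<^sup>+x. W (fst x) \<partial>step_kernel G act t (restrict w {0..<t})) =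
        (\<integral>\<^sup>+s. state_cond_dens t (restrict w {0..<t}) s * W s \<partial>S)"
      unfolding nn_integral_step_kernel[OF act w g]
      by (intro nn_integral_cong)
        (simp add: nn_integral_state_step_fst[where act="act t (restrict w {0..<t})", OF _ act_state_step_measurable[OF act w] W])
  qed
qed

lemma nn_integral_traj_le:
  assumes K: "step_system K" and act: "admissible act" and Kt: "K t = step_kernel G act t"
    and W: "W \<in> borel_measurable S" and g: "g \<in> borel_measurable (step_space G)"
    and le: "\<And>w s. w \<in> space (Hist t) \<Longrightarrow> s \<in> space S \<Longrightarrow> (\<integral>\<^sup>+x. g x \<partial>state_step (act t w) s) \<le> W s"
  shows "(\<integral>\<^sup>+w. g (w t) \<partial>traj_law G K) \<le> (\<integral>\<^sup>+w. W (fst (w t)) \<partial>traj_law G K)"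
  unfolding nn_integral_traj_step[OF K g] nn_integral_traj_state[OF K act Kt W] Kt
  by (intro nn_integral_mono)
    (auto simp: nn_integral_step_kernel[OF act _ g] traj_restrict_space[OF K] intro!: nn_integral_mono mult_left_mono le)

lemma nn_integral_traj_eq:
  assumes K: "step_system K" and act: "admissible act" and Kt: "K t = step_kernel G act t"
    and W: "W \<in> borel_measurable S" and g: "g \<in> borel_measurable (step_space G)"
    and eq: "\<And>w s. w \<in> space (Hist t) \<Longrightarrow> s \<in> space S \<Longrightarrow> (\<integral>\<^sup>+x. g x \<partial>state_step (act t w) s) = W s"
  shows "(\<integral>\<^sup>+w. g (w t) \<partial>traj_law G K) = (\<integral>\<^sup>+w. W (fst (w t)) \<partial>traj_law G K)"
  unfolding nn_integral_traj_step[OF K g] nn_integral_traj_state[OF K act Kt W] Kt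
  by (intro nn_integral_cong)
    (auto simp: nn_integral_step_kernel[OF act _ g] traj_restrict_space[OF K] eq intro!: nn_integral_cong)

lemma nn_integral_traj_next_state:
  assumes K: "step_system K" and act: "admissible act" and Kt: "K (Suc t) = step_kernel G act (Suc t)"
    and W: "W \<in> borel_measurable S"
  shows "(\<integral>\<^sup>+w. W (fst (w (Suc t))) \<partial>traj_law G K) =
    (\<integral>\<^sup>+w. \<integral>\<^sup>+s. next_dens G (w t) s * W s \<partial>S \<partial>traj_law G K)"
  unfolding nn_integral_traj_state[OF K act Kt W] by (simp add: state_cond_dens_def)

lemma AE_traj_reward:
  assumes K: "step_system K"
    and 0: "\<And>w. w \<in> space (Hist t) \<Longrightarrow> (\<integral>\<^sup>+x. indicator {x. \<not> \<bar>reward x\<bar> \<le> Rmax} x \<partial>K t w) = 0"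
  shows "AE w in traj_law G K. \<bar>reward (w t)\<bar> \<le> Rmax"
proof -
  have m: "(\<lambda>x. indicator {x. \<not> \<bar>reward x\<bar> \<le> Rmax} x :: ennreal) \<in> borel_measurable (step_space G)"
    unfolding indicator_def by measurable
  have "(\<integral>\<^sup>+w. indicator {x. \<not> \<bar>reward x\<bar> \<le> Rmax} (w t) \<partial>traj_law G K) = 0"
    unfolding nn_integral_traj_step[OF K m]
    by (simp add: 0 traj_restrict_space[OF K] cong: nn_integral_cong_simp)
  moreover have "(\<lambda>w. indicator {x. \<not> \<bar>reward x\<bar> \<le> Rmax} (w t) :: ennreal) \<in> borel_measurable (traj_law G K)"
    using K m by measurable
  ultimately have "AE w in traj_law G K. indicator {x. \<not> \<bar>reward x\<bar> \<le> Rmax} (w t) = (0::ennreal)"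
    by (simp add: nn_integral_0_iff_AE)
  then show ?thesis by eventually_elim (auto simp: indicator_def split: if_splits)
qed

lemma step_kernel_reward:
  assumes act: "admissible act" and w: "w \<in> space (Hist t)"
  shows "(\<integral>\<^sup>+x. indicator {x. \<not> \<bar>reward x\<bar> \<le> Rmax} x \<partial>step_kernel G act t w) = 0"
proof -
  have m: "(\<lambda>x. indicator {x. \<not> \<bar>reward x\<bar> \<le> Rmax} x :: ennreal) \<in> borel_measurable (step_space G)"
    unfolding indicator_def by measurable
  show ?thesis
    unfolding nn_integral_step_kernel[OF act w m]
    by (simp add: nn_integral_state_step_reward act_state_step_measurable[OF act w] cong: nn_integral_cong_simp)
qed

lemma step_system_step_kernel: "admissible act \<Longrightarrow> step_system (step_kernel G act)"
  by (simp add: step_system_def measurable_step_kernel)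

lemma admissible_offline: "admissible (\<lambda>t w s c. p_a G s c)"
  unfolding admissible_def
proof safe
  fix t a
  show "(\<lambda>((w, s), c). pmf (p_a G s c) a) \<in> borel_measurable ((Hist t \<Otimes>\<^sub>M S) \<Otimes>\<^sub>M Cf)"
    using measurable_compose[OF _ p_a_meas[of a], of "\<lambda>((w, s), c). (s, c)" "(Hist t \<Otimes>\<^sub>M S) \<Otimes>\<^sub>M Cf"]
    by (simp add: split_beta')
qed

lemma admissible_online:
  assumes "\<pi> \<in> policies G"
  shows "admissible (\<lambda>t w s c. \<pi> t (\<lambda>i\<in>{0..<t}. observe (w i)) s)"
  unfolding admissible_def
proof safe
  fix t a
  have 1: "(\<lambda>(h, s). pmf (\<pi> t h s) a) \<in> borel_measurable (PiM {0..<t} (\<lambda>_. obs_space G) \<Otimes>\<^sub>M S)"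
    using assms by (auto simp: policies_def)
  have 2: "(\<lambda>((w, s), c). ((\<lambda>i\<in>{0..<t}. observe (w i)), s)) \<in> (Hist t \<Otimes>\<^sub>M S) \<Otimes>\<^sub>M Cf \<rightarrow>\<^sub>M
      PiM {0..<t} (\<lambda>_. obs_space G) \<Otimes>\<^sub>M S"
    unfolding split_beta'
    by (intro measurable_Pair measurable_restrict measurable_compose[OF _ measurable_observe]
      measurable_compose[OF measurable_fst measurable_compose[OF measurable_fst measurable_component_singleton]])
      auto
  show "(\<lambda>((w, s), c). pmf (\<pi> t (\<lambda>i\<in>{0..<t}. observe (w i)) s) a)
      \<in> borel_measurable ((Hist t \<Otimes>\<^sub>M S) \<Otimes>\<^sub>M Cf)"
    using measurable_compose[OF 2 1] by (simp add: split_beta')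
qed

lemma state_dens_measurable:
  assumes K: "step_system K" shows "state_dens G (traj_law G K) t \<in> borel_measurable S"
proof (cases t)
  case 0
  then have "state_dens G (traj_law G K) t = init_dens G" by (simp add: fun_eq_iff)
  then show ?thesis by simp
next
  case (Suc k)
  interpret L: prob_space "traj_law G K" by (rule traj_law_prob[OF K])
  have eq: "state_dens G (traj_law G K) t = (\<lambda>s. \<integral>\<^sup>+w. next_dens G (w k) s \<partial>traj_law G K)"
    by (simp add: fun_eq_iff Suc)
  have "(\<lambda>z. (snd z k, fst z)) \<in> S \<Otimes>\<^sub>M traj_law G K \<rightarrow>\<^sub>M step_space G \<Otimes>\<^sub>M S"
    by (intro measurable_Pair measurable_compose[OF measurable_snd measurable_traj_component[OF K]]) simp
  from measurable_compose[OF this measurable_next_dens]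
  have "(\<lambda>(s, w). next_dens G (w k) s) \<in> borel_measurable (S \<Otimes>\<^sub>M traj_law G K)"
    by (simp add: split_beta')
  then show ?thesis unfolding eq by (rule L.borel_measurable_nn_integral)
qed

text \<open>Justifies reading \<open>state_dens\<close> as the density of the state at time
  \<open>t\<close>. For \<open>t > 0\<close> the expectation over trajectories and the integral over
  the next state are exchanged.\<close>

lemma nn_integral_state_dens:
  assumes act: "admissible act" and W[measurable]: "W \<in> borel_measurable S"
  defines "L \<equiv> traj_law G (step_kernel G act)"
  shows "(\<integral>\<^sup>+w. W (fst (w t)) \<partial>L) = (\<integral>\<^sup>+s. state_dens G L t s * W s \<partial>S)"
proof -
  note K = step_system_step_kernel[OF act]
  interpret L: prob_space L unfolding L_def by (rule traj_law_prob[OF K])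
  interpret SS: sigma_finite_measure S by (rule sfin_S)
  interpret LS: pair_sigma_finite S L ..
  show ?thesis
  proof (cases t)
    case 0
    then show ?thesis unfolding L_def
      by (subst nn_integral_traj_state[OF K act refl W])
        (use L.emeasure_space_1 in \<open>simp add: state_cond_dens_def L_def\<close>)
  next
    case (Suc k)
    have "(\<lambda>z. (snd z k, fst z)) \<in> S \<Otimes>\<^sub>M L \<rightarrow>\<^sub>M step_space G \<Otimes>\<^sub>M S"
      unfolding L_def
      by (intro measurable_Pair measurable_compose[OF measurable_snd measurable_traj_component[OF K]]) simp
    from measurable_compose[OF this measurable_next_dens]
    have m[measurable]: "(\<lambda>z. next_dens G (snd z k) (fst z)) \<in> borel_measurable (S \<Otimes>\<^sub>M L)"
      by (simp add: split_beta')
    have m1: "(\<lambda>w. next_dens G (w k) s) \<in> borel_measurable L" if "s \<in> space S" for s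
      using measurable_compose[OF measurable_Pair1'[OF that] m] by simp
    have "(\<integral>\<^sup>+w. W (fst (w t)) \<partial>L) = (\<integral>\<^sup>+w. \<integral>\<^sup>+s. next_dens G (w k) s * W s \<partial>S \<partial>L)"
      unfolding L_def Suc by (rule nn_integral_traj_next_state[OF K act refl W])
    also have "\<dots> = (\<integral>\<^sup>+s. \<integral>\<^sup>+w. next_dens G (w k) s * W s \<partial>L \<partial>S)"
      using LS.Fubini'[of "\<lambda>s w. next_dens G (w k) s * W s"] by (simp add: split_beta')
    also have "\<dots> = (\<integral>\<^sup>+s. (\<integral>\<^sup>+w. next_dens G (w k) s \<partial>L) * W s \<partial>S)"
      by (intro nn_integral_cong nn_integral_multc m1)
    finally show ?thesis by (simp add: Suc)
  qed
qed

lemma state_dens_total: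
  assumes act: "admissible act"
  shows "(\<integral>\<^sup>+s. state_dens G (traj_law G (step_kernel G act)) t s \<partial>S) = 1"
  using nn_integral_state_dens[OF act, of "\<lambda>_. 1" t]
    prob_space.emeasure_space_1[OF traj_law_prob[OF step_system_step_kernel[OF act]]]
  by simp

end

section \<open>The Bellman equation\<close>

lemma ennreal_add_SUP: "I \<noteq> {} \<Longrightarrow> c + (SUP i\<in>I. f i) = (SUP i\<in>I. c + f i :: ennreal)"
  using ennreal_SUP_add_left[of I f c] by (simp add: add.commute)

text \<open>Here \<open>e\<close> is the expected reward, \<open>x\<close> the expected value of the
  current state and \<open>\<delta>\<close> the loss of the step. Iterating the balance leaves the
  remainder \<open>\<gamma> ^ n * x n\<close>, which vanishes because \<open>x\<close> is
  bounded.\<close>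

lemma discounted_telescope:
  fixes e x \<delta> :: "nat \<Rightarrow> ennreal" and \<gamma> B :: real
  assumes \<gamma>: "0 \<le> \<gamma>" "\<gamma> < 1" and B: "\<And>t. x t \<le> ennreal B"
    and step: "\<And>t. e t + ennreal \<gamma> * x (Suc t) + \<delta> t = x t"
  shows "(\<Sum>t. ennreal (\<gamma> ^ t) * e t) + (\<Sum>t. ennreal (\<gamma> ^ t) * \<delta> t) = x 0"
proof -
  have pow: "ennreal (\<gamma> ^ Suc n) = ennreal (\<gamma> ^ n) * ennreal \<gamma>" for n
    using \<gamma> by (simp add: ennreal_mult'[symmetric] mult.commute)
  have part: "(\<Sum>t<n. ennreal (\<gamma> ^ t) * (e t + \<delta> t)) + ennreal (\<gamma> ^ n) * x n = x 0" for n
  proof (induction n)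
    case (Suc n)
    have "(\<Sum>t<Suc n. ennreal (\<gamma> ^ t) * (e t + \<delta> t)) + ennreal (\<gamma> ^ Suc n) * x (Suc n) =
      (\<Sum>t<n. ennreal (\<gamma> ^ t) * (e t + \<delta> t)) + ennreal (\<gamma> ^ n) * (e n + ennreal \<gamma> * x (Suc n) + \<delta> n)"
      unfolding pow by (simp add: algebra_simps)
    then show ?case unfolding step Suc .
  qed simp
  have "(\<lambda>n. \<gamma> ^ n * \<bar>B\<bar>) \<longlonglongrightarrow> 0 * \<bar>B\<bar>"
    using \<gamma> by (intro tendsto_mult LIMSEQ_power_zero tendsto_const) simp
  then have lim0: "(\<lambda>n. ennreal (\<gamma> ^ n * \<bar>B\<bar>)) \<longlonglongrightarrow> 0"
    using \<gamma> by (subst ennreal_tendsto_0_iff) auto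
  have "ennreal (\<gamma> ^ n) * x n \<le> ennreal (\<gamma> ^ n * \<bar>B\<bar>)" for n
  proof -
    have "x n \<le> ennreal \<bar>B\<bar>" using B[of n] by (rule order_trans) (simp add: ennreal_leI)
    then show ?thesis using \<gamma> by (simp add: ennreal_mult mult_left_mono)
  qed
  then have 0: "(\<lambda>n. ennreal (\<gamma> ^ n) * x n) \<longlonglongrightarrow> 0"
    by (intro tendsto_sandwich[OF _ _ tendsto_const lim0] always_eventually) simp_all
  have "(\<lambda>n. \<Sum>t<n. ennreal (\<gamma> ^ t) * (e t + \<delta> t)) \<longlonglongrightarrow> (\<Sum>t. ennreal (\<gamma> ^ t) * (e t + \<delta> t))"
    by (intro summable_LIMSEQ) simp
  from tendsto_add[OF this 0]
  have "(\<lambda>n. x 0) \<longlonglongrightarrow> (\<Sum>t. ennreal (\<gamma> ^ t) * (e t + \<delta> t)) + 0"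
    unfolding part .
  then have "x 0 = (\<Sum>t. ennreal (\<gamma> ^ t) * (e t + \<delta> t))"
    by (simp add: tendsto_const_iff)
  then show ?thesis by (simp add: distrib_left suminf_add)
qed

section \<open>The observed behaviour policy\<close>

context confounded_m2dp begin

lemma p_a_section[measurable]: "s \<in> space S \<Longrightarrow> (\<lambda>c. pmf (p_a G s c) a) \<in> borel_measurable Cf"
  using measurable_compose[OF measurable_Pair1' p_a_meas[of a]] by simp

lemma p_m_section[measurable]: "s \<in> space S \<Longrightarrow> (\<lambda>c. pmf (p_m G s c a) m) \<in> borel_measurable Cf"
  using measurable_compose[OF measurable_Pair1' p_m_meas[of a m]] by simp

lemma ennreal_p_b: "s \<in> space S \<Longrightarrow> ennreal (p_b G s a) = (\<integral>\<^sup>+c. ennreal (pmf (p_a G s c) a) \<partial>p_c G s)"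
proof -
  assume s: "s \<in> space S"
  interpret prob_space "p_c G s" by (rule p_c_prob[OF s])
  note [measurable_cong] = sets_p_c[OF s]
  have "integrable (p_c G s) (\<lambda>c. pmf (p_a G s c) a)"
    using s by (intro integrable_const_bound[of _ 1]) (auto simp: pmf_le_1)
  then show ?thesis unfolding p_b_def by (simp add: nn_integral_eq_integral)
qed

lemma measurable_p_b[measurable]: "(\<lambda>s. p_b G s a) \<in> borel_measurable S"
proof -
  have "(\<lambda>s. \<integral>\<^sup>+c. ennreal (pmf (p_a G s c) a) \<partial>p_c G s) \<in> borel_measurable S"
    using p_a_meas[of a] by (intro nn_integral_measurable_subprob_algebra2[OF _ p_c_subprob]) (simp add: split_beta')
  then have "(\<lambda>s. enn2real (\<integral>\<^sup>+c. ennreal (pmf (p_a G s c) a) \<partial>p_c G s)) \<in> borel_measurable S"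
    by measurable
  then show ?thesis
    by (rule measurable_cong[THEN iffD1, rotated])
      (simp add: ennreal_p_b[symmetric] p_b_def enn2real_ennreal integral_nonneg_AE)
qed

lemma p_b_nonneg: "0 \<le> p_b G s a"
  by (simp add: p_b_def integral_nonneg_AE)

lemma p_b_sum: assumes s: "s \<in> space S" shows "(\<Sum>a\<in>UNIV. p_b G s a) = 1"
proof -
  interpret prob_space "p_c G s" by (rule p_c_prob[OF s])
  note [measurable_cong] = sets_p_c[OF s]
  have "integrable (p_c G s) (\<lambda>c. pmf (p_a G s c) a)" for a
    using s by (intro integrable_const_bound[of _ 1]) (auto simp: pmf_le_1)
  then have "(\<Sum>a\<in>UNIV. p_b G s a) = (\<integral>c. (\<Sum>a\<in>UNIV. pmf (p_a G s c) a) \<partial>p_c G s)"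
    unfolding p_b_def by (simp add: Bochner_Integration.integral_sum)
  then show ?thesis by (simp add: sum_pmf_UNIV prob_space)
qed

end

section \<open>Bellman operators under the front-door criterion\<close>

context front_door_m2dp begin

lemma p_r_eq: "s \<in> space S \<Longrightarrow> c \<in> space Cf \<Longrightarrow> p_r G s c a m = p_r G s c a' m"
  using fd unfolding front_door_def by blast

lemma p_s_eq: "s \<in> space S \<Longrightarrow> c \<in> space Cf \<Longrightarrow> s' \<in> space S \<Longrightarrow> p_s G s c a m s' = p_s G s c a' m s'"
  using fd unfolding front_door_def by blast

lemma p_m_eq_p_med:
  assumes s: "s \<in> space S" and c: "c \<in> space Cf"
  shows "pmf (p_m G s c a) m = p_med G s a m"
proof -
  interpret prob_space "p_c G s" by (rule p_c_prob[OF s])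
  have "p_m G s c' a = p_m G s c a" if "c' \<in> space Cf" for c'
    using fd s c that unfolding front_door_def by blast
  then have "p_med G s a m = (\<integral>c'. pmf (p_m G s c a) m \<partial>p_c G s)"
    unfolding p_med_def by (intro Bochner_Integration.integral_cong) (auto simp: space_p_c[OF s])
  then show ?thesis by (simp add: prob_space)
qed

lemma p_med_pmf: "s \<in> space S \<Longrightarrow> \<exists>p. \<forall>m. p_med G s a m = pmf p m"
  using space_Cf_ne p_m_eq_p_med by (metis all_not_in_conv)

lemma p_med_nonneg: "0 \<le> p_med G s a m"
  by (simp add: p_med_def integral_nonneg_AE)

lemma p_med_sum: "s \<in> space S \<Longrightarrow> (\<Sum>m\<in>UNIV. p_med G s a m) = 1"
  using p_med_pmf[of s a] by (auto simp: sum_pmf_UNIV)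

lemma p_med_le_1: "s \<in> space S \<Longrightarrow> p_med G s a m \<le> 1"
  using p_med_pmf[of s a] by (auto simp: pmf_le_1)

lemma p_med_lower: "s \<in> space S \<Longrightarrow> pmin \<le> p_med G s a m"
  using space_Cf_ne p_m_eq_p_med p_m_lower by (metis all_not_in_conv)

lemma measurable_p_med[measurable]: "(\<lambda>s. p_med G s a m) \<in> borel_measurable S"
proof -
  obtain c where c: "c \<in> space Cf" using space_Cf_ne by blast
  from measurable_compose[OF measurable_Pair2'[OF c] p_m_meas[of a m]]
  have "(\<lambda>s. pmf (p_m G s c a) m) \<in> borel_measurable S" by simp
  then show ?thesis
    by (rule measurable_cong[THEN iffD1, rotated]) (simp add: p_m_eq_p_med c)
qed

lemma p_med_sum_mult: "s \<in> space S \<Longrightarrow> (\<Sum>m\<in>UNIV. ennreal (p_med G s a m) * c) = c"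
  using p_med_sum[of s a] by (simp add: sum_distrib_right[symmetric] sum_ennreal p_med_nonneg)

text \<open>Rewards are shifted by \<open>Rmax\<close>, so that all values are nonnegative and live in
  \<^typ>\<open>ennreal\<close>. By the front-door criterion the action argument of \<open>p_r\<close> and \<open>p_s\<close> is immaterial.\<close>

definition conf_value :: "('s \<Rightarrow> ennreal) \<Rightarrow> 's \<Rightarrow> 'c \<Rightarrow> 'm \<Rightarrow> ennreal" where
  "conf_value v s c m = (\<integral>\<^sup>+r. ennreal (r + Rmax) \<partial>p_r G s c undefined m)
     + ennreal (disc G) * (\<integral>\<^sup>+s'. p_s G s c undefined m s' * v s' \<partial>S)"

text \<open>The confounder is drawn from its prior \<open>p_c\<close>: this is the value of
  intervening on the mediator.\<close>

definition med_value :: "('s \<Rightarrow> ennreal) \<Rightarrow> 's \<Rightarrow> 'm \<Rightarrow> ennreal" where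
  "med_value v s m = (\<integral>\<^sup>+c. conf_value v s c m \<partial>p_c G s)"

definition act_value :: "('s \<Rightarrow> ennreal) \<Rightarrow> 's \<Rightarrow> 'a \<Rightarrow> ennreal" where
  "act_value v s a = (\<Sum>m\<in>UNIV. ennreal (p_med G s a m) * med_value v s m)"

text \<open>The Bellman backup along a realised step. The action and confounder are kept inside
  \<open>x\<close>, so that one function serves offline, online and mediated first steps.\<close>

definition step_value :: "('s \<Rightarrow> ennreal) \<Rightarrow> ('s, 'c, 'a, 'm) step \<Rightarrow> ennreal" where
  "step_value v x = ennreal (reward x + Rmax) + ennreal (disc G) * (\<integral>\<^sup>+s'. next_dens G x s' * v s' \<partial>S)"

lemma measurable_p_s_section[measurable]:
  "s \<in> space S \<Longrightarrow> c \<in> space Cf \<Longrightarrow> p_s G s c a m \<in> borel_measurable S"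
  using measurable_compose[OF measurable_Pair1'[of "(s, c)" "S \<Otimes>\<^sub>M Cf" S] p_s_meas[of a m]]
  by (simp add: space_pair_measure)

lemma measurable_conf_value:
  assumes [measurable]: "v \<in> borel_measurable S"
  shows "(\<lambda>(s, c). conf_value v s c m) \<in> borel_measurable (S \<Otimes>\<^sub>M Cf)"
proof -
  interpret SS: sigma_finite_measure S by (rule sfin_S)
  have r: "(\<lambda>z. \<integral>\<^sup>+r. ennreal (r + Rmax) \<partial>p_r G (fst z) (snd z) undefined m) \<in> borel_measurable (S \<Otimes>\<^sub>M Cf)"
    using measurable_compose[OF measurable_prob_algebraD[OF p_r_kernel[of undefined m]]
       nn_integral_measurable_subprob_algebra[of "\<lambda>r. ennreal (r + Rmax)" borel]]
    by (simp add: split_beta')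
  note p_s_meas[of undefined m, unfolded split_beta', measurable]
  have "(\<lambda>z. \<integral>\<^sup>+s'. p_s G (fst z) (snd z) undefined m s' * v s' \<partial>S) \<in> borel_measurable (S \<Otimes>\<^sub>M Cf)"
    by (rule SS.borel_measurable_nn_integral) (simp add: split_beta')
  with r show ?thesis unfolding conf_value_def split_beta' by measurable
qed

lemma measurable_conf_value_section:
  assumes "v \<in> borel_measurable S" "s \<in> space S"
  shows "(\<lambda>c. conf_value v s c m) \<in> borel_measurable Cf"
  using measurable_compose[OF measurable_Pair1'[OF assms(2)] measurable_conf_value[OF assms(1)]] by simp

lemma measurable_med_value[measurable]:
  "v \<in> borel_measurable S \<Longrightarrow> (\<lambda>s. med_value v s m) \<in> borel_measurable S"
  unfolding med_value_def
  by (intro nn_integral_measurable_subprob_algebra2[OF _ p_c_subprob] measurable_conf_value)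

lemma measurable_act_value[measurable]:
  "v \<in> borel_measurable S \<Longrightarrow> (\<lambda>s. act_value v s a) \<in> borel_measurable S"
  unfolding act_value_def by measurable

lemma measurable_step_value:
  assumes [measurable]: "v \<in> borel_measurable S"
  shows "step_value v \<in> borel_measurable (step_space G)"
proof -
  interpret SS: sigma_finite_measure S by (rule sfin_S)
  note measurable_next_dens[unfolded split_beta', measurable]
  have "(\<lambda>x. \<integral>\<^sup>+s'. next_dens G x s' * v s' \<partial>S) \<in> borel_measurable (step_space G)"
    by (rule SS.borel_measurable_nn_integral) (simp add: split_beta')
  then show ?thesis unfolding step_value_def[abs_def] by measurable
qed

lemma nn_integral_step_value_reward:
  assumes s: "s \<in> space S" and c: "c \<in> space Cf"
  shows "(\<integral>\<^sup>+r. step_value v (s, c, a, m, r) \<partial>p_r G s c a m) = conf_value v s c m"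
proof -
  interpret prob_space "p_r G s c a m" by (rule p_r_prob[OF s c])
  note [measurable_cong] = sets_p_r[OF s c]
  have "(\<integral>\<^sup>+s'. p_s G s c a m s' * v s' \<partial>S) = (\<integral>\<^sup>+s'. p_s G s c undefined m s' * v s' \<partial>S)"
    using p_s_eq[OF s c] by (intro nn_integral_cong) metis
  then show ?thesis
    unfolding step_value_def conf_value_def p_r_eq[OF s c, of undefined m a]
    by (simp add: reward_def next_dens_def nn_integral_add emeasure_space_1)
qed

text \<open>Since the action rule ignores the confounder, its weights leave the integral over
  \<open>p_c\<close> and the confounder keeps its prior. This is where an intervention differs from
  the offline process, in which the action is informative about \<open>c\<close>.\<close>

lemma nn_integral_state_step_step_value:
  assumes s: "s \<in> space S" and v: "v \<in> borel_measurable S" and act: "\<And>c. act s c = p"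
  shows "(\<integral>\<^sup>+x. step_value v x \<partial>state_step act s) = (\<Sum>a\<in>UNIV. ennreal (pmf p a) * act_value v s a)"
proof -
  note [measurable_cong] = sets_p_c[OF s]
  note [measurable] = measurable_conf_value_section[OF v s]
  have am: "(\<lambda>c. pmf (act s c) a) \<in> borel_measurable Cf" for a by (simp add: act)
  have "(\<integral>\<^sup>+x. step_value v x \<partial>state_step act s) =
      (\<integral>\<^sup>+c. (\<Sum>a\<in>UNIV. ennreal (pmf p a) * (\<Sum>m\<in>UNIV. ennreal (p_med G s a m) * conf_value v s c m)) \<partial>p_c G s)"
    unfolding nn_integral_state_step[where act=act and s=s, OF s am measurable_step_value[OF v]]
    by (intro nn_integral_cong) (simp add: act space_p_c[OF s] p_m_eq_p_med[OF s] nn_integral_step_value_reward[OF s])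
  then show ?thesis
    by (simp add: nn_integral_sum nn_integral_cmult act_value_def med_value_def)
qed

lemma conf_value_mono: "v \<le> v' \<Longrightarrow> conf_value v s c m \<le> conf_value v' s c m"
  unfolding conf_value_def le_fun_def
  by (intro add_left_mono mult_left_mono nn_integral_mono) auto

lemma act_value_mono: "v \<le> v' \<Longrightarrow> act_value v s a \<le> act_value v' s a"
  unfolding act_value_def med_value_def
  by (intro sum_mono mult_left_mono nn_integral_mono conf_value_mono) auto

lemma conf_value_SUP:
  assumes v: "\<And>n. v n \<in> borel_measurable S" "incseq v" and s: "s \<in> space S" and c: "c \<in> space Cf"
  shows "conf_value (\<lambda>s. SUP n. v n s) s c m = (SUP n. conf_value (v n) s c m)"
proof -
  note v(1)[measurable]
  note [measurable] = measurable_p_s_section[OF s c]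
  have inc: "incseq (\<lambda>n s'. p_s G s c undefined m s' * v n s')"
    using v(2) unfolding incseq_def le_fun_def by (auto intro: mult_left_mono)
  have "(\<integral>\<^sup>+s'. p_s G s c undefined m s' * (SUP n. v n s') \<partial>S) =
      (SUP n. \<integral>\<^sup>+s'. p_s G s c undefined m s' * v n s' \<partial>S)"
    unfolding SUP_mult_left_ennreal by (rule nn_integral_monotone_convergence_SUP[OF inc]) measurable
  then show ?thesis
    unfolding conf_value_def
    by (simp only: SUP_mult_left_ennreal ennreal_add_SUP[OF UNIV_not_empty])
qed

text \<open>Monotone convergence is applied to the next state and then to the confounder. This
  continuity turns the limit of value iteration into a fixed point.\<close>

lemma act_value_SUP:
  assumes v: "\<And>n. v n \<in> borel_measurable S" "incseq v" and s: "s \<in> space S"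
  shows "act_value (\<lambda>s. SUP n. v n s) s a = (SUP n. act_value (v n) s a)"
proof -
  note [measurable_cong] = sets_p_c[OF s]
  note [measurable] = measurable_conf_value_section[OF v(1) s]
  have inc: "incseq (\<lambda>n c. conf_value (v n) s c m)" for m
    using v(2) unfolding incseq_def by (auto intro!: conf_value_mono le_funI dest: le_funD)
  have med: "med_value (\<lambda>s. SUP n. v n s) s m = (SUP n. med_value (v n) s m)" for m
  proof -
    have "med_value (\<lambda>s. SUP n. v n s) s m = (\<integral>\<^sup>+c. (SUP n. conf_value (v n) s c m) \<partial>p_c G s)"
      unfolding med_value_def
      by (intro nn_integral_cong) (simp add: space_p_c[OF s] conf_value_SUP[OF v s])
    also have "\<dots> = (SUP n. med_value (v n) s m)"
      unfolding med_value_def by (rule nn_integral_monotone_convergence_SUP[OF inc]) measurable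
    finally show ?thesis .
  qed
  have "incseq (\<lambda>n. ennreal (p_med G s a m) * med_value (v n) s m)" for m
    using inc[of m] unfolding incseq_def le_fun_def med_value_def
    by (auto intro!: mult_left_mono nn_integral_mono)
  then show ?thesis
    unfolding act_value_def med by (simp add: SUP_mult_left_ennreal ennreal_SUP_sum)
qed

text \<open>Shifted rewards lie between 0 and \<open>2 * Rmax\<close>, hence shifted returns between
  0 and \<open>2 * Vmax\<close>.\<close>

abbreviation Bmax :: real where "Bmax \<equiv> 2 * Vmax G Rmax"

lemma Bmax_eq: "2 * Rmax + disc G * Bmax = Bmax"
  using disc by (simp add: Vmax_def field_simps)

lemma conf_value_bound:
  assumes v: "\<And>s. s \<in> space S \<Longrightarrow> v s \<le> ennreal Bmax" and s: "s \<in> space S" and c: "c \<in> space Cf"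
  shows "conf_value v s c m \<le> ennreal Bmax"
proof -
  interpret prob_space "p_r G s c undefined m" by (rule p_r_prob[OF s c])
  have "(\<integral>\<^sup>+r. ennreal (r + Rmax) \<partial>p_r G s c undefined m) \<le> (\<integral>\<^sup>+r. ennreal (2 * Rmax) \<partial>p_r G s c undefined m)"
    using reward_bound[OF s c, of undefined m] by (intro nn_integral_mono_AE) (auto elim!: eventually_mono intro!: ennreal_leI)
  then have 1: "(\<integral>\<^sup>+r. ennreal (r + Rmax) \<partial>p_r G s c undefined m) \<le> ennreal (2 * Rmax)"
    by (simp add: emeasure_space_1)
  have "(\<integral>\<^sup>+s'. p_s G s c undefined m s' * v s' \<partial>S) \<le> (\<integral>\<^sup>+s'. p_s G s c undefined m s' * ennreal Bmax \<partial>S)"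
    by (intro nn_integral_mono mult_left_mono v) auto
  also have "\<dots> = ennreal Bmax"
    using measurable_p_s_section[OF s c] by (simp add: nn_integral_multc p_s_total[OF s c])
  finally have "conf_value v s c m \<le> ennreal (2 * Rmax) + ennreal (disc G) * ennreal Bmax"
    unfolding conf_value_def by (intro add_mono 1 mult_left_mono) auto
  also have "\<dots> = ennreal (2 * Rmax + disc G * Bmax)"
    using disc Rmax_nonneg Vmax_nonneg by (simp add: ennreal_mult' ennreal_plus)
  finally show ?thesis unfolding Bmax_eq .
qed

lemma med_value_bound:
  assumes v: "\<And>s. s \<in> space S \<Longrightarrow> v s \<le> ennreal Bmax" and s: "s \<in> space S"
  shows "med_value v s m \<le> ennreal Bmax"
proof -
  interpret prob_space "p_c G s" by (rule p_c_prob[OF s])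
  have "med_value v s m \<le> (\<integral>\<^sup>+c. ennreal Bmax \<partial>p_c G s)"
    unfolding med_value_def using conf_value_bound[OF v s]
    by (intro nn_integral_mono) (simp add: space_p_c[OF s])
  then show ?thesis by (simp add: emeasure_space_1)
qed

lemma act_value_bound:
  assumes v: "\<And>s. s \<in> space S \<Longrightarrow> v s \<le> ennreal Bmax" and s: "s \<in> space S"
  shows "act_value v s a \<le> ennreal Bmax"
proof -
  have "act_value v s a \<le> (\<Sum>m\<in>UNIV. ennreal (p_med G s a m) * ennreal Bmax)"
    unfolding act_value_def by (intro sum_mono mult_left_mono med_value_bound[OF v s]) auto
  then show ?thesis using p_med_sum_mult[OF s] by simp
qed

text \<open>The start 0 is a lower bound for all shifted values, so the iterates increase and their
  limit exists as a supremum.\<close>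

primrec value_iter :: "nat \<Rightarrow> 's \<Rightarrow> ennreal" where
  "value_iter 0 = (\<lambda>s. 0)"
| "value_iter (Suc n) = (\<lambda>s. SUP a. act_value (value_iter n) s a)"

definition opt_value :: "'s \<Rightarrow> ennreal" where
  "opt_value s = (SUP n. value_iter n s)"

lemma measurable_value_iter[measurable]: "value_iter n \<in> borel_measurable S"
  by (induction n) (auto intro!: borel_measurable_SUP measurable_act_value)

lemma measurable_opt_value[measurable]: "opt_value \<in> borel_measurable S"
  unfolding opt_value_def[abs_def] by measurable

lemma incseq_value_iter: "incseq value_iter"
proof (rule incseq_SucI)
  fix n show "value_iter n \<le> value_iter (Suc n)"
  proof (induction n)
    case (Suc n)
    then show ?case
      by (auto simp: le_fun_def intro!: SUP_mono' act_value_mono simp del: value_iter.simps(2)) 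
         (auto simp: le_fun_def intro!: SUP_mono' act_value_mono)
  qed (simp add: le_fun_def)
qed

lemma value_iter_bound: "s \<in> space S \<Longrightarrow> value_iter n s \<le> ennreal Bmax"
  by (induction n arbitrary: s) (auto intro!: SUP_least act_value_bound)

lemma opt_value_bound: "s \<in> space S \<Longrightarrow> opt_value s \<le> ennreal Bmax"
  unfolding opt_value_def by (intro SUP_least value_iter_bound)

text \<open>The suprema over actions and over iterates are exchanged; shifting the iteration index
  does not change the supremum of an increasing sequence.\<close>

lemma opt_value_fixpoint: "s \<in> space S \<Longrightarrow> (SUP a. act_value opt_value s a) = opt_value s"
proof -
  assume s: "s \<in> space S"
  have inc: "incseq (\<lambda>n. value_iter n s)"
    using incseq_value_iter by (auto simp: incseq_def le_fun_def)
  have "(SUP a. act_value opt_value s a) = (SUP a. SUP n. act_value (value_iter n) s a)"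
    unfolding opt_value_def[abs_def] by (simp add: act_value_SUP[OF _ incseq_value_iter s])
  also have "\<dots> = (SUP n. SUP a. act_value (value_iter n) s a)" by (rule SUP_commute)
  also have "\<dots> = (SUP n. value_iter (Suc n) s)" by simp
  also have "\<dots> = (SUP n. value_iter n s)"
    using incseq_SucD[OF inc] by (intro antisym SUP_mono) (blast intro: order_refl)+
  finally show ?thesis by (simp add: opt_value_def)
qed

lemma act_value_le_opt: "s \<in> space S \<Longrightarrow> act_value opt_value s a \<le> opt_value s"
  by (subst opt_value_fixpoint[symmetric]) (auto intro: SUP_upper)

end

section \<open>Optimal mediated values and regret\<close>

context front_door_m2dp begin

definition shifted_return :: "(nat \<Rightarrow> ('s, 'c, 'a, 'm) step) measure \<Rightarrow> ennreal" where
  "shifted_return L = (\<Sum>t. ennreal (disc G ^ t) * (\<integral>\<^sup>+w. ennreal (reward (w t) + Rmax) \<partial>L))"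

text \<open>The bridge between the real series in the definitions and the \<open>ennreal\<close>
  calculus: adding \<open>Rmax\<close> to every reward adds the geometric sum \<open>Vmax\<close> to
  the return.\<close>

lemma disc_return_shift:
  assumes K: "step_system K" and R: "\<And>t. AE w in traj_law G K. \<bar>reward (w t)\<bar> \<le> Rmax"
  shows "ennreal (disc_return G (traj_law G K) + Vmax G Rmax) = shifted_return (traj_law G K)"
    and "\<bar>disc_return G (traj_law G K)\<bar> \<le> Vmax G Rmax"
proof -
  let ?L = "traj_law G K"
  interpret prob_space ?L by (rule traj_law_prob[OF K])
  define r where "r t = (\<integral>w. reward (w t) \<partial>?L)" for t
  have m[measurable]: "(\<lambda>w. reward (w t)) \<in> borel_measurable ?L" for t
    by (rule measurable_compose[OF measurable_traj_component[OF K] measurable_reward])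
  have int: "integrable ?L (\<lambda>w. reward (w t))" for t
    using R by (intro integrable_const_bound[of _ Rmax]) auto
  have er: "(\<integral>\<^sup>+w. ennreal (reward (w t) + Rmax) \<partial>?L) = ennreal (r t + Rmax)" for t
  proof -
    have "AE w in ?L. 0 \<le> reward (w t) + Rmax" using R[of t] by eventually_elim simp
    then have "(\<integral>\<^sup>+w. ennreal (reward (w t) + Rmax) \<partial>?L) = ennreal (\<integral>w. reward (w t) + Rmax \<partial>?L)"
      using int by (intro nn_integral_eq_integral) auto
    then show ?thesis using int by (simp add: r_def prob_space)
  qed
  have rb: "\<bar>r t\<bar> \<le> Rmax" for t
  proof -
    have "\<bar>r t\<bar> \<le> (\<integral>w. \<bar>reward (w t)\<bar> \<partial>?L)" unfolding r_def by (rule integral_abs_bound)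
    also have "\<dots> \<le> (\<integral>w. Rmax \<partial>?L)" using int R by (intro integral_mono_AE) auto
    finally show ?thesis by (simp add: prob_space)
  qed
  have g: "summable (\<lambda>t. disc G ^ t * Rmax)" "(\<Sum>t. disc G ^ t * Rmax) = Vmax G Rmax"
    using disc by (auto simp: suminf_mult2[symmetric] suminf_geometric Vmax_def intro!: summable_mult2 summable_geometric)
  have b: "\<bar>disc G ^ t * r t\<bar> \<le> disc G ^ t * Rmax" for t
    using rb[of t] disc by (simp add: abs_mult mult_left_mono)
  have sr: "summable (\<lambda>t. disc G ^ t * r t)"
    by (rule summable_comparison_test'[OF g(1), of 0]) (use b in auto)
  have D: "disc_return G ?L = (\<Sum>t. disc G ^ t * r t)" by (simp add: disc_return_def r_def)
  have sa: "summable (\<lambda>t. \<bar>disc G ^ t * r t\<bar>)"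
    by (rule summable_comparison_test'[OF g(1), of 0]) (use b in auto)
  have "\<bar>disc_return G ?L\<bar> \<le> (\<Sum>t. \<bar>disc G ^ t * r t\<bar>)"
    unfolding D by (rule summable_rabs[OF sa])
  also have "\<dots> \<le> Vmax G Rmax"
    unfolding g(2)[symmetric] by (intro suminf_le b sa g(1))
  finally show "\<bar>disc_return G ?L\<bar> \<le> Vmax G Rmax" .
  have pos: "0 \<le> disc G ^ t * (r t + Rmax)" for t
    using rb[of t] disc by (intro mult_nonneg_nonneg) auto
  have "shifted_return ?L = (\<Sum>t. ennreal (disc G ^ t * (r t + Rmax)))"
    unfolding shifted_return_def er using disc by (simp add: ennreal_mult')
  also have "\<dots> = ennreal (\<Sum>t. disc G ^ t * (r t + Rmax))"
    using sr g(1) pos by (intro suminf_ennreal2) (auto simp: distrib_left summable_add)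
  also have "(\<Sum>t. disc G ^ t * (r t + Rmax)) = disc_return G ?L + Vmax G Rmax"
    unfolding D g(2)[symmetric] distrib_left by (rule suminf_add[symmetric, OF sr g(1)])
  finally show "ennreal (disc_return G ?L + Vmax G Rmax) = shifted_return ?L" by simp
qed

lemma nn_integral_step_value_traj:
  assumes K: "step_system K" and act: "admissible act" and Kt: "K (Suc t) = step_kernel G act (Suc t)"
    and v: "v \<in> borel_measurable S"
  shows "(\<integral>\<^sup>+w. step_value v (w t) \<partial>traj_law G K) =
    (\<integral>\<^sup>+w. ennreal (reward (w t) + Rmax) \<partial>traj_law G K) + ennreal (disc G) * (\<integral>\<^sup>+w. v (fst (w (Suc t))) \<partial>traj_law G K)"
proof -
  interpret SS: sigma_finite_measure S by (rule sfin_S)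
  note v[measurable] measurable_next_dens[unfolded split_beta', measurable]
  have "(\<lambda>x. \<integral>\<^sup>+s'. next_dens G x s' * v s' \<partial>S) \<in> borel_measurable (step_space G)"
    by (rule SS.borel_measurable_nn_integral) (simp add: split_beta')
  from measurable_compose[OF measurable_traj_component[OF K] this]
  have [measurable]: "(\<lambda>w. \<integral>\<^sup>+s'. next_dens G (w t) s' * v s' \<partial>S) \<in> borel_measurable (traj_law G K)" .
  have [measurable]: "(\<lambda>w. reward (w t)) \<in> borel_measurable (traj_law G K)"
    by (rule measurable_compose[OF measurable_traj_component[OF K] measurable_reward])
  show ?thesis
    unfolding nn_integral_traj_next_state[OF K act Kt v] step_value_def
    by (simp add: nn_integral_add nn_integral_cmult)
qed

lemma traj_expected_state_bound:
  assumes K: "step_system K" and v: "\<And>s. s \<in> space S \<Longrightarrow> v s \<le> ennreal B"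
  shows "(\<integral>\<^sup>+w. v (fst (w t)) \<partial>traj_law G K) \<le> ennreal B"
proof -
  interpret prob_space "traj_law G K" by (rule traj_law_prob[OF K])
  have "(\<integral>\<^sup>+w. v (fst (w t)) \<partial>traj_law G K) \<le> (\<integral>\<^sup>+w. ennreal B \<partial>traj_law G K)"
    using measurable_space[OF measurable_step_fst traj_component_space[OF K]] by (intro nn_integral_mono v)
  then show ?thesis by (simp add: emeasure_space_1)
qed

lemma expected_reward_bound:
  assumes K: "step_system K" and R: "AE w in traj_law G K. \<bar>reward (w t)\<bar> \<le> Rmax"
  shows "(\<integral>\<^sup>+w. ennreal (reward (w t) + Rmax) \<partial>traj_law G K) \<le> ennreal (2 * Rmax)"
proof -
  interpret prob_space "traj_law G K" by (rule traj_law_prob[OF K])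
  have "(\<integral>\<^sup>+w. ennreal (reward (w t) + Rmax) \<partial>traj_law G K) \<le> (\<integral>\<^sup>+w. ennreal (2 * Rmax) \<partial>traj_law G K)"
    using R by (intro nn_integral_mono_AE) (auto elim!: eventually_mono intro!: ennreal_leI)
  then show ?thesis by (simp add: emeasure_space_1)
qed

text \<open>A verification theorem: a function \<open>v\<close> that no step can improve on in
  expectation bounds the return, and one that every step preserves equals it. The kernel at time 0
  is left free, which is why the first step appears through its own backup and not through
  \<open>v\<close>.\<close>

lemma shifted_return_le:
  assumes K: "step_system K" and act: "admissible act" and KS: "\<And>t. K (Suc t) = step_kernel G act (Suc t)"
    and R: "\<And>t. AE w in traj_law G K. \<bar>reward (w t)\<bar> \<le> Rmax"
    and v: "v \<in> borel_measurable S" "\<And>s. s \<in> space S \<Longrightarrow> v s \<le> ennreal Bmax"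
    and le: "\<And>t w s. w \<in> space (Hist t) \<Longrightarrow> s \<in> space S \<Longrightarrow> (\<integral>\<^sup>+x. step_value v x \<partial>state_step (act t w) s) \<le> v s"
  shows "shifted_return (traj_law G K) \<le> (\<integral>\<^sup>+w. step_value v (w 0) \<partial>traj_law G K)"
    and "(\<And>t w s. w \<in> space (Hist t) \<Longrightarrow> s \<in> space S \<Longrightarrow> (\<integral>\<^sup>+x. step_value v x \<partial>state_step (act t w) s) = v s)
      \<Longrightarrow> shifted_return (traj_law G K) = (\<integral>\<^sup>+w. step_value v (w 0) \<partial>traj_law G K)"
proof -
  let ?L = "traj_law G K"
  define e where "e t = (\<integral>\<^sup>+w. ennreal (reward (w t) + Rmax) \<partial>?L)" for t
  define y where "y t = (\<integral>\<^sup>+w. step_value v (w t) \<partial>?L)" for t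
  \<comment> \<open>Setting \<open>x 0\<close> to \<open>y 0\<close> makes the defect at time 0
    vanish, because the first step need not follow the action rule.\<close>
  define x where "x t = (if t = 0 then y 0 else \<integral>\<^sup>+w. v (fst (w t)) \<partial>?L)" for t
  define \<delta> where "\<delta> t = x t - y t" for t
  have y: "y t = e t + ennreal (disc G) * x (Suc t)" for t
    unfolding y_def e_def x_def by (simp add: nn_integral_step_value_traj[OF K act KS v(1)])
  have yx: "y t \<le> x t" for t
  proof (cases t)
    case (Suc k)
    then show ?thesis unfolding y_def x_def
      using nn_integral_traj_le[where W=v, OF K act KS v(1) measurable_step_value[OF v(1)] le] by simp
  qed (simp add: x_def)
  have xB: "x (Suc t) \<le> ennreal Bmax" for t
    unfolding x_def using traj_expected_state_bound[OF K v(2)] by simp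
  have xbound: "x t \<le> ennreal Bmax" for t
  proof (cases t)
    case 0
    have "y 0 \<le> ennreal (2 * Rmax) + ennreal (disc G) * ennreal Bmax"
      unfolding y using expected_reward_bound[OF K R, of 0] xB[of 0]
      by (intro add_mono mult_left_mono) (auto simp: e_def)
    also have "\<dots> = ennreal (2 * Rmax + disc G * Bmax)"
      using disc Rmax_nonneg Vmax_nonneg by (simp add: ennreal_mult' ennreal_plus)
    finally show ?thesis unfolding Bmax_eq using 0 by (simp add: x_def)
  qed (use xB in simp)
  have "e t + ennreal (disc G) * x (Suc t) + \<delta> t = x t" for t
    unfolding \<delta>_def y[symmetric] using yx[of t] by (rule add_diff_inverse_ennreal)
  with xbound have T: "(\<Sum>t. ennreal (disc G ^ t) * e t) + (\<Sum>t. ennreal (disc G ^ t) * \<delta> t) = x 0"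
    using disc by (intro discounted_telescope[where B=Bmax]) auto
  have eret: "shifted_return ?L = (\<Sum>t. ennreal (disc G ^ t) * e t)"
    by (simp add: shifted_return_def e_def)
  have x0: "x 0 = (\<integral>\<^sup>+w. step_value v (w 0) \<partial>?L)" by (simp add: x_def y_def)
  show "shifted_return ?L \<le> (\<integral>\<^sup>+w. step_value v (w 0) \<partial>?L)"
    unfolding eret x0[symmetric] T[symmetric] by simp
  assume eq: "\<And>t w s. w \<in> space (Hist t) \<Longrightarrow> s \<in> space S \<Longrightarrow> (\<integral>\<^sup>+x. step_value v x \<partial>state_step (act t w) s) = v s"
  have "y t = x t" for t
  proof (cases t)
    case (Suc k)
    then show ?thesis unfolding y_def x_def
      using nn_integral_traj_eq[where W=v, OF K act KS v(1) measurable_step_value[OF v(1)] eq] by simp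
  qed (simp add: x_def)
  \<comment> \<open>Finiteness of \<open>x t\<close> is essential here: in \<open>ennreal\<close>,
    \<open>\<top> - \<top>\<close> is \<open>\<top>\<close>.\<close>
  then have "\<delta> t = 0" for t
    using le_less_trans[OF xbound ennreal_less_top, of t] unfolding \<delta>_def by simp
  then show "shifted_return ?L = (\<integral>\<^sup>+w. step_value v (w 0) \<partial>?L)"
    using T unfolding eret x0[symmetric] by simp
qed

section \<open>The confounder posterior and the mediated law\<close>

definition post_value :: "('s \<Rightarrow> ennreal) \<Rightarrow> 's \<Rightarrow> 'a \<Rightarrow> 'm \<Rightarrow> ennreal" where
  "post_value v s a m = (\<integral>\<^sup>+c. conf_value v s c m \<partial>conf_posterior G s a m)"

lemma posterior_normalizer:
  assumes s: "s \<in> space S"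
  shows "(\<integral>c. pmf (p_a G s c) a * pmf (p_m G s c a) m \<partial>p_c G s) = p_b G s a * p_med G s a m"
proof -
  have "(\<integral>c. pmf (p_a G s c) a * pmf (p_m G s c a) m \<partial>p_c G s) = (\<integral>c. pmf (p_a G s c) a * p_med G s a m \<partial>p_c G s)"
    by (intro Bochner_Integration.integral_cong) (auto simp: space_p_c[OF s] p_m_eq_p_med[OF s])
  then show ?thesis by (simp add: p_b_def)
qed

lemma conf_posterior_null: "s \<in> space S \<Longrightarrow> p_b G s a = 0 \<Longrightarrow> conf_posterior G s a m = p_c G s"
  by (simp add: conf_posterior_def posterior_normalizer)

text \<open>Given the state and action, the mediator carries no further information about the
  confounder, so \<open>p_med\<close> cancels from Bayes' rule; it is positive by
  \<open>pmin\<close>. Multiplying by \<open>p_b\<close> avoids a division in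
  \<open>ennreal\<close>.\<close>

lemma nn_integral_conf_posterior:
  assumes s: "s \<in> space S" and pb: "p_b G s a \<noteq> 0" and f: "f \<in> borel_measurable Cf"
  shows "ennreal (p_b G s a) * (\<integral>\<^sup>+c. f c \<partial>conf_posterior G s a m) = (\<integral>\<^sup>+c. ennreal (pmf (p_a G s c) a) * f c \<partial>p_c G s)"
proof -
  note [measurable_cong] = sets_p_c[OF s]
  note f[measurable]
  have pm: "p_med G s a m > 0" using p_med_lower[OF s] pmin_pos by (rule less_le_trans[rotated])
  have pb': "p_b G s a > 0" using pb p_b_nonneg[of s a] by simp
  have m: "(\<lambda>c. ennreal (pmf (p_a G s c) a * pmf (p_m G s c a) m / (p_b G s a * p_med G s a m))) \<in> borel_measurable (p_c G s)"
    using s by measurable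
  have "ennreal (p_b G s a) * (\<integral>\<^sup>+c. f c \<partial>conf_posterior G s a m) =
    ennreal (p_b G s a) * (\<integral>\<^sup>+c. ennreal (pmf (p_a G s c) a * pmf (p_m G s c a) m / (p_b G s a * p_med G s a m)) * f c \<partial>p_c G s)"
    using pm pb' m by (simp add: conf_posterior_def posterior_normalizer[OF s] nn_integral_density)
  also have "\<dots> = (\<integral>\<^sup>+c. ennreal (p_b G s a) * (ennreal (pmf (p_a G s c) a * pmf (p_m G s c a) m / (p_b G s a * p_med G s a m)) * f c) \<partial>p_c G s)"
    using f by (intro nn_integral_cmult[symmetric] borel_measurable_times_ennreal m)
      (simp add: measurable_cong_sets[OF sets_p_c[OF s] refl])
  also have "\<dots> = (\<integral>\<^sup>+c. ennreal (pmf (p_a G s c) a) * f c \<partial>p_c G s)"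
  proof (intro nn_integral_cong)
    fix c assume "c \<in> space (p_c G s)"
    then have "pmf (p_m G s c a) m = p_med G s a m" by (simp add: space_p_c[OF s] p_m_eq_p_med[OF s])
    then show "ennreal (p_b G s a) * (ennreal (pmf (p_a G s c) a * pmf (p_m G s c a) m / (p_b G s a * p_med G s a m)) * f c) = ennreal (pmf (p_a G s c) a) * f c"
      using pm pb' by (simp add: mult.assoc[symmetric] ennreal_mult[symmetric])
  qed
  finally show ?thesis .
qed

lemma conf_posterior_prob:
  assumes s: "s \<in> space S"
  shows "conf_posterior G s a m \<in> space (prob_algebra Cf)"
proof (cases "p_b G s a = 0")
  case True
  then show ?thesis using s p_c_prob[OF s] sets_p_c[OF s] by (simp add: conf_posterior_null space_prob_algebra)
next
  case False
  then have pb: "0 < ennreal (p_b G s a)" "ennreal (p_b G s a) < \<top>" using p_b_nonneg[of s a] by simp_all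
  have sets: "sets (conf_posterior G s a m) = sets Cf"
    by (simp add: conf_posterior_def Let_def sets_p_c[OF s])
  have "ennreal (p_b G s a) * emeasure (conf_posterior G s a m) (space (conf_posterior G s a m)) = ennreal (p_b G s a) * 1"
    using nn_integral_conf_posterior[OF s False, of "\<lambda>_. 1" m] ennreal_p_b[OF s, of a] by simp
  then have "emeasure (conf_posterior G s a m) (space (conf_posterior G s a m)) = 1"
    using pb by (subst (asm) ennreal_mult_cancel_left) auto
  then show ?thesis using sets by (auto simp: space_prob_algebra intro: prob_spaceI)
qed

lemma space_conf_posterior: "s \<in> space S \<Longrightarrow> space (conf_posterior G s a m) = space Cf"
  using conf_posterior_prob[of s a m] by (intro sets_eq_imp_space_eq) (simp add: space_prob_algebra)

lemma sum_post_value: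
  assumes s: "s \<in> space S" and v: "v \<in> borel_measurable S"
  shows "(\<Sum>a\<in>UNIV. ennreal (p_b G s a) * post_value v s a m) = med_value v s m"
proof -
  note [measurable_cong] = sets_p_c[OF s]
  note cm[measurable] = measurable_conf_value_section[OF v s]
  have "ennreal (p_b G s a) * post_value v s a m = (\<integral>\<^sup>+c. ennreal (pmf (p_a G s c) a) * conf_value v s c m \<partial>p_c G s)" for a
  proof (cases "p_b G s a = 0")
    \<comment> \<open>For an action of probability 0 the posterior is a mere convention. It enters
      with weight 0, and on the prior side \<open>pmf (p_a G s c) a\<close> vanishes for almost
      every \<open>c\<close>, so both sides agree.\<close>
    case True
    then have "(\<integral>\<^sup>+c. ennreal (pmf (p_a G s c) a) \<partial>p_c G s) = 0" using ennreal_p_b[OF s, of a] by simp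
    then have "AE c in p_c G s. ennreal (pmf (p_a G s c) a) = 0"
      using s by (subst (asm) nn_integral_0_iff_AE) auto
    then have "AE c in p_c G s. ennreal (pmf (p_a G s c) a) * conf_value v s c m = 0"
      by eventually_elim simp
    from nn_integral_cong_AE[OF this]
    have "(\<integral>\<^sup>+c. ennreal (pmf (p_a G s c) a) * conf_value v s c m \<partial>p_c G s) = 0"
      by simp
    then show ?thesis using True by simp
  next
    case False
    then show ?thesis unfolding post_value_def by (rule nn_integral_conf_posterior[OF s _ cm])
  qed
  then have "(\<Sum>a\<in>UNIV. ennreal (p_b G s a) * post_value v s a m) =
      (\<integral>\<^sup>+c. (\<Sum>a\<in>UNIV. ennreal (pmf (p_a G s c) a) * conf_value v s c m) \<partial>p_c G s)"
    using s by (simp add: nn_integral_sum)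
  then show ?thesis by (simp add: sum_pmf_mult_const med_value_def)
qed

definition mediated_kernel where
  "mediated_kernel \<pi> s a m = (\<lambda>t w. if t = 0 then conf_posterior G s a m \<bind> (\<lambda>c. reward_step G s c a m)
     else online_kernel G \<pi> t w)"

lemma mediated_law_kernel: "mediated_law G \<pi> s a m = traj_law G (mediated_kernel \<pi> s a m)"
  by (simp add: mediated_law_def mediated_kernel_def)

lemma reward_step_kernel:
  assumes s: "s \<in> space S"
  shows "(\<lambda>c. reward_step G s c a m) \<in> Cf \<rightarrow>\<^sub>M prob_algebra (step_space G)"
  using measurable_compose[OF measurable_Pair1'[OF s] measurable_reward_step[of a m]] by simp

lemma step_system_mediated:
  assumes s: "s \<in> space S" and \<pi>: "\<pi> \<in> policies G"
  shows "step_system (mediated_kernel \<pi> s a m)"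
proof -
  have 0: "conf_posterior G s a m \<bind> (\<lambda>c. reward_step G s c a m) \<in> space (prob_algebra (step_space G))"
    using prob_space_bind'[OF conf_posterior_prob[OF s] reward_step_kernel[OF s]]
      sets_bind'[OF conf_posterior_prob[OF s] reward_step_kernel[OF s]]
    by (simp add: space_prob_algebra)
  show ?thesis
    unfolding step_system_def
  proof
    fix t
    show "mediated_kernel \<pi> s a m t \<in> Hist t \<rightarrow>\<^sub>M prob_algebra (step_space G)"
    proof (cases "t = 0")
      case True
      then show ?thesis using 0 by (simp add: mediated_kernel_def)
    next
      case False
      then have "mediated_kernel \<pi> s a m t = online_kernel G \<pi> t" by (simp add: mediated_kernel_def fun_eq_iff)
      then show ?thesis
        unfolding online_kernel_def by (simp add: measurable_step_kernel admissible_online \<pi>)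
    qed
  qed
qed

lemma nn_integral_mediated_0:
  assumes s: "s \<in> space S" and g: "g \<in> borel_measurable (step_space G)"
  shows "(\<integral>\<^sup>+x. g x \<partial>mediated_kernel \<pi> s a m 0 w) =
    (\<integral>\<^sup>+c. \<integral>\<^sup>+r. g (s, c, a, m, r) \<partial>p_r G s c a m \<partial>conf_posterior G s a m)"
proof -
  have sets: "sets (conf_posterior G s a m) = sets Cf" using conf_posterior_prob[OF s] by (simp add: space_prob_algebra)
  have "(\<lambda>c. reward_step G s c a m) \<in> conf_posterior G s a m \<rightarrow>\<^sub>M subprob_algebra (step_space G)"
    using measurable_prob_algebraD[OF reward_step_kernel[OF s]] by (simp add: measurable_cong_sets[OF sets refl])
  then show ?thesis
    unfolding mediated_kernel_def
    by (simp add: nn_integral_bind[OF g], intro nn_integral_cong)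
      (simp add: sets_eq_imp_space_eq[OF sets] nn_integral_reward_step[OF s _ g])
qed

lemma mediated_reward:
  assumes s: "s \<in> space S" and \<pi>: "\<pi> \<in> policies G"
  shows "AE w in traj_law G (mediated_kernel \<pi> s a m). \<bar>reward (w t)\<bar> \<le> Rmax"
proof (rule AE_traj_reward[OF step_system_mediated[OF s \<pi>]])
  fix w assume w: "w \<in> space (Hist t)"
  have mm: "(\<lambda>x. indicator {x. \<not> \<bar>reward x\<bar> \<le> Rmax} x :: ennreal) \<in> borel_measurable (step_space G)"
    unfolding indicator_def by measurable
  show "(\<integral>\<^sup>+x. indicator {x. \<not> \<bar>reward x\<bar> \<le> Rmax} x \<partial>mediated_kernel \<pi> s a m t w) = 0"
  proof (cases "t = 0")
    case True
    have "(\<integral>\<^sup>+r. indicator {x. \<not> \<bar>reward x\<bar> \<le> Rmax} (s, c, a, m, r) \<partial>p_r G s c a m) = 0"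
      if "c \<in> space Cf" for c
    proof -
      have "AE r in p_r G s c a m. indicator {x. \<not> \<bar>reward x\<bar> \<le> Rmax} (s, c, a, m, r) = (0::ennreal)"
        using reward_bound[OF s that] by eventually_elim (simp add: reward_def)
      then show ?thesis by (simp add: nn_integral_cong_AE)
    qed
    moreover have "space (conf_posterior G s a m) = space Cf"
      by (rule space_conf_posterior[OF s])
    ultimately show ?thesis
      unfolding True nn_integral_mediated_0[OF s mm] by (simp cong: nn_integral_cong_simp)
  next
    case False
    then have "mediated_kernel \<pi> s a m t w = online_kernel G \<pi> t w" by (simp add: mediated_kernel_def)
    then show ?thesis
      unfolding online_kernel_def using step_kernel_reward[OF admissible_online[OF \<pi>] w] by simp
  qed
qed

lemma nn_integral_mediated_step_value:
  assumes s: "s \<in> space S" and \<pi>: "\<pi> \<in> policies G" and v: "v \<in> borel_measurable S"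
  shows "(\<integral>\<^sup>+w. step_value v (w 0) \<partial>traj_law G (mediated_kernel \<pi> s a m)) = post_value v s a m"
proof -
  note K = step_system_mediated[OF s \<pi>, of a m]
  interpret prob_space "traj_law G (mediated_kernel \<pi> s a m)" by (rule traj_law_prob[OF K])
  have "space (conf_posterior G s a m) = space Cf"
    by (rule space_conf_posterior[OF s])
  then have "(\<integral>\<^sup>+c. \<integral>\<^sup>+r. step_value v (s, c, a, m, r) \<partial>p_r G s c a m \<partial>conf_posterior G s a m) = post_value v s a m"
    unfolding post_value_def by (intro nn_integral_cong) (simp add: nn_integral_step_value_reward[OF s])
  then show ?thesis
    unfolding nn_integral_traj_step[OF K measurable_step_value[OF v]]
      nn_integral_mediated_0[OF s measurable_step_value[OF v]]
    by (simp add: emeasure_space_1)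
qed

section \<open>Attainment and measurability of the optimal mediated Q-function\<close>

lemma state_step_step_value_le:
  assumes s: "s \<in> space S" and act: "\<And>c. act s c = p"
  shows "(\<integral>\<^sup>+x. step_value opt_value x \<partial>state_step act s) \<le> opt_value s"
proof -
  have "(\<integral>\<^sup>+x. step_value opt_value x \<partial>state_step act s) \<le> (\<Sum>a\<in>UNIV. ennreal (pmf p a) * opt_value s)"
    unfolding nn_integral_state_step_step_value[where act=act and p=p, OF s measurable_opt_value act]
    by (intro sum_mono mult_left_mono act_value_le_opt[OF s]) auto
  then show ?thesis by (simp add: sum_pmf_mult_const)
qed

lemma mediated_kernel_Suc:
  "mediated_kernel \<pi> s a m (Suc t) = step_kernel G (\<lambda>t w s c. \<pi> t (\<lambda>i\<in>{0..<t}. observe (w i)) s) (Suc t)"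
  by (simp add: mediated_kernel_def online_kernel_def fun_eq_iff)

lemma Q_bounded: "s \<in> space S \<Longrightarrow> \<pi> \<in> policies G \<Longrightarrow> \<bar>Q G \<pi> s a m\<bar> \<le> Vmax G Rmax"
  unfolding Q_def mediated_law_kernel
  by (rule disc_return_shift(2)[OF step_system_mediated mediated_reward])

text \<open>After the first step, each conditional backup is an average of action values whatever
  the history, hence at most \<open>opt_value\<close>; the first step contributes
  \<open>post_value\<close> exactly.\<close>

lemma Q_le_post_value:
  assumes s: "s \<in> space S" and \<pi>: "\<pi> \<in> policies G"
  shows "ennreal (Q G \<pi> s a m + Vmax G Rmax) \<le> post_value opt_value s a m"
  unfolding Q_def mediated_law_kernel disc_return_shift(1)[OF step_system_mediated[OF s \<pi>] mediated_reward[OF s \<pi>]]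
    nn_integral_mediated_step_value[OF s \<pi> measurable_opt_value, symmetric]
  by (rule shifted_return_le(1)[OF step_system_mediated[OF s \<pi>] admissible_online[OF \<pi>] mediated_kernel_Suc
      mediated_reward[OF s \<pi>] measurable_opt_value opt_value_bound state_step_step_value_le])
    simp_all

definition greedy_set :: "'s \<Rightarrow> 'a set" where
  "greedy_set s = {a. act_value opt_value s a = opt_value s}"

text \<open>The uniform law on all maximisers replaces the choice of one: its weights are quotients
  of measurable functions, so no measurable selection is needed. The default \<open>UNIV\<close>
  concerns points outside the state space, where maximisers in this sense may be missing.\<close>

definition greedy :: "'s \<Rightarrow> 'a pmf" where
  "greedy s = pmf_of_set (if greedy_set s = {} then UNIV else greedy_set s)"

lemma greedy_set_ne: assumes s: "s \<in> space S" shows "greedy_set s \<noteq> {}"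
proof -
  have "(SUP a. act_value opt_value s a) = Max (range (act_value opt_value s))"
    by (rule Max_Sup[symmetric]) auto
  also have "\<dots> \<in> range (act_value opt_value s)" by (rule Max_in) auto
  finally obtain a where "(SUP a. act_value opt_value s a) = act_value opt_value s a" by (rule imageE)
  then have "a \<in> greedy_set s" using opt_value_fixpoint[OF s] by (simp add: greedy_set_def)
  then show ?thesis by auto
qed

lemma pmf_greedy:
  assumes s: "s \<in> space S"
  shows "pmf (greedy s) a = (if act_value opt_value s a = opt_value s then 1 else 0) /
    (\<Sum>b\<in>UNIV. if act_value opt_value s b = opt_value s then 1 else 0)"
  using greedy_set_ne[OF s]
  by (simp add: greedy_def pmf_of_set[OF _ finite] sum.If_cases) (simp add: greedy_set_def indicator_def)

lemma measurable_greedy: "greedy \<in> stationary_policies G"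
  unfolding stationary_policies_def
proof safe
  fix a
  have "(\<lambda>s. (if act_value opt_value s a = opt_value s then 1 else 0) /
    (\<Sum>b\<in>UNIV. if act_value opt_value s b = opt_value s then 1 else 0) :: real) \<in> borel_measurable S"
    by measurable
  then show "(\<lambda>s. pmf (greedy s) a) \<in> borel_measurable S"
    by (rule measurable_cong[THEN iffD1, rotated]) (simp add: pmf_greedy)
qed

lemma stationary_in_policies:
  assumes "p \<in> stationary_policies G" shows "stationary p \<in> policies G"
  unfolding policies_def stationary_def
proof safe
  fix t a
  have "(\<lambda>s. pmf (p s) a) \<in> borel_measurable S" using assms by (auto simp: stationary_policies_def)
  from measurable_compose[OF measurable_snd this]
  show "(\<lambda>(h, s). pmf (p s) a) \<in> borel_measurable (PiM {0..<t} (\<lambda>_. obs_space G) \<Otimes>\<^sub>M S)"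
    by (simp add: split_beta')
qed

text \<open>\<open>greedy\<close> charges only actions that attain \<open>opt_value\<close>, so
  every inequality in the verification argument becomes an equality.\<close>

lemma Q_greedy:
  assumes s: "s \<in> space S"
  shows "ennreal (Q G (stationary greedy) s a m + Vmax G Rmax) = post_value opt_value s a m"
proof -
  note \<pi> = stationary_in_policies[OF measurable_greedy]
  have eq: "(\<integral>\<^sup>+x. step_value opt_value x \<partial>state_step (\<lambda>s c. greedy s) s) = opt_value s" if s: "s \<in> space S" for s
  proof -
    have "ennreal (pmf (greedy s) a) * act_value opt_value s a = ennreal (pmf (greedy s) a) * opt_value s" for a
      by (auto simp: pmf_greedy[OF s])
    then show ?thesis
      unfolding nn_integral_state_step_step_value[where act="\<lambda>s c. greedy s" and p="greedy s", OF s measurable_opt_value refl]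
      by (simp add: sum_pmf_mult_const)
  qed
  show ?thesis
  unfolding Q_def mediated_law_kernel disc_return_shift(1)[OF step_system_mediated[OF s \<pi>] mediated_reward[OF s \<pi>]]
    nn_integral_mediated_step_value[OF s \<pi> measurable_opt_value, symmetric]
  by (rule shifted_return_le(2)[OF step_system_mediated[OF s \<pi>] admissible_online[OF \<pi>] mediated_kernel_Suc
      mediated_reward[OF s \<pi>] measurable_opt_value opt_value_bound state_step_step_value_le])
    (simp_all add: stationary_def eq)
qed

text \<open>The supremum is attained at \<open>greedy\<close>, so the real-valued \<open>SUP\<close>
  is a maximum and not an unspecified value.\<close>

lemma Qstar_post_value:
  assumes s: "s \<in> space S"
  shows "ennreal (Qstar G s a m + Vmax G Rmax) = post_value opt_value s a m"
    and "\<bar>Qstar G s a m\<bar> \<le> Vmax G Rmax"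
proof -
  note \<pi> = stationary_in_policies[OF measurable_greedy]
  have "Q G \<pi>' s a m \<le> Q G (stationary greedy) s a m" if "\<pi>' \<in> policies G" for \<pi>'
    using Q_le_post_value[OF s that, of a m] Q_bounded[OF s that, of a m] Q_bounded[OF s \<pi>, of a m]
    unfolding Q_greedy[OF s, symmetric] by (subst (asm) ennreal_le_iff) auto
  then have "Qstar G s a m = Q G (stationary greedy) s a m"
    unfolding Qstar_def using \<pi> by (intro cSup_eq_maximum) auto
  then show "ennreal (Qstar G s a m + Vmax G Rmax) = post_value opt_value s a m"
    "\<bar>Qstar G s a m\<bar> \<le> Vmax G Rmax"
    using Q_greedy[OF s] Q_bounded[OF s \<pi>] by simp_all
qed

text \<open>Bayes' rule writes the posterior integral as a quotient of integrals against the kernel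
  \<open>p_c\<close>; where \<open>p_b\<close> vanishes it is the prior integral.\<close>

lemma measurable_post_value[measurable]: "v \<in> borel_measurable S \<Longrightarrow> (\<lambda>s. post_value v s a m) \<in> borel_measurable S"
proof -
  assume v: "v \<in> borel_measurable S"
  note p_a_meas[of a, measurable]
  have "(\<lambda>s. \<integral>\<^sup>+c. ennreal (pmf (p_a G s c) a) * conf_value v s c m \<partial>p_c G s) \<in> borel_measurable S"
    using p_a_meas[of a] measurable_conf_value[OF v, of m]
    by (intro nn_integral_measurable_subprob_algebra2[OF _ p_c_subprob]) (simp add: split_beta')
  then have "(\<lambda>s. if p_b G s a = 0 then med_value v s m
     else (\<integral>\<^sup>+c. ennreal (pmf (p_a G s c) a) * conf_value v s c m \<partial>p_c G s) / ennreal (p_b G s a)) \<in> borel_measurable S"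
    using v by measurable
  then show ?thesis
  proof (rule measurable_cong[THEN iffD1, rotated])
    fix s assume s: "s \<in> space S"
    show "(if p_b G s a = 0 then med_value v s m
     else (\<integral>\<^sup>+c. ennreal (pmf (p_a G s c) a) * conf_value v s c m \<partial>p_c G s) / ennreal (p_b G s a)) = post_value v s a m"
    proof (cases "p_b G s a = 0")
      case True
      then show ?thesis using s by (simp add: post_value_def med_value_def conf_posterior_null)
    next
      case False
      then have "ennreal (p_b G s a) \<noteq> 0" using p_b_nonneg[of s a] by simp
      then show ?thesis
        using False nn_integral_conf_posterior[OF s False measurable_conf_value_section[OF v s, of m], of m, symmetric]
        unfolding post_value_def
        by (simp add: ennreal_mult_divide_eq mult.commute[of "ennreal (p_b G s a)"])
    qed
  qed
qed

lemma measurable_Qstar[measurable]: "(\<lambda>s. Qstar G s a m) \<in> borel_measurable S"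
proof -
  have "(\<lambda>s. enn2real (post_value opt_value s a m) - Vmax G Rmax) \<in> borel_measurable S" by measurable
  then show ?thesis
  proof (rule measurable_cong[THEN iffD1, rotated])
    fix s assume s: "s \<in> space S"
    have "0 \<le> Qstar G s a m + Vmax G Rmax" using Qstar_post_value(2)[OF s, of a m] by linarith
    then show "enn2real (post_value opt_value s a m) - Vmax G Rmax = Qstar G s a m"
      by (simp add: Qstar_post_value(1)[OF s, symmetric])
  qed
qed

text \<open>The objective of \<open>optimal_policy\<close>, kept real and unshifted because it is
  later compared with the objective of the algorithm.\<close>

definition star_value :: "'s \<Rightarrow> 'a \<Rightarrow> real" where
  "star_value s a = (\<Sum>a'\<in>UNIV. \<Sum>m\<in>UNIV. p_med G s a m * p_b G s a' * Qstar G s a' m)"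

lemma star_value_shift:
  assumes s: "s \<in> space S"
  shows "star_value s a + k = (\<Sum>a'\<in>UNIV. \<Sum>m\<in>UNIV. p_med G s a m * p_b G s a' * (Qstar G s a' m + k))"
proof -
  have "(\<Sum>a'\<in>UNIV. \<Sum>m\<in>UNIV. p_med G s a m * p_b G s a' * k) = (\<Sum>a'\<in>UNIV. p_b G s a' * ((\<Sum>m\<in>UNIV. p_med G s a m) * k))"
    by (simp add: sum_distrib_left sum_distrib_right ac_simps)
  also have "\<dots> = k" using p_b_sum[OF s] by (simp add: p_med_sum[OF s] sum_distrib_right[symmetric])
  finally show ?thesis unfolding star_value_def by (simp add: distrib_left sum.distrib)
qed

text \<open>The front-door adjustment \<open>sum_post_value\<close> replaces each mediator value by
  a \<open>p_b\<close>-average of \<open>Qstar\<close>. The weights sum to 1, so the shift comes out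
  as a single \<open>Vmax\<close>.\<close>

lemma act_value_star:
  assumes s: "s \<in> space S"
  shows "act_value opt_value s a = ennreal (star_value s a + Vmax G Rmax)"
    and "0 \<le> star_value s a + Vmax G Rmax"
proof -
  have q: "0 \<le> Qstar G s a' m + Vmax G Rmax" for a' m
    using Qstar_post_value(2)[OF s, of a' m] by linarith
  show "0 \<le> star_value s a + Vmax G Rmax"
    unfolding star_value_shift[OF s] using q by (intro sum_nonneg mult_nonneg_nonneg) (auto simp: p_med_nonneg p_b_nonneg)
  have "act_value opt_value s a = (\<Sum>m\<in>UNIV. \<Sum>a'\<in>UNIV. ennreal (p_med G s a m) * (ennreal (p_b G s a') * ennreal (Qstar G s a' m + Vmax G Rmax)))"
    unfolding act_value_def sum_post_value[OF s measurable_opt_value, symmetric] Qstar_post_value(1)[OF s]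
    by (simp add: sum_distrib_left)
  also have "\<dots> = (\<Sum>m\<in>UNIV. \<Sum>a'\<in>UNIV. ennreal (p_med G s a m * p_b G s a' * (Qstar G s a' m + Vmax G Rmax)))"
    using q by (intro sum.cong refl) (simp add: ennreal_mult p_med_nonneg p_b_nonneg mult.assoc)
  also have "\<dots> = (\<Sum>a'\<in>UNIV. \<Sum>m\<in>UNIV. ennreal (p_med G s a m * p_b G s a' * (Qstar G s a' m + Vmax G Rmax)))"
    by (rule sum.swap)
  also have "\<dots> = ennreal (star_value s a + Vmax G Rmax)"
    unfolding star_value_shift[OF s] using q
    by (simp add: sum_ennreal sum_nonneg p_med_nonneg p_b_nonneg)
  finally show "act_value opt_value s a = ennreal (star_value s a + Vmax G Rmax)" .
qed

lemma optimal_policy_value: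
  assumes o: "optimal_policy G d" and s: "s \<in> space S"
  shows "act_value opt_value s (d s) = opt_value s"
proof -
  have "star_value s a \<le> star_value s (d s)" for a
    using o s by (auto simp: optimal_policy_def is_arg_max_def star_value_def not_less)
  then have "act_value opt_value s a \<le> act_value opt_value s (d s)" for a
    unfolding act_value_star(1)[OF s] by (intro ennreal_leI) simp
  then have "(SUP a. act_value opt_value s a) = act_value opt_value s (d s)"
    by (intro antisym SUP_least SUP_upper) auto
  then show ?thesis unfolding opt_value_fixpoint[OF s] by simp
qed

section \<open>Visitation densities and the regret identity\<close>

lemma deterministic_stationary:
  assumes d: "d \<in> S \<rightarrow>\<^sub>M count_space UNIV"
  shows "(\<lambda>s. return_pmf (d s)) \<in> stationary_policies G"
  unfolding stationary_policies_def
proof safe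
  fix a
  have "(\<lambda>s. if d s = a then 1 else 0 :: real) \<in> borel_measurable S" using d by measurable
  then show "(\<lambda>s. pmf (return_pmf (d s)) a) \<in> borel_measurable S"
    by (rule measurable_cong[THEN iffD1, rotated]) (simp add: indicator_def)
qed

lemma online_law_stationary:
  "online_law G (stationary p) = traj_law G (step_kernel G (\<lambda>t w s c. p s))"
  by (simp add: online_law_def online_kernel_def stationary_def)

lemma admissible_stationary:
  "p \<in> stationary_policies G \<Longrightarrow> admissible (\<lambda>t w s c. p s)"
  using admissible_online[OF stationary_in_policies] by (simp add: stationary_def)

lemma visit_dens_measurable:
  assumes p: "p \<in> stationary_policies G"
  shows "visit_dens G (stationary p) \<in> borel_measurable S"
proof -
  have "state_dens G (online_law G (stationary p)) t \<in> borel_measurable S" for t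
    unfolding online_law_stationary
    by (rule state_dens_measurable[OF step_system_step_kernel[OF admissible_stationary[OF p]]])
  then show ?thesis unfolding visit_dens_def[abs_def] by measurable
qed

lemma nn_integral_visit_dens:
  assumes p: "p \<in> stationary_policies G" and f[measurable]: "f \<in> borel_measurable S"
  shows "(\<integral>\<^sup>+s. visit_dens G (stationary p) s * f s \<partial>S) =
    ennreal (1 - disc G) * (\<Sum>t. ennreal (disc G ^ t) * (\<integral>\<^sup>+w. f (fst (w t)) \<partial>online_law G (stationary p)))"
proof -
  have [measurable]: "state_dens G (online_law G (stationary p)) t \<in> borel_measurable S" for t
    unfolding online_law_stationary
    by (rule state_dens_measurable[OF step_system_step_kernel[OF admissible_stationary[OF p]]])
  have 1: "(\<integral>\<^sup>+w. f (fst (w t)) \<partial>online_law G (stationary p)) =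
      (\<integral>\<^sup>+s. state_dens G (online_law G (stationary p)) t s * f s \<partial>S)" for t
    unfolding online_law_stationary by (rule nn_integral_state_dens[OF admissible_stationary[OF p] f])
  have "(\<integral>\<^sup>+s. visit_dens G (stationary p) s * f s \<partial>S) =
    (\<integral>\<^sup>+s. ennreal (1 - disc G) * (\<Sum>t. ennreal (disc G ^ t) * (state_dens G (online_law G (stationary p)) t s * f s)) \<partial>S)"
    unfolding visit_dens_def
    by (simp only: mult.assoc[symmetric] ennreal_suminf_multc[symmetric])
       (simp only: mult.assoc ennreal_suminf_multc[symmetric])
  then show ?thesis unfolding 1 by (simp add: nn_integral_cmult nn_integral_suminf)
qed

lemma visit_dens_total:
  assumes p: "p \<in> stationary_policies G"
  shows "(\<integral>\<^sup>+s. visit_dens G (stationary p) s \<partial>S) = 1"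
proof -
  interpret prob_space "online_law G (stationary p)"
    unfolding online_law_stationary by (rule traj_law_prob[OF step_system_step_kernel[OF admissible_stationary[OF p]]])
  have "(\<Sum>t. ennreal (disc G ^ t)) = ennreal (1 / (1 - disc G))"
    using disc by (subst suminf_ennreal2) (auto simp: suminf_geometric)
  then show ?thesis
    using nn_integral_visit_dens[OF p, of "\<lambda>_. 1"] disc
    by (simp add: emeasure_space_1 ennreal_mult[symmetric])
qed

text \<open>The discounted losses of \<open>d\<close> fill exactly the distance to the optimal
  value. The difference inside the integral is genuine, since no action value exceeds
  \<open>opt_value\<close>.\<close>

lemma J_deterministic:
  assumes d: "d \<in> S \<rightarrow>\<^sub>M count_space UNIV"
  shows "ennreal (J G (deterministic d) + Vmax G Rmax) +
     (\<Sum>t. ennreal (disc G ^ t) * (\<integral>\<^sup>+w. (opt_value (fst (w t)) - act_value opt_value (fst (w t)) (d (fst (w t)))) \<partial>online_law G (deterministic d)))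
     = (\<integral>\<^sup>+s. init_dens G s * opt_value s \<partial>S)"
    and "\<bar>J G (deterministic d)\<bar> \<le> Vmax G Rmax"
proof -
  define act where "act = (\<lambda>(t::nat) (w::nat \<Rightarrow> ('s, 'c, 'a, 'm) step) s (c::'c). return_pmf (d s))"
  define gap where "gap s = opt_value s - act_value opt_value s (d s)" for s
  let ?K = "step_kernel G act"
  let ?L = "traj_law G ?K"
  have L: "online_law G (deterministic d) = ?L"
    by (simp add: deterministic_def online_law_stationary act_def)
  have act: "admissible act"
    unfolding act_def by (rule admissible_stationary[OF deterministic_stationary[OF d]])
  note K = step_system_step_kernel[OF act]
  have R: "AE w in ?L. \<bar>reward (w t)\<bar> \<le> Rmax" for t
    by (rule AE_traj_reward[OF K step_kernel_reward[OF act]])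
  have md[measurable]: "(\<lambda>s. act_value opt_value s (d s)) \<in> borel_measurable S"
    by (rule measurable_compose_countable[OF measurable_act_value[OF measurable_opt_value] d])
  have gm[measurable]: "gap \<in> borel_measurable S" unfolding gap_def[abs_def] by measurable
  define e where "e t = (\<integral>\<^sup>+w. ennreal (reward (w t) + Rmax) \<partial>?L)" for t
  define x where "x t = (\<integral>\<^sup>+w. opt_value (fst (w t)) \<partial>?L)" for t
  define \<delta> where "\<delta> t = (\<integral>\<^sup>+w. gap (fst (w t)) \<partial>?L)" for t
  have mc: "(\<lambda>w. f (fst (w t))) \<in> borel_measurable ?L" if "f \<in> borel_measurable S" for f :: "'s \<Rightarrow> ennreal" and t
    by (rule measurable_compose[OF measurable_traj_component[OF K] measurable_compose[OF measurable_step_fst that]])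
  have step: "e t + ennreal (disc G) * x (Suc t) + \<delta> t = x t" for t
  proof -
    have "e t + ennreal (disc G) * x (Suc t) = (\<integral>\<^sup>+w. step_value opt_value (w t) \<partial>?L)"
      unfolding e_def x_def by (rule nn_integral_step_value_traj[OF K act refl measurable_opt_value, symmetric])
    also have "\<dots> = (\<integral>\<^sup>+w. act_value opt_value (fst (w t)) (d (fst (w t))) \<partial>?L)"
    proof (rule nn_integral_traj_eq[where W="\<lambda>s. act_value opt_value s (d s)", OF K act refl md measurable_step_value[OF measurable_opt_value]])
      fix w s assume s: "s \<in> space S"
      show "(\<integral>\<^sup>+x. step_value opt_value x \<partial>state_step (act t w) s) = act_value opt_value s (d s)"
        unfolding nn_integral_state_step_step_value[where act="act t w" and p="return_pmf (d s)", OF s measurable_opt_value act_def[THEN fun_cong, THEN fun_cong, THEN fun_cong, THEN fun_cong]]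
        using nn_integral_pmf_finite[where f="act_value opt_value s" and p="return_pmf (d s)"] by simp
    qed
    also have "\<dots> + \<delta> t = (\<integral>\<^sup>+w. act_value opt_value (fst (w t)) (d (fst (w t))) + gap (fst (w t)) \<partial>?L)"
      unfolding \<delta>_def by (rule nn_integral_add[OF mc[OF md] mc[OF gm], symmetric])
    also have "\<dots> = x t" unfolding x_def
    proof (intro nn_integral_cong)
      fix w assume "w \<in> space ?L"
      then have "fst (w t) \<in> space S" using traj_component_space[OF K] by (auto simp: space_step mem_Times_iff)
      then show "act_value opt_value (fst (w t)) (d (fst (w t))) + gap (fst (w t)) = opt_value (fst (w t))"
        unfolding gap_def by (intro add_diff_inverse_ennreal act_value_le_opt)
    qed
    finally show ?thesis .
  qed
  have "x t \<le> ennreal Bmax" for t unfolding x_def by (rule traj_expected_state_bound[OF K opt_value_bound])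
  then have "(\<Sum>t. ennreal (disc G ^ t) * e t) + (\<Sum>t. ennreal (disc G ^ t) * \<delta> t) = x 0"
    using disc step by (intro discounted_telescope[where B=Bmax]) auto
  moreover have "x 0 = (\<integral>\<^sup>+s. init_dens G s * opt_value s \<partial>S)"
    unfolding x_def nn_integral_state_dens[OF act measurable_opt_value] by simp
  moreover have "ennreal (J G (deterministic d) + Vmax G Rmax) = (\<Sum>t. ennreal (disc G ^ t) * e t)"
    unfolding J_def L disc_return_shift(1)[OF K R] by (simp add: shifted_return_def e_def)
  ultimately show "ennreal (J G (deterministic d) + Vmax G Rmax) +
     (\<Sum>t. ennreal (disc G ^ t) * (\<integral>\<^sup>+w. (opt_value (fst (w t)) - act_value opt_value (fst (w t)) (d (fst (w t)))) \<partial>online_law G (deterministic d)))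
     = (\<integral>\<^sup>+s. init_dens G s * opt_value s \<partial>S)"
    unfolding L \<delta>_def gap_def by simp
  show "\<bar>J G (deterministic d)\<bar> \<le> Vmax G Rmax"
    unfolding J_def L by (rule disc_return_shift(2)[OF K R])
qed

text \<open>A performance-difference formula: \<open>d'\<close> has zero loss at every state, so its
  value is the common right-hand side of \<open>J_deterministic\<close>, and the loss of
  \<open>d\<close> remains. The factor \<open>1 - disc G\<close> is the normalisation of the
  visitation density.\<close>

lemma regret_identity:
  assumes o: "optimal_policy G d'" and d: "d \<in> S \<rightarrow>\<^sub>M count_space UNIV"
  shows "ennreal (1 - disc G) * ennreal (J G (deterministic d') - J G (deterministic d)) =
    (\<integral>\<^sup>+s. visit_dens G (deterministic d) s * ennreal (star_value s (d' s) - star_value s (d s)) \<partial>S)"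
proof -
  define gap where "gap s = opt_value s - act_value opt_value s (d s)" for s
  have d': "d' \<in> S \<rightarrow>\<^sub>M count_space UNIV" using o by (simp add: optimal_policy_def)
  have [measurable]: "(\<lambda>s. act_value opt_value s (d s)) \<in> borel_measurable S"
    by (rule measurable_compose_countable[OF measurable_act_value[OF measurable_opt_value] d])
  have gm: "gap \<in> borel_measurable S" unfolding gap_def[abs_def] by measurable
  let ?Gap = "\<Sum>t. ennreal (disc G ^ t) * (\<integral>\<^sup>+w. gap (fst (w t)) \<partial>online_law G (deterministic d))"
  have K: "step_system (step_kernel G (\<lambda>t w s c. return_pmf (d' s)))"
    by (rule step_system_step_kernel[OF admissible_stationary[OF deterministic_stationary[OF d']]])
  have "(\<integral>\<^sup>+w. (opt_value (fst (w t)) - act_value opt_value (fst (w t)) (d' (fst (w t)))) \<partial>online_law G (deterministic d')) = (\<integral>\<^sup>+w. 0 \<partial>online_law G (deterministic d'))" for t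
    unfolding deterministic_def online_law_stationary
  proof (intro nn_integral_cong)
    fix w assume "w \<in> space (traj_law G (step_kernel G (\<lambda>t w s c. return_pmf (d' s))))"
    then have s: "fst (w t) \<in> space S" using traj_component_space[OF K] by (auto simp: space_step mem_Times_iff)
    then have "opt_value (fst (w t)) < \<top>" using le_less_trans[OF opt_value_bound[OF s] ennreal_less_top] by simp
    then show "opt_value (fst (w t)) - act_value opt_value (fst (w t)) (d' (fst (w t))) = 0"
      using optimal_policy_value[OF o s] by simp
  qed
  then have "ennreal (J G (deterministic d') + Vmax G Rmax) = (\<integral>\<^sup>+s. init_dens G s * opt_value s \<partial>S)"
    using J_deterministic(1)[OF d'] by simp
  also have "\<dots> = ennreal (J G (deterministic d) + Vmax G Rmax) + ?Gap"
    using J_deterministic(1)[OF d] by (simp add: gap_def)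
  finally have eq: "ennreal (J G (deterministic d') + Vmax G Rmax) = ennreal (J G (deterministic d) + Vmax G Rmax) + ?Gap" .
  have "ennreal (J G (deterministic d') - J G (deterministic d)) =
      ennreal ((J G (deterministic d') + Vmax G Rmax) - (J G (deterministic d) + Vmax G Rmax))" by simp
  also have "\<dots> = ennreal (J G (deterministic d') + Vmax G Rmax) - ennreal (J G (deterministic d) + Vmax G Rmax)"
    using J_deterministic(2)[OF d] by (intro ennreal_minus[symmetric]) auto
  also have "\<dots> = ?Gap" unfolding eq by simp
  finally have "ennreal (1 - disc G) * ennreal (J G (deterministic d') - J G (deterministic d)) = ennreal (1 - disc G) * ?Gap"
    by simp
  also have "\<dots> = (\<integral>\<^sup>+s. visit_dens G (deterministic d) s * gap s \<partial>S)"
    unfolding deterministic_def by (rule nn_integral_visit_dens[OF deterministic_stationary[OF d] gm, symmetric])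
  also have "\<dots> = (\<integral>\<^sup>+s. visit_dens G (deterministic d) s * ennreal (star_value s (d' s) - star_value s (d s)) \<partial>S)"
  proof (intro nn_integral_cong)
    fix s assume s: "s \<in> space S"
    have "gap s = ennreal ((star_value s (d' s) + Vmax G Rmax) - (star_value s (d s) + Vmax G Rmax))"
      unfolding gap_def optimal_policy_value[OF o s, symmetric] act_value_star(1)[OF s]
      by (intro ennreal_minus act_value_star(2)[OF s])
    then show "visit_dens G (deterministic d) s * gap s = visit_dens G (deterministic d) s * ennreal (star_value s (d' s) - star_value s (d s))"
      by simp
  qed
  finally show ?thesis .
qed

end

section \<open>Pessimism and coverage\<close>

text \<open>If \<open>f\<close> is not integrable, its integral is 0 by convention. This lets the
  expected regret be bounded without showing that the regret is measurable in the data.\<close>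

lemma ennreal_integral_le_nn_integral:
  fixes f :: "'x \<Rightarrow> real"
  shows "ennreal (\<integral>x. f x \<partial>M) \<le> (\<integral>\<^sup>+x. ennreal (f x) \<partial>M)"
proof (cases "integrable M f")
  case True
  have "ennreal (\<integral>x. f x \<partial>M) \<le> ennreal (\<integral>x. max 0 (f x) \<partial>M)"
    using True by (intro ennreal_leI integral_mono) auto
  also have "\<dots> = (\<integral>\<^sup>+x. ennreal (max 0 (f x)) \<partial>M)"
    using True by (intro nn_integral_eq_integral[symmetric]) auto
  finally show ?thesis by (simp add: ennreal_max_0')
qed (simp add: not_integrable_integral_eq)

text \<open>Cauchy-Schwarz with the weights split as \<open>sqrt (w i) * sqrt (w i)\<close>.\<close>

lemma weighted_abs_sum_le:
  fixes w z :: "'i \<Rightarrow> real"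
  assumes "\<And>i. i \<in> I \<Longrightarrow> 0 \<le> w i" and "sum w I = 1"
  shows "(\<Sum>i\<in>I. w i * \<bar>z i\<bar>) \<le> sqrt (\<Sum>i\<in>I. w i * (z i)\<^sup>2)"
proof -
  have "(\<Sum>i\<in>I. w i * \<bar>z i\<bar>) = (\<Sum>i\<in>I. \<bar>sqrt (w i)\<bar> * \<bar>sqrt (w i) * z i\<bar>)"
    using assms(1) by (intro sum.cong) (auto simp: abs_mult mult.assoc[symmetric])
  also have "\<dots> \<le> L2_set (\<lambda>i. sqrt (w i)) I * L2_set (\<lambda>i. sqrt (w i) * z i) I"
    by (rule L2_set_mult_ineq)
  also have "L2_set (\<lambda>i. sqrt (w i)) I = 1"
    using assms by (simp add: L2_set_def)
  also have "L2_set (\<lambda>i. sqrt (w i) * z i) I = sqrt (\<Sum>i\<in>I. w i * (z i)\<^sup>2)"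
    unfolding L2_set_def using assms(1) by (simp add: power_mult_distrib)
  finally show ?thesis by simp
qed

text \<open>The estimated objective \<open>\<Sum> (pmh - \<Delta>) pbh (Qh - \<kappa>)\<close> underestimates the objective with the true
  mediator probabilities at both actions, so only the gap at the comparator \<open>a1\<close> is paid for.\<close>

lemma pessimism_gap:
  fixes pm pmh \<Delta> Qs Qh :: "'a::finite \<Rightarrow> 'm::finite \<Rightarrow> real" and pb pbh :: "'a \<Rightarrow> real"
  assumes pm: "\<And>a. (\<Sum>m\<in>UNIV. pm a m) = 1" "\<And>a m. pmin \<le> pm a m" "\<And>a m. pm a m \<le> 1" and pmin: "0 < pmin"
    and pb: "\<And>a. 0 \<le> pb a" "(\<Sum>a\<in>UNIV. pb a) = 1"
    and pbh: "\<And>a. 0 \<le> pbh a" "(\<Sum>a\<in>UNIV. pbh a) = 1"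
    and Qh: "\<And>a m. \<kappa> \<le> Qh a m" "\<And>a m. Qh a m \<le> V" and \<kappa>: "- V \<le> \<kappa>"
    and good1: "\<And>m. \<bar>pmh a1 m - pm a1 m\<bar> \<le> \<Delta> a1 m" and good2: "\<And>m. \<bar>pmh a2 m - pm a2 m\<bar> \<le> \<Delta> a2 m"
    and opt: "(\<Sum>a'\<in>UNIV. \<Sum>m\<in>UNIV. (pmh a1 m - \<Delta> a1 m) * pbh a' * (Qh a' m - \<kappa>))
      \<le> (\<Sum>a'\<in>UNIV. \<Sum>m\<in>UNIV. (pmh a2 m - \<Delta> a2 m) * pbh a' * (Qh a' m - \<kappa>))"
  shows "(\<Sum>a'\<in>UNIV. \<Sum>m\<in>UNIV. pm a1 m * pb a' * Qs a' m) - (\<Sum>a'\<in>UNIV. \<Sum>m\<in>UNIV. pm a2 m * pb a' * Qs a' m)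
    \<le> 2 / pmin * (\<Sum>a'\<in>UNIV. \<Sum>m\<in>UNIV. pb a' * pm a' m * \<bar>Qs a' m - Qh a' m\<bar>)
      + 4 * V * (\<Sum>a\<in>UNIV. \<bar>pb a - pbh a\<bar>) + 4 * V * (\<Sum>m\<in>UNIV. \<bar>\<Delta> a1 m\<bar>)"
proof -
  define Qt where "Qt a m = Qh a m - \<kappa>" for a m
  define A where "A a = (\<Sum>a'\<in>UNIV. \<Sum>m\<in>UNIV. pm a m * pb a' * Qs a' m)" for a
  define U where "U a = (\<Sum>a'\<in>UNIV. \<Sum>m\<in>UNIV. pm a m * pbh a' * Qt a' m)" for a
  define L where "L a = (\<Sum>a'\<in>UNIV. \<Sum>m\<in>UNIV. (pmh a m - \<Delta> a m) * pbh a' * Qt a' m)" for a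
  define X where "X = (\<Sum>a'\<in>UNIV. \<Sum>m\<in>UNIV. pb a' * pm a' m * \<bar>Qs a' m - Qh a' m\<bar>)"
  define Y where "Y = (\<Sum>a\<in>UNIV. \<bar>pb a - pbh a\<bar>)"
  have pm0: "0 \<le> pm a m" for a m using pm(2)[of a m] pmin by linarith
  have Qt: "0 \<le> Qt a m" "Qt a m \<le> 2 * V" for a m
    using Qh[of a m] Qh(1)[of a m] \<kappa> by (auto simp: Qt_def)
  have k: "(\<Sum>a'\<in>UNIV. \<Sum>m\<in>UNIV. pm a m * pb a' * \<kappa>) = \<kappa>" for a
  proof -
    have "(\<Sum>a'\<in>UNIV. \<Sum>m\<in>UNIV. pm a m * pb a' * \<kappa>) = (\<Sum>a'\<in>UNIV. pb a' * ((\<Sum>m\<in>UNIV. pm a m) * \<kappa>))"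
      by (simp add: sum_distrib_left sum_distrib_right ac_simps)
    then show ?thesis by (simp add: pm(1) sum_distrib_right[symmetric] pb(2))
  qed
  \<comment> \<open>The weights \<open>pm a m * pb a'\<close> sum to 1, so subtracting
    \<open>\<kappa>\<close> from \<open>A a\<close> replaces \<open>Qs\<close> by
    \<open>Qs - \<kappa>\<close>. The difference to \<open>U a\<close> then splits into the error of
    \<open>Qh\<close> weighted by \<open>pb\<close> and the error of \<open>pbh\<close> weighted by
    \<open>Qt\<close>, which is at most \<open>2 * V\<close>.\<close>
  have diff: "\<bar>A a - \<kappa> - U a\<bar> \<le> 1 / pmin * X + 2 * V * Y" for a
  proof -
    have "A a - \<kappa> - U a = (\<Sum>a'\<in>UNIV. \<Sum>m\<in>UNIV. pm a m * pb a' * Qs a' m - pm a m * pb a' * \<kappa> - pm a m * pbh a' * Qt a' m)"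
      unfolding A_def U_def by (subst k[of a, symmetric]) (simp only: sum_subtractf)
    also have "\<dots> = (\<Sum>a'\<in>UNIV. \<Sum>m\<in>UNIV. pm a m * pb a' * (Qs a' m - Qh a' m) + pm a m * ((pb a' - pbh a') * Qt a' m))"
      by (simp add: Qt_def algebra_simps)
    also have "\<bar>\<dots>\<bar> \<le> (\<Sum>a'\<in>UNIV. \<Sum>m\<in>UNIV. \<bar>pm a m * pb a' * (Qs a' m - Qh a' m) + pm a m * ((pb a' - pbh a') * Qt a' m)\<bar>)"
      by (intro order_trans[OF sum_abs] sum_mono order_refl)
    also have "\<dots> \<le> (\<Sum>a'\<in>UNIV. \<Sum>m\<in>UNIV. 1 / pmin * (pb a' * pm a' m * \<bar>Qs a' m - Qh a' m\<bar>) + pm a m * (\<bar>pb a' - pbh a'\<bar> * (2 * V)))"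
    proof (intro sum_mono)
      fix a' m
      \<comment> \<open>The error norm draws the mediator under \<open>a'\<close> itself, the
        objective under \<open>a\<close>. Exchanging the two laws costs \<open>1 / pmin\<close>, as
        \<open>pm a m\<close> is at most 1 and \<open>pm a' m\<close> at least
        \<open>pmin\<close>.\<close>
      have "pm a m \<le> 1 / pmin * pm a' m"
        using pm(2)[of a' m] pm(3)[of a m] pmin by (simp add: field_simps)
          (metis mult_left_le_one_le mult.commute order_trans pm0 less_imp_le mult_right_le_one_le)
      then have "pm a m * (pb a' * \<bar>Qs a' m - Qh a' m\<bar>) \<le> 1 / pmin * pm a' m * (pb a' * \<bar>Qs a' m - Qh a' m\<bar>)"
        using pb(1) by (intro mult_right_mono) auto
      then have 1: "\<bar>pm a m * pb a' * (Qs a' m - Qh a' m)\<bar> \<le> 1 / pmin * (pb a' * pm a' m * \<bar>Qs a' m - Qh a' m\<bar>)"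
        using pm0 pb(1) by (simp add: abs_mult ac_simps)
      have "\<bar>pm a m * ((pb a' - pbh a') * Qt a' m)\<bar> = pm a m * (\<bar>pb a' - pbh a'\<bar> * Qt a' m)"
        using pm0 Qt by (simp add: abs_mult)
      also have "\<dots> \<le> pm a m * (\<bar>pb a' - pbh a'\<bar> * (2 * V))"
        using pm0 Qt by (intro mult_left_mono) auto
      finally show "\<bar>pm a m * pb a' * (Qs a' m - Qh a' m) + pm a m * ((pb a' - pbh a') * Qt a' m)\<bar>
        \<le> 1 / pmin * (pb a' * pm a' m * \<bar>Qs a' m - Qh a' m\<bar>) + pm a m * (\<bar>pb a' - pbh a'\<bar> * (2 * V))"
        using 1 by linarith
    qed
    also have "\<dots> = 1 / pmin * X + (\<Sum>a'\<in>UNIV. (\<Sum>m\<in>UNIV. pm a m) * (\<bar>pb a' - pbh a'\<bar> * (2 * V)))"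
      unfolding X_def by (simp only: sum.distrib sum_distrib_left sum_distrib_right)
    also have "\<dots> = 1 / pmin * X + 2 * V * Y"
      unfolding Y_def by (simp add: pm(1) sum_distrib_left mult.commute)
    finally show ?thesis .
  qed
  \<comment> \<open>This is pessimism: subtracting the infimum made \<open>Qt\<close> nonnegative,
    so underestimated mediator weights give an underestimated objective.\<close>
  have L2: "L a2 \<le> U a2"
    unfolding L_def U_def
  proof (intro sum_mono mult_right_mono)
    show "pmh a2 m - \<Delta> a2 m \<le> pm a2 m" for m using good2[of m] by linarith
  qed (use pbh Qt in auto)
  \<comment> \<open>The coefficient \<open>4 * V\<close> is the width
    \<open>2 * \<bar>\<Delta> a1 m\<bar>\<close> of the confidence interval times the bound
    \<open>2 * V\<close> on \<open>Qt\<close>.\<close>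
  have "U a1 - L a1 = (\<Sum>a'\<in>UNIV. \<Sum>m\<in>UNIV. (pm a1 m - pmh a1 m + \<Delta> a1 m) * (pbh a' * Qt a' m))"
    unfolding U_def L_def by (simp add: sum_subtractf[symmetric] algebra_simps)
  also have "\<dots> \<le> (\<Sum>a'\<in>UNIV. \<Sum>m\<in>UNIV. (2 * \<bar>\<Delta> a1 m\<bar>) * (pbh a' * (2 * V)))"
  proof (intro sum_mono mult_mono mult_left_mono)
    show "pm a1 m - pmh a1 m + \<Delta> a1 m \<le> 2 * \<bar>\<Delta> a1 m\<bar>" for m using good1[of m] by linarith
  qed (use pbh Qt in auto)
  also have "\<dots> = (\<Sum>a'\<in>UNIV. pbh a' * (4 * V * (\<Sum>m\<in>UNIV. \<bar>\<Delta> a1 m\<bar>)))"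
    by (simp add: sum_distrib_left sum_distrib_right ac_simps)
  also have "\<dots> = 4 * V * (\<Sum>m\<in>UNIV. \<bar>\<Delta> a1 m\<bar>)"
    unfolding sum_distrib_right[symmetric] pbh(2) by simp
  finally have L1: "U a1 - L a1 \<le> 4 * V * (\<Sum>m\<in>UNIV. \<bar>\<Delta> a1 m\<bar>)" .
  have "L a1 \<le> L a2" using opt unfolding L_def Qt_def .
  moreover have "A a1 - \<kappa> - U a1 \<le> 1 / pmin * X + 2 * V * Y" "- (A a2 - \<kappa> - U a2) \<le> 1 / pmin * X + 2 * V * Y"
    using diff[of a1] diff[of a2] unfolding abs_le_iff by blast+
  ultimately have "A a1 - A a2 \<le> 2 * (1 / pmin * X + 2 * V * Y) + 4 * V * (\<Sum>m\<in>UNIV. \<bar>\<Delta> a1 m\<bar>)"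
    using L1 L2 by (simp only: distrib_left mult_2)
  then show ?thesis unfolding A_def X_def Y_def by simp
qed

section \<open>Domination of visitation densities by the data density\<close>

context confounded_m2dp begin

lemma data_dens_measurable: "data_dens G n T \<in> borel_measurable S"
proof -
  have "state_dens G (offline_law G) t \<in> borel_measurable S" for t
    unfolding offline_law_def by (rule state_dens_measurable[OF step_system_step_kernel[OF admissible_offline]])
  then show ?thesis unfolding data_dens_def[abs_def] by measurable
qed

lemma data_dens_total:
  assumes "0 < n" "\<And>i. i < n \<Longrightarrow> 0 < T i"
  shows "(\<integral>\<^sup>+s. data_dens G n T s \<partial>S) = 1"
proof -
  have [measurable]: "state_dens G (offline_law G) t \<in> borel_measurable S" for t
    unfolding offline_law_def by (rule state_dens_measurable[OF step_system_step_kernel[OF admissible_offline]])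
  have 1: "(\<integral>\<^sup>+s. state_dens G (offline_law G) t s \<partial>S) = 1" for t
    unfolding offline_law_def by (rule state_dens_total[OF admissible_offline])
  have "(\<integral>\<^sup>+s. data_dens G n T s \<partial>S) = (\<Sum>i<n. (\<Sum>t<T i. 1) / of_nat (T i)) / (of_nat n :: ennreal)"
    unfolding data_dens_def by (simp add: nn_integral_divide nn_integral_sum 1)
  also have "\<dots> = (\<Sum>i<n. 1) / (of_nat n :: ennreal)"
  proof (intro arg_cong2[where f="(/)"] sum.cong refl)
    fix i assume "i \<in> {..<n}"
    then have "T i \<noteq> 0" using assms(2)[of i] by simp
    then show "(\<Sum>t<T i. 1) / of_nat (T i) = (1 :: ennreal)"
      by (simp add: ennreal_divide_self of_nat_less_top)
  qed
  also have "\<dots> = 1" using assms(1) by (simp add: ennreal_divide_self of_nat_less_top)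
  finally show ?thesis .
qed

text \<open>Where the data density vanishes, a positive visitation density would make the quotient
  infinite, so finite \<open>c1\<close> forces it to be 0. Where the data density is infinite the
  quotient cannot be undone, but it has integral 1 and these points form a null set.\<close>

lemma visit_le_data:
  assumes n: "0 < n" "\<And>i. i < n \<Longrightarrow> 0 < T i" and c1: "c1 G n T < \<top>" and p: "p \<in> stationary_policies G"
  shows "AE s in S. visit_dens G (stationary p) s \<le> c1 G n T * data_dens G n T s"
proof -
  have "AE s in S. data_dens G n T s \<noteq> \<infinity>"
    using data_dens_total[of n T] n by (intro nn_integral_PInf_AE data_dens_measurable) auto
  moreover have "AE s in S. s \<in> space S" by simp
  ultimately show ?thesis
  proof eventually_elim
    case (elim s)
    have le: "visit_dens G (stationary p) s / data_dens G n T s \<le> c1 G n T"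
      unfolding c1_def by (rule SUP_upper2[OF elim(2)], rule SUP_upper2[OF p]) simp
    show ?case
    proof (cases "data_dens G n T s = 0")
      case True
      then have "visit_dens G (stationary p) s = 0"
        using le c1 by (cases "visit_dens G (stationary p) s = 0") (auto simp: top_unique)
      then show ?thesis by simp
    next
      case False
      then have "visit_dens G (stationary p) s = visit_dens G (stationary p) s / data_dens G n T s * data_dens G n T s"
        using elim(1) by (simp add: ennreal_divide_times ennreal_divide_self less_top[symmetric])
      also have "\<dots> \<le> c1 G n T * data_dens G n T s" by (intro mult_right_mono le) simp
      finally show ?thesis .
    qed
  qed
qed

end

context front_door_m2dp begin

lemma nn_integral_visit_le_data:
  assumes n: "0 < n" "\<And>i. i < n \<Longrightarrow> 0 < T i" and c1: "c1 G n T < \<top>" and p: "p \<in> stationary_policies G"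
    and f[measurable]: "f \<in> borel_measurable S"
  shows "(\<integral>\<^sup>+s. visit_dens G (stationary p) s * f s \<partial>S) \<le> c1 G n T * (\<integral>\<^sup>+s. f s \<partial>data_states G n T)"
proof -
  note data_dens_measurable[of n T, measurable]
  have "(\<integral>\<^sup>+s. visit_dens G (stationary p) s * f s \<partial>S) \<le> (\<integral>\<^sup>+s. c1 G n T * (data_dens G n T s * f s) \<partial>S)"
    using visit_le_data[OF n c1 p] by (intro nn_integral_mono_AE) (auto elim!: eventually_mono simp: mult.assoc[symmetric] intro!: mult_right_mono)
  then show ?thesis unfolding data_states_def by (simp add: nn_integral_cmult nn_integral_density)
qed

text \<open>Jensen is applied under the visitation density before the change of density, so
  \<open>c1\<close> ends up under the square root.\<close>

lemma nn_integral_visit_esqrt: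
  assumes n: "0 < n" "\<And>i. i < n \<Longrightarrow> 0 < T i" and c1: "c1 G n T < \<top>" and p: "p \<in> stationary_policies G"
    and f[measurable]: "f \<in> borel_measurable S"
  shows "(\<integral>\<^sup>+s. visit_dens G (stationary p) s * esqrt (f s) \<partial>S) \<le> esqrt (c1 G n T * (\<integral>\<^sup>+s. f s \<partial>data_states G n T))"
proof -
  note visit_dens_measurable[OF p, measurable]
  let ?M = "density S (visit_dens G (stationary p))"
  have "emeasure ?M (space ?M) \<le> 1"
    using visit_dens_total[OF p] by (simp add: emeasure_density cong: nn_integral_cong_simp)
  then have "(\<integral>\<^sup>+s. esqrt (f s) \<partial>?M) \<le> esqrt (\<integral>\<^sup>+s. f s \<partial>?M)"
    by (rule nn_integral_esqrt_le) simp
  also have "(\<integral>\<^sup>+s. f s \<partial>?M) = (\<integral>\<^sup>+s. visit_dens G (stationary p) s * f s \<partial>S)"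
    by (simp add: nn_integral_density)
  finally have "(\<integral>\<^sup>+s. esqrt (f s) \<partial>?M) \<le> esqrt (c1 G n T * (\<integral>\<^sup>+s. f s \<partial>data_states G n T))"
    by (rule order_trans[OF _ esqrt_mono[OF nn_integral_visit_le_data[OF n c1 p f]]])
  then show ?thesis by (simp add: nn_integral_density)
qed

end

lemma measurable_KL[measurable]:
  assumes [measurable]: "\<And>x. (\<lambda>w. p w x) \<in> borel_measurable M" "\<And>x. (\<lambda>w. q w x) \<in> borel_measurable M"
  shows "(\<lambda>w. KL (p w) (q w)) \<in> borel_measurable M"
  unfolding KL_def by measurable

section \<open>From pointwise gaps to expected regret\<close>

context front_door_m2dp begin

lemma star_value_bound: "s \<in> space S \<Longrightarrow> \<bar>star_value s a\<bar> \<le> Vmax G Rmax"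
proof -
  assume s: "s \<in> space S"
  have "star_value s a + - Vmax G Rmax \<le> 0"
    unfolding star_value_shift[OF s]
  proof (intro sum_nonpos mult_nonneg_nonpos)
    show "Qstar G s a' m + - Vmax G Rmax \<le> 0" for a' m
      using Qstar_post_value(2)[OF s, of a' m] by linarith
  qed (simp add: p_med_nonneg p_b_nonneg)
  then show ?thesis using act_value_star(2)[OF s, of a] by linarith
qed

lemma sets_data_states[measurable_cong]: "sets (data_states G n T) = sets S"
  by (simp add: data_states_def)

lemma data_states_prob:
  assumes "0 < n" "\<And>i. i < n \<Longrightarrow> 0 < T i" shows "prob_space (data_states G n T)"
  using data_dens_total[of n T] assms data_dens_measurable[of n T]
  by (intro prob_spaceI) (simp add: data_states_def emeasure_density cong: nn_integral_cong_simp)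

lemma measurable_nn_integral_data:
  assumes n: "0 < n" "\<And>i. i < n \<Longrightarrow> 0 < T i" and f: "(\<lambda>(w, s). f w s) \<in> borel_measurable (P \<Otimes>\<^sub>M S)"
  shows "(\<lambda>w. \<integral>\<^sup>+s. f w s \<partial>data_states G n T) \<in> borel_measurable P"
proof -
  interpret prob_space "data_states G n T" by (rule data_states_prob[OF n])
  note f[measurable]
  show ?thesis by measurable
qed

text \<open>A failed confidence bound at either action is charged \<open>2 * Vmax\<close>. The
  charge is a sum over all pairs \<open>(a, m)\<close> because \<open>a2\<close> will be an action
  chosen from the data, for which no individual confidence statement is available.\<close>

lemma pointwise_gap:
  fixes pbh :: "'a pmf" and pmh \<Delta> :: "'a \<Rightarrow> 'm \<Rightarrow> real" and Qh :: "'s \<Rightarrow> 'a \<Rightarrow> 'm \<Rightarrow> real"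
  assumes c3: "c3 G dopt < \<top>" and s: "s \<in> space S"
    and Qh: "\<And>s a m. s \<in> space S \<Longrightarrow> \<bar>Qh s a m\<bar> \<le> Vmax G Rmax"
  defines "\<kappa> \<equiv> INF (s', a', m')\<in>space S \<times> UNIV. Qh s' a' m'"
  assumes opt: "(\<Sum>a'\<in>UNIV. \<Sum>m\<in>UNIV. (pmh (dopt s) m - \<Delta> (dopt s) m) * pmf pbh a' * (Qh s a' m - \<kappa>))
      \<le> (\<Sum>a'\<in>UNIV. \<Sum>m\<in>UNIV. (pmh a2 m - \<Delta> a2 m) * pmf pbh a' * (Qh s a' m - \<kappa>))"
  shows "ennreal (star_value s (dopt s) - star_value s a2) \<le>
    ennreal (2 / pmin) * esqrt (\<Sum>a\<in>UNIV. \<Sum>m\<in>UNIV. ennreal (p_b G s a * p_med G s a m * (Qstar G s a m - Qh s a m)\<^sup>2))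
    + ennreal (8 * Vmax G Rmax) * esqrt (KL (p_b G s) (pmf pbh))
    + ennreal (4 * Vmax G Rmax) * (\<Sum>m\<in>UNIV. esqrt (c3 G dopt * (\<Sum>a\<in>UNIV. ennreal (p_b G s a * (\<Delta> a m)\<^sup>2))))
    + ennreal (2 * Vmax G Rmax) * (\<Sum>a\<in>UNIV. \<Sum>m\<in>UNIV. if \<bar>pmh a m - p_med G s a m\<bar> \<le> \<Delta> a m then 0 else 1)"
    (is "_ \<le> ?X + ?K + ?D + ?B")
proof (cases "\<forall>m. \<bar>pmh (dopt s) m - p_med G s (dopt s) m\<bar> \<le> \<Delta> (dopt s) m \<and> \<bar>pmh a2 m - p_med G s a2 m\<bar> \<le> \<Delta> a2 m")
  case False
  then obtain a m where am: "\<not> \<bar>pmh a m - p_med G s a m\<bar> \<le> \<Delta> a m" by blast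
  let ?f = "\<lambda>a m. if \<bar>pmh a m - p_med G s a m\<bar> \<le> \<Delta> a m then 0 else 1 :: ennreal"
  have "1 = ?f a m" using am by simp
  also have "\<dots> \<le> (\<Sum>m\<in>UNIV. ?f a m)" by (rule member_le_sum) auto
  also have "\<dots> \<le> (\<Sum>a\<in>UNIV. \<Sum>m\<in>UNIV. ?f a m)"
    by (rule member_le_sum[where f="\<lambda>a. \<Sum>m\<in>UNIV. ?f a m"]) auto
  finally have "ennreal (2 * Vmax G Rmax) * 1 \<le> ?B" by (rule mult_left_mono) simp
  moreover have "ennreal (star_value s (dopt s) - star_value s a2) \<le> ennreal (2 * Vmax G Rmax)"
    using star_value_bound[OF s, of "dopt s"] star_value_bound[OF s, of a2] by (intro ennreal_leI) linarith
  ultimately have "ennreal (star_value s (dopt s) - star_value s a2) \<le> ?B" by simp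
  then show ?thesis by (rule order_trans) simp
next
  case True
  define V where "V = Vmax G Rmax"
  have V: "0 \<le> V" unfolding V_def by (rule Vmax_nonneg)
  have ne: "space S \<times> (UNIV :: ('a \<times> 'm) set) \<noteq> {}" using space_S_ne by simp
  have Qb: "- V \<le> Qh s a m" "Qh s a m \<le> V" if "s \<in> space S" for s a m
    using Qh[OF that, of a m] by (auto simp: V_def)
  have \<kappa>1: "- V \<le> \<kappa>" unfolding \<kappa>_def using ne by (intro cINF_greatest) (auto simp: Qb)
  have "bdd_below ((\<lambda>(s', a', m'). Qh s' a' m') ` (space S \<times> UNIV))"
    by (rule bdd_belowI2[of _ "- V"]) (auto simp: Qb)
  then have \<kappa>2: "\<kappa> \<le> Qh s a m" for a m
    unfolding \<kappa>_def using s cINF_lower[of "\<lambda>(s', a', m'). Qh s' a' m'" "space S \<times> UNIV" "(s, a, m)"] by simp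
  let ?X' = "\<Sum>a\<in>UNIV. \<Sum>m\<in>UNIV. p_b G s a * p_med G s a m * \<bar>Qstar G s a m - Qh s a m\<bar>"
  let ?Y' = "\<Sum>a\<in>UNIV. \<bar>p_b G s a - pmf pbh a\<bar>"
  have "star_value s (dopt s) - star_value s a2 \<le> 2 / pmin * ?X' + 4 * V * ?Y' + 4 * V * (\<Sum>m\<in>UNIV. \<bar>\<Delta> (dopt s) m\<bar>)"
    unfolding star_value_def
    by (rule pessimism_gap[where pm="p_med G s" and pmh=pmh and \<kappa>=\<kappa> and pbh="pmf pbh"])
      (use True opt in \<open>auto simp: p_med_sum[OF s] p_med_lower[OF s] p_med_le_1[OF s] pmin_pos p_b_nonneg p_b_sum[OF s]
        sum_pmf_UNIV \<kappa>1 \<kappa>2 Qb[OF s]\<close>)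
  then have "ennreal (star_value s (dopt s) - star_value s a2) \<le> ennreal (2 / pmin * ?X' + 4 * V * ?Y' + 4 * V * (\<Sum>m\<in>UNIV. \<bar>\<Delta> (dopt s) m\<bar>))"
    by (rule ennreal_leI)
  also have "\<dots> = ennreal (2 / pmin) * ennreal ?X' + ennreal (4 * V) * ennreal ?Y' + ennreal (4 * V) * (\<Sum>m\<in>UNIV. ennreal \<bar>\<Delta> (dopt s) m\<bar>)"
  proof -
    have "ennreal (p * x + q * y + r * z) = ennreal p * ennreal x + ennreal q * ennreal y + ennreal r * ennreal z"
      if "0 \<le> p" "0 \<le> q" "0 \<le> r" "0 \<le> x" "0 \<le> y" "0 \<le> z" for p q r x y z
      using that by (simp add: ennreal_plus ennreal_mult)
    from this[of "2 / pmin" "4 * V" "4 * V" ?X' ?Y' "\<Sum>m\<in>UNIV. \<bar>\<Delta> (dopt s) m\<bar>"] show ?thesis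
      using V pmin_pos by (simp only: sum_ennreal[OF abs_ge_zero]) (simp add: sum_nonneg p_b_nonneg p_med_nonneg)
  qed
  also have "\<dots> \<le> ?X + ?K + ?D"
  proof (intro add_mono)
    have "?X' = (\<Sum>(a, m)\<in>UNIV \<times> UNIV. p_b G s a * p_med G s a m * \<bar>Qstar G s a m - Qh s a m\<bar>)"
      by (rule sum.cartesian_product)
    also have "\<dots> \<le> sqrt (\<Sum>(a, m)\<in>UNIV \<times> UNIV. p_b G s a * p_med G s a m * (Qstar G s a m - Qh s a m)\<^sup>2)"
    proof -
      have "(\<Sum>i\<in>UNIV \<times> UNIV. p_b G s (fst i) * p_med G s (fst i) (snd i)) = (\<Sum>a\<in>UNIV. \<Sum>m\<in>UNIV. p_b G s a * p_med G s a m)"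
        unfolding sum.cartesian_product by (simp add: split_beta')
      also have "\<dots> = 1" by (simp add: sum_distrib_left[symmetric] p_med_sum[OF s] p_b_sum[OF s])
      finally show ?thesis
        using weighted_abs_sum_le[of "UNIV \<times> UNIV" "\<lambda>i. p_b G s (fst i) * p_med G s (fst i) (snd i)"
            "\<lambda>i. Qstar G s (fst i) (snd i) - Qh s (fst i) (snd i)"]
        by (simp add: split_beta' p_b_nonneg p_med_nonneg)
    qed
    also have "(\<Sum>(a, m)\<in>UNIV \<times> UNIV. p_b G s a * p_med G s a m * (Qstar G s a m - Qh s a m)\<^sup>2) =
        (\<Sum>a\<in>UNIV. \<Sum>m\<in>UNIV. p_b G s a * p_med G s a m * (Qstar G s a m - Qh s a m)\<^sup>2)"
      by (rule sum.cartesian_product[symmetric])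
    finally have "ennreal ?X' \<le> esqrt (ennreal (\<Sum>a\<in>UNIV. \<Sum>m\<in>UNIV. p_b G s a * p_med G s a m * (Qstar G s a m - Qh s a m)\<^sup>2))"
      by (subst esqrt_ennreal) (auto intro!: sum_nonneg ennreal_leI simp: p_b_nonneg p_med_nonneg)
    then have "ennreal ?X' \<le> esqrt (\<Sum>a\<in>UNIV. \<Sum>m\<in>UNIV. ennreal (p_b G s a * p_med G s a m * (Qstar G s a m - Qh s a m)\<^sup>2))"
      by (simp add: sum_ennreal sum_nonneg p_b_nonneg p_med_nonneg)
    then show "ennreal (2 / pmin) * ennreal ?X' \<le> ?X" by (rule mult_left_mono) simp
  next
    \<comment> \<open>The 2 of the Hellinger bound and the \<open>4 * V\<close> of
      \<open>pessimism_gap\<close> give the coefficient \<open>8 * V\<close>.\<close>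
    have "ennreal ?Y' \<le> 2 * esqrt (KL (p_b G s) (pmf pbh))"
      by (rule L1_le_KL) (auto simp: p_b_nonneg p_b_sum[OF s] sum_pmf_UNIV)
    then have "ennreal (4 * V) * ennreal ?Y' \<le> ennreal (4 * V) * (2 * esqrt (KL (p_b G s) (pmf pbh)))"
      by (rule mult_left_mono) simp
    also have "\<dots> = (ennreal (4 * V) * ennreal 2) * esqrt (KL (p_b G s) (pmf pbh))" by (simp add: mult.assoc)
    also have "ennreal (4 * V) * ennreal 2 = ennreal (8 * V)" using V by (subst ennreal_mult[symmetric]) auto
    finally show "ennreal (4 * V) * ennreal ?Y' \<le> ?K" by (simp add: V_def)
  next
    have c: "inverse (ennreal (p_b G s (dopt s))) \<le> c3 G dopt"
      unfolding c3_def by (rule SUP_upper[OF s])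
    \<comment> \<open>\<open>inverse 0\<close> is \<open>\<top>\<close> in \<open>ennreal\<close>,
      so finite \<open>c3\<close> makes the optimal action observable. Its squared width is then one
      summand of the behaviour average, divided by its probability.\<close>
    then have pb: "0 < p_b G s (dopt s)"
      using c3 p_b_nonneg[of s "dopt s"] by (cases "p_b G s (dopt s) = 0") (auto simp: top_unique)
    have "ennreal \<bar>\<Delta> (dopt s) m\<bar> \<le> esqrt (c3 G dopt * (\<Sum>a\<in>UNIV. ennreal (p_b G s a * (\<Delta> a m)\<^sup>2)))" for m
      unfolding ennreal_abs_eq_esqrt
    proof (rule esqrt_mono)
      have "ennreal ((\<Delta> (dopt s) m)\<^sup>2) = inverse (ennreal (p_b G s (dopt s))) * ennreal (p_b G s (dopt s) * (\<Delta> (dopt s) m)\<^sup>2)"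
        using pb by (simp add: inverse_ennreal ennreal_mult[symmetric])
      also have "\<dots> \<le> c3 G dopt * (\<Sum>a\<in>UNIV. ennreal (p_b G s a * (\<Delta> a m)\<^sup>2))"
        by (intro mult_mono c member_le_sum[where f="\<lambda>a. ennreal (p_b G s a * (\<Delta> a m)\<^sup>2)"]) auto
      finally show "ennreal ((\<Delta> (dopt s) m)\<^sup>2) \<le> c3 G dopt * (\<Sum>a\<in>UNIV. ennreal (p_b G s a * (\<Delta> a m)\<^sup>2))" .
    qed
    then show "ennreal (4 * V) * (\<Sum>m\<in>UNIV. ennreal \<bar>\<Delta> (dopt s) m\<bar>) \<le> ?D"
      unfolding V_def by (intro mult_left_mono sum_mono) auto
  qed
  finally show ?thesis by (rule order_trans) simp
qed

text \<open>The confidence statement holds for each fixed state, so the expectation over the data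
  has to be taken first. Fubini permits this because \<open>data_states\<close> does not depend on
  the realised data, unlike the visitation density of the learned policy.\<close>

lemma expected_bad_set:
  fixes pmh \<Delta> :: "'w \<Rightarrow> 's \<Rightarrow> real"
  assumes P: "prob_space P" and n: "0 < n" "\<And>i. i < n \<Longrightarrow> 0 < T i"
    and m: "(\<lambda>(w, s). pmh w s) \<in> borel_measurable (P \<Otimes>\<^sub>M S)" "(\<lambda>(w, s). \<Delta> w s) \<in> borel_measurable (P \<Otimes>\<^sub>M S)"
    and uq: "\<And>s. s \<in> space S \<Longrightarrow> 1 - \<alpha> \<le> measure P {w \<in> space P. \<bar>pmh w s - p_med G s a m\<bar> \<le> \<Delta> w s}"
  shows "(\<integral>\<^sup>+w. \<integral>\<^sup>+s. (if \<bar>pmh w s - p_med G s a m\<bar> \<le> \<Delta> w s then 0 else 1) \<partial>data_states G n T \<partial>P) \<le> ennreal \<alpha>"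
proof -
  interpret P: prob_space P by fact
  interpret D: prob_space "data_states G n T" by (rule data_states_prob[OF n])
  interpret PD: pair_sigma_finite "data_states G n T" P ..
  note m[unfolded split_beta', measurable]
  have sw: "(\<lambda>z. (snd z, fst z)) \<in> data_states G n T \<Otimes>\<^sub>M P \<rightarrow>\<^sub>M P \<Otimes>\<^sub>M S" by measurable
  have [measurable]: "(\<lambda>z. pmh (snd z) (fst z)) \<in> borel_measurable (data_states G n T \<Otimes>\<^sub>M P)"
    "(\<lambda>z. \<Delta> (snd z) (fst z)) \<in> borel_measurable (data_states G n T \<Otimes>\<^sub>M P)"
    using measurable_compose[OF sw m(1)] measurable_compose[OF sw m(2)] by (simp_all add: split_beta')
  have "(\<integral>\<^sup>+w. \<integral>\<^sup>+s. (if \<bar>pmh w s - p_med G s a m\<bar> \<le> \<Delta> w s then 0 else 1) \<partial>data_states G n T \<partial>P) =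
    (\<integral>\<^sup>+s. \<integral>\<^sup>+w. (if \<bar>pmh w s - p_med G s a m\<bar> \<le> \<Delta> w s then 0 else 1) \<partial>P \<partial>data_states G n T)"
    by (rule PD.Fubini') (simp add: split_beta')
  also have "\<dots> \<le> (\<integral>\<^sup>+s. ennreal \<alpha> \<partial>data_states G n T)"
  proof (intro nn_integral_mono)
    fix s assume "s \<in> space (data_states G n T)"
    then have s: "s \<in> space S" by (simp add: data_states_def)
    let ?E = "{w \<in> space P. \<bar>pmh w s - p_med G s a m\<bar> \<le> \<Delta> w s}"
    have [measurable]: "(\<lambda>w. pmh w s) \<in> borel_measurable P" "(\<lambda>w. \<Delta> w s) \<in> borel_measurable P"
      using measurable_compose[OF measurable_Pair2'[OF s] m(1)] measurable_compose[OF measurable_Pair2'[OF s] m(2)] by simp_all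
    have E: "?E \<in> sets P" by measurable
    have "(\<integral>\<^sup>+w. (if \<bar>pmh w s - p_med G s a m\<bar> \<le> \<Delta> w s then 0 else 1) \<partial>P) = (\<integral>\<^sup>+w. indicator (space P - ?E) w \<partial>P)"
      by (intro nn_integral_cong) (auto simp: indicator_def)
    also have "\<dots> = ennreal (P.prob (space P - ?E))"
      using E by (subst nn_integral_indicator) (auto simp: P.emeasure_eq_measure)
    also have "\<dots> \<le> ennreal \<alpha>"
      using uq[OF s] unfolding P.prob_compl[OF E] by (intro ennreal_leI) linarith
    finally show "(\<integral>\<^sup>+w. (if \<bar>pmh w s - p_med G s a m\<bar> \<le> \<Delta> w s then 0 else 1) \<partial>P) \<le> ennreal \<alpha>" .
  qed
  finally show ?thesis by (simp add: D.emeasure_space_1)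
qed

text \<open>The coverage constant of the confidence term is the one of a reference sampling scheme
  \<open>(n0, T0)\<close>: unlike \<open>c1 G n T\<close>, it depends on the model only.\<close>

lemma pescal_regret:
  fixes P :: "'w measure" and pbh :: "'w \<Rightarrow> 's \<Rightarrow> 'a pmf" and pmh Qh \<Delta> :: "'w \<Rightarrow> 's \<Rightarrow> 'a \<Rightarrow> 'm \<Rightarrow> real"
    and d :: "'w \<Rightarrow> 's \<Rightarrow> 'a"
  assumes opt: "optimal_policy G dopt" and c3: "c3 G dopt < \<top>"
    and n0: "0 < n0" "\<And>i. i < n0 \<Longrightarrow> 0 < T0 i" "c1 G n0 T0 < \<top>"
    and n: "0 < n" "\<And>i. i < n \<Longrightarrow> 0 < T i" "c1 G n T < \<top>"
    and P: "prob_space P"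
    and mb: "\<And>a. (\<lambda>(w, s). pmf (pbh w s) a) \<in> borel_measurable (P \<Otimes>\<^sub>M S)"
    and mm: "\<And>a m. (\<lambda>(w, s). pmh w s a m) \<in> borel_measurable (P \<Otimes>\<^sub>M S)"
    and mQ: "\<And>a m. (\<lambda>(w, s). Qh w s a m) \<in> borel_measurable (P \<Otimes>\<^sub>M S)"
    and mD: "\<And>a m. (\<lambda>(w, s). \<Delta> w s a m) \<in> borel_measurable (P \<Otimes>\<^sub>M S)"
    and md: "(\<lambda>(w, s). d w s) \<in> P \<Otimes>\<^sub>M S \<rightarrow>\<^sub>M count_space UNIV"
    and uq: "\<And>s a m. s \<in> space S \<Longrightarrow> 1 - \<alpha> \<le> measure P {w \<in> space P. \<bar>pmh w s a m - p_med G s a m\<bar> \<le> \<Delta> w s a m}"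
    and Qb: "\<And>w s a m. w \<in> space P \<Longrightarrow> s \<in> space S \<Longrightarrow> \<bar>Qh w s a m\<bar> \<le> Vmax G Rmax"
    and alg: "\<And>w. w \<in> space P \<Longrightarrow> pescal_policy G (pbh w) (pmh w) (Qh w) (\<Delta> w) (d w)"
  shows "ennreal (1 - disc G) * (\<integral>\<^sup>+w. ennreal (J G (deterministic dopt) - J G (deterministic (d w))) \<partial>P) \<le>
    ennreal (2 / pmin) * esqrt (c1 G n T * (\<integral>\<^sup>+w. norm_sq G (data_states G n T) (\<lambda>s a m. Qstar G s a m - Qh w s a m) \<partial>P))
    + ennreal (8 * Vmax G Rmax) * esqrt (c1 G n T * (\<integral>\<^sup>+w. \<integral>\<^sup>+s. KL (p_b G s) (pmf (pbh w s)) \<partial>data_states G n T \<partial>P))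
    + ennreal (4 * Vmax G Rmax) * (\<Sum>m\<in>UNIV. esqrt (c1 G n T * c3 G dopt * (\<integral>\<^sup>+w. \<integral>\<^sup>+s. (\<Sum>a\<in>UNIV. ennreal (p_b G s a * (\<Delta> w s a m)\<^sup>2)) \<partial>data_states G n T \<partial>P)))
    + ennreal (2 * Vmax G Rmax) * (of_nat (CARD('a) * CARD('m)) * (c1 G n0 T0 * ennreal \<alpha>))"
proof -
  interpret P: prob_space P by (rule P)
  let ?\<rho> = "data_states G n T" and ?ref = "data_states G n0 T0"
  define X where "X w s = (\<Sum>a\<in>UNIV. \<Sum>m\<in>UNIV. ennreal (p_b G s a * p_med G s a m * (Qstar G s a m - Qh w s a m)\<^sup>2))" for w s
  define K where "K w s = KL (p_b G s) (pmf (pbh w s))" for w s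
  define D where "D m w s = (\<Sum>a\<in>UNIV. ennreal (p_b G s a * (\<Delta> w s a m)\<^sup>2))" for m w s
  define B where "B a m w s = (if \<bar>pmh w s a m - p_med G s a m\<bar> \<le> \<Delta> w s a m then 0 else 1 :: ennreal)" for a m w s
  note mb[unfolded split_beta', measurable] mm[unfolded split_beta', measurable] mQ[unfolded split_beta', measurable] mD[unfolded split_beta', measurable]
  have mX: "(\<lambda>(w, s). X w s) \<in> borel_measurable (P \<Otimes>\<^sub>M S)"
    unfolding X_def split_beta' by measurable
  have mK: "(\<lambda>(w, s). K w s) \<in> borel_measurable (P \<Otimes>\<^sub>M S)"
    unfolding K_def split_beta' by measurable
  have mDD: "(\<lambda>(w, s). D m w s) \<in> borel_measurable (P \<Otimes>\<^sub>M S)" for m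
    unfolding D_def split_beta' by measurable
  have mB: "(\<lambda>(w, s). B a m w s) \<in> borel_measurable (P \<Otimes>\<^sub>M S)" for a m
    unfolding B_def split_beta' by measurable
  have sec: "f w \<in> borel_measurable S" if "(\<lambda>(w, s). f w s) \<in> borel_measurable (P \<Otimes>\<^sub>M S)" "w \<in> space P" for f :: "'w \<Rightarrow> 's \<Rightarrow> ennreal" and w
    using measurable_compose[OF measurable_Pair1'[OF that(2)] that(1)] by simp
  \<comment> \<open>The bound for one realisation \<open>w\<close> of the data. All state measures
    in it are nonrandom, so the expectation over \<open>w\<close> can be taken term by term.\<close>
  define H where "H w = ennreal (2 / pmin) * esqrt (c1 G n T * (\<integral>\<^sup>+s. X w s \<partial>?\<rho>))
    + ennreal (8 * Vmax G Rmax) * esqrt (c1 G n T * (\<integral>\<^sup>+s. K w s \<partial>?\<rho>))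
    + ennreal (4 * Vmax G Rmax) * (\<Sum>m\<in>UNIV. esqrt (c1 G n T * (\<integral>\<^sup>+s. c3 G dopt * D m w s \<partial>?\<rho>)))
    + ennreal (2 * Vmax G Rmax) * (\<Sum>a\<in>UNIV. \<Sum>m\<in>UNIV. c1 G n0 T0 * (\<integral>\<^sup>+s. B a m w s \<partial>?ref))" for w
  have H: "ennreal (1 - disc G) * ennreal (J G (deterministic dopt) - J G (deterministic (d w))) \<le> H w" if w: "w \<in> space P" for w
  proof -
    have dw: "d w \<in> S \<rightarrow>\<^sub>M count_space UNIV"
      using measurable_compose[OF measurable_Pair1'[OF w] md] by simp
    note st = deterministic_stationary[OF dw]
    let ?v = "visit_dens G (stationary (\<lambda>s. return_pmf (d w s)))"
    note visit_dens_measurable[OF st, measurable]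
    note sec[OF mX w, measurable] sec[OF mK w, measurable] sec[OF mDD w, measurable] sec[OF mB w, measurable]
    have le: "ennreal (star_value s (dopt s) - star_value s (d w s)) \<le> ennreal (2 / pmin) * esqrt (X w s)
        + ennreal (8 * Vmax G Rmax) * esqrt (K w s)
        + ennreal (4 * Vmax G Rmax) * (\<Sum>m\<in>UNIV. esqrt (c3 G dopt * D m w s))
        + ennreal (2 * Vmax G Rmax) * (\<Sum>a\<in>UNIV. \<Sum>m\<in>UNIV. B a m w s)" if s: "s \<in> space S" for s
    proof -
      have "is_arg_max (\<lambda>a. \<Sum>a'\<in>UNIV. \<Sum>m\<in>UNIV. (pmh w s a m - \<Delta> w s a m) * pmf (pbh w s) a' *
          (Qh w s a' m - (INF (s', a', m')\<in>space S \<times> UNIV. Qh w s' a' m'))) (\<lambda>_. True) (d w s)"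
        using alg[OF w] s by (simp add: pescal_policy_def Let_def)
      then show ?thesis
        unfolding X_def K_def D_def B_def
        by (intro pointwise_gap[OF c3 s Qb[OF w]]) (auto simp: is_arg_max_def not_less)
    qed
    have "ennreal (1 - disc G) * ennreal (J G (deterministic dopt) - J G (deterministic (d w))) =
        (\<integral>\<^sup>+s. ?v s * ennreal (star_value s (dopt s) - star_value s (d w s)) \<partial>S)"
      using regret_identity[OF opt dw] by (simp add: deterministic_def)
    also have "\<dots> \<le> (\<integral>\<^sup>+s. ?v s * (ennreal (2 / pmin) * esqrt (X w s)
        + ennreal (8 * Vmax G Rmax) * esqrt (K w s)
        + ennreal (4 * Vmax G Rmax) * (\<Sum>m\<in>UNIV. esqrt (c3 G dopt * D m w s))
        + ennreal (2 * Vmax G Rmax) * (\<Sum>a\<in>UNIV. \<Sum>m\<in>UNIV. B a m w s)) \<partial>S)"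
      by (intro nn_integral_mono mult_left_mono le) auto
    also have "\<dots> = (\<integral>\<^sup>+s. ennreal (2 / pmin) * (?v s * esqrt (X w s))
        + ennreal (8 * Vmax G Rmax) * (?v s * esqrt (K w s))
        + ennreal (4 * Vmax G Rmax) * (\<Sum>m\<in>UNIV. ?v s * esqrt (c3 G dopt * D m w s))
        + ennreal (2 * Vmax G Rmax) * (\<Sum>a\<in>UNIV. \<Sum>m\<in>UNIV. ?v s * B a m w s) \<partial>S)"
      by (simp add: distrib_left sum_distrib_left mult.left_commute)
    also have "\<dots> = ennreal (2 / pmin) * (\<integral>\<^sup>+s. ?v s * esqrt (X w s) \<partial>S)
        + ennreal (8 * Vmax G Rmax) * (\<integral>\<^sup>+s. ?v s * esqrt (K w s) \<partial>S)
        + ennreal (4 * Vmax G Rmax) * (\<Sum>m\<in>UNIV. \<integral>\<^sup>+s. ?v s * esqrt (c3 G dopt * D m w s) \<partial>S)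
        + ennreal (2 * Vmax G Rmax) * (\<Sum>a\<in>UNIV. \<Sum>m\<in>UNIV. \<integral>\<^sup>+s. ?v s * B a m w s \<partial>S)"
      by (simp add: nn_integral_add nn_integral_cmult nn_integral_sum)
    also have "\<dots> \<le> H w"
      unfolding H_def
      \<comment> \<open>The same visitation density is dominated twice: by the actual scheme in the
        square-root terms, by the reference scheme in the confidence term.\<close>
      by (intro add_mono mult_left_mono sum_mono nn_integral_visit_esqrt[OF n st] nn_integral_visit_le_data[OF n0 st]) auto
    finally show ?thesis .
  qed
  have mint: "(\<lambda>w. \<integral>\<^sup>+s. f w s \<partial>?\<rho>) \<in> borel_measurable P" "(\<lambda>w. \<integral>\<^sup>+s. f w s \<partial>?ref) \<in> borel_measurable P"
    if "(\<lambda>(w, s). f w s) \<in> borel_measurable (P \<Otimes>\<^sub>M S)" for f :: "'w \<Rightarrow> 's \<Rightarrow> ennreal"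
    by (rule measurable_nn_integral_data[OF n(1,2) that], assumption, rule measurable_nn_integral_data[OF n0(1,2) that])
  note mint(1)[OF mX, measurable] mint(1)[OF mK, measurable] mint(1)[OF mDD, measurable] mint(2)[OF mB, measurable]
  have mD3: "(\<integral>\<^sup>+s. c3 G dopt * D m w s \<partial>?\<rho>) = c3 G dopt * (\<integral>\<^sup>+s. D m w s \<partial>?\<rho>)" if "w \<in> space P" for m w
    using sec[OF mDD that] by (intro nn_integral_cmult) simp
  \<comment> \<open>The second use of Jensen's inequality, now over the data.\<close>
  have J: "(\<integral>\<^sup>+w. esqrt (k * f w) \<partial>P) \<le> esqrt (k * (\<integral>\<^sup>+w. f w \<partial>P))" if [measurable]: "f \<in> borel_measurable P" for f k
    using nn_integral_esqrt_le[of P "\<lambda>w. k * f w"] P.emeasure_space_1 by (simp add: nn_integral_cmult)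
  have "ennreal (1 - disc G) * (\<integral>\<^sup>+w. ennreal (J G (deterministic dopt) - J G (deterministic (d w))) \<partial>P) \<le> (\<integral>\<^sup>+w. H w \<partial>P)"
  proof -
    have g: "0 < 1 - disc G" using disc by simp
    \<comment> \<open>A constant factor may be pulled out of an integral of a measurable function.
      That is available for \<open>H\<close>, but has not been shown for the regret, so the factor
      is first moved to the side of \<open>H\<close>.\<close>
    have "ennreal (J G (deterministic dopt) - J G (deterministic (d w))) \<le> ennreal (1 / (1 - disc G)) * H w" if "w \<in> space P" for w
      using mult_left_mono[OF H[OF that], of "ennreal (1 / (1 - disc G))"] g
      by (simp add: mult.assoc[symmetric] ennreal_mult[symmetric])
    then have "(\<integral>\<^sup>+w. ennreal (J G (deterministic dopt) - J G (deterministic (d w))) \<partial>P) \<le> (\<integral>\<^sup>+w. ennreal (1 / (1 - disc G)) * H w \<partial>P)"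
      by (rule nn_integral_mono)
    also have "\<dots> = ennreal (1 / (1 - disc G)) * (\<integral>\<^sup>+w. H w \<partial>P)"
    proof (rule nn_integral_cmult)
      have "H \<in> borel_measurable P \<longleftrightarrow> (\<lambda>w. ennreal (2 / pmin) * esqrt (c1 G n T * (\<integral>\<^sup>+s. X w s \<partial>?\<rho>))
        + ennreal (8 * Vmax G Rmax) * esqrt (c1 G n T * (\<integral>\<^sup>+s. K w s \<partial>?\<rho>))
        + ennreal (4 * Vmax G Rmax) * (\<Sum>m\<in>UNIV. esqrt (c1 G n T * (c3 G dopt * (\<integral>\<^sup>+s. D m w s \<partial>?\<rho>))))
        + ennreal (2 * Vmax G Rmax) * (\<Sum>a\<in>UNIV. \<Sum>m\<in>UNIV. c1 G n0 T0 * (\<integral>\<^sup>+s. B a m w s \<partial>?ref))) \<in> borel_measurable P"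
        by (intro measurable_cong) (simp add: H_def mD3)
      also have "\<dots>" by measurable
      finally show "H \<in> borel_measurable P" .
    qed
    finally have "ennreal (1 - disc G) * (\<integral>\<^sup>+w. ennreal (J G (deterministic dopt) - J G (deterministic (d w))) \<partial>P)
        \<le> ennreal (1 - disc G) * (ennreal (1 / (1 - disc G)) * (\<integral>\<^sup>+w. H w \<partial>P))"
      by (rule mult_left_mono) simp
    then show ?thesis using g by (simp add: mult.assoc[symmetric] ennreal_mult[symmetric])
  qed
  also have "(\<integral>\<^sup>+w. H w \<partial>P) = (\<integral>\<^sup>+w. ennreal (2 / pmin) * esqrt (c1 G n T * (\<integral>\<^sup>+s. X w s \<partial>?\<rho>))
        + ennreal (8 * Vmax G Rmax) * esqrt (c1 G n T * (\<integral>\<^sup>+s. K w s \<partial>?\<rho>))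
        + ennreal (4 * Vmax G Rmax) * (\<Sum>m\<in>UNIV. esqrt (c1 G n T * c3 G dopt * (\<integral>\<^sup>+s. D m w s \<partial>?\<rho>)))
        + ennreal (2 * Vmax G Rmax) * (\<Sum>a\<in>UNIV. \<Sum>m\<in>UNIV. c1 G n0 T0 * (\<integral>\<^sup>+s. B a m w s \<partial>?ref)) \<partial>P)"
    by (intro nn_integral_cong) (simp add: H_def mD3 mult.assoc)
  also have "\<dots> = ennreal (2 / pmin) * (\<integral>\<^sup>+w. esqrt (c1 G n T * (\<integral>\<^sup>+s. X w s \<partial>?\<rho>)) \<partial>P)
        + ennreal (8 * Vmax G Rmax) * (\<integral>\<^sup>+w. esqrt (c1 G n T * (\<integral>\<^sup>+s. K w s \<partial>?\<rho>)) \<partial>P)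
        + ennreal (4 * Vmax G Rmax) * (\<Sum>m\<in>UNIV. \<integral>\<^sup>+w. esqrt (c1 G n T * c3 G dopt * (\<integral>\<^sup>+s. D m w s \<partial>?\<rho>)) \<partial>P)
        + ennreal (2 * Vmax G Rmax) * (\<Sum>a\<in>UNIV. \<Sum>m\<in>UNIV. c1 G n0 T0 * (\<integral>\<^sup>+w. \<integral>\<^sup>+s. B a m w s \<partial>?ref \<partial>P))"
    by (simp add: nn_integral_add nn_integral_cmult nn_integral_sum)
  also have "\<dots> \<le> ennreal (2 / pmin) * esqrt (c1 G n T * (\<integral>\<^sup>+w. \<integral>\<^sup>+s. X w s \<partial>?\<rho> \<partial>P))
        + ennreal (8 * Vmax G Rmax) * esqrt (c1 G n T * (\<integral>\<^sup>+w. \<integral>\<^sup>+s. K w s \<partial>?\<rho> \<partial>P))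
        + ennreal (4 * Vmax G Rmax) * (\<Sum>m\<in>UNIV. esqrt (c1 G n T * c3 G dopt * (\<integral>\<^sup>+w. \<integral>\<^sup>+s. D m w s \<partial>?\<rho> \<partial>P)))
        + ennreal (2 * Vmax G Rmax) * (\<Sum>a\<in>(UNIV::'a set). \<Sum>m\<in>(UNIV::'m set). c1 G n0 T0 * ennreal \<alpha>)"
  proof (intro add_mono mult_left_mono sum_mono J)
    show "(\<integral>\<^sup>+w. \<integral>\<^sup>+s. B a m w s \<partial>?ref \<partial>P) \<le> ennreal \<alpha>" for a m
      unfolding B_def by (rule expected_bad_set[OF P n0(1,2) mm mD uq])
  qed (auto intro!: mint(1)[OF mX] mint(1)[OF mK] mint(1)[OF mDD])
  finally show ?thesis
    unfolding X_def K_def D_def norm_sq_def by (simp add: mult.assoc)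
qed

end

theorem theorem3:
  fixes G :: "('s, 'c, 'a::finite, 'm::finite) m2dp"
    and Rmax pmin :: real
    and \<pi>_opt :: "'s \<Rightarrow> 'a"
  assumes model: "confounded_m2dp G Rmax pmin"
    and front_door: "front_door G"
    and optimal: "optimal_policy G \<pi>_opt"
    and c3_finite: "c3 G \<pi>_opt < \<top>"
  shows "\<exists>C>0. \<forall>(n::nat) (T :: nat \<Rightarrow> nat) P (\<alpha>::real)
      (pbh :: ('s, 'a, 'm) dataset \<Rightarrow> 's \<Rightarrow> 'a pmf)
      (pmh :: ('s, 'a, 'm) dataset \<Rightarrow> 's \<Rightarrow> 'a \<Rightarrow> 'm \<Rightarrow> real)
      (Qh :: ('s, 'a, 'm) dataset \<Rightarrow> 's \<Rightarrow> 'a \<Rightarrow> 'm \<Rightarrow> real)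
      (\<Delta> :: ('s, 'a, 'm) dataset \<Rightarrow> 's \<Rightarrow> 'a \<Rightarrow> 'm \<Rightarrow> real)
      (\<pi>_til :: ('s, 'a, 'm) dataset \<Rightarrow> 's \<Rightarrow> 'a).
      n > 0 \<and> (\<forall>i<n. T i > 0) \<and> data_law G n P \<and>
      \<comment> \<open>joint measurability in data and state\<close>
      (\<forall>a. (\<lambda>(\<omega>, s). pmf (pbh (dataset n T \<omega>) s) a) \<in> borel_measurable (P \<Otimes>\<^sub>M state_base G)) \<and>
      (\<forall>a m. (\<lambda>(\<omega>, s). pmh (dataset n T \<omega>) s a m) \<in> borel_measurable (P \<Otimes>\<^sub>M state_base G)) \<and>
      (\<forall>a m. (\<lambda>(\<omega>, s). Qh (dataset n T \<omega>) s a m) \<in> borel_measurable (P \<Otimes>\<^sub>M state_base G)) \<and>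
      (\<forall>a m. (\<lambda>(\<omega>, s). \<Delta> (dataset n T \<omega>) s a m) \<in> borel_measurable (P \<Otimes>\<^sub>M state_base G)) \<and>
      (\<lambda>(\<omega>, s). \<pi>_til (dataset n T \<omega>) s) \<in> P \<Otimes>\<^sub>M state_base G \<rightarrow>\<^sub>M count_space UNIV \<and>
      \<comment> \<open>pointwise uncertainty quantification\<close>
      \<alpha> > 0 \<and>
      (\<forall>s\<in>space (state_base G). \<forall>a m.
        measure P {\<omega> \<in> space P. \<bar>pmh (dataset n T \<omega>) s a m - p_med G s a m\<bar>
            \<le> \<Delta> (dataset n T \<omega>) s a m} \<ge> 1 - \<alpha>) \<and>
      \<comment> \<open>coverage\<close>
      c1 G n T < \<top> \<and>
      \<comment> \<open>boundedness of the initial Q-estimator\<close>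
      (\<forall>\<omega>\<in>space P. \<forall>s\<in>space (state_base G). \<forall>a m.
        \<bar>Qh (dataset n T \<omega>) s a m\<bar> \<le> Vmax G Rmax) \<and>
      \<comment> \<open>the algorithm's output\<close>
      (\<forall>\<omega>\<in>space P. let D = dataset n T \<omega> in
        pescal_policy G (pbh D) (pmh D) (Qh D) (\<Delta> D) (\<pi>_til D))
      \<longrightarrow>
      ennreal (\<integral>\<omega>. J G (deterministic \<pi>_opt) - J G (deterministic (\<pi>_til (dataset n T \<omega>))) \<partial>P)
      \<le> ennreal (C / (1 - disc G)) *
          esqrt (c1 G n T * (\<integral>\<^sup>+\<omega>. norm_sq G (data_states G n T)
            (\<lambda>s a m. Qstar G s a m - Qh (dataset n T \<omega>) s a m) \<partial>P))
        + ennreal (C * Vmax G Rmax / (1 - disc G)) *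
          (esqrt (c1 G n T * (\<integral>\<^sup>+\<omega>. \<integral>\<^sup>+s.
              KL (p_b G s) (pmf (pbh (dataset n T \<omega>) s)) \<partial>data_states G n T \<partial>P))
          + (\<Sum>m\<in>UNIV. esqrt (c1 G n T * c3 G \<pi>_opt * (\<integral>\<^sup>+\<omega>. \<integral>\<^sup>+s.
              (\<Sum>a\<in>UNIV. ennreal (p_b G s a * (\<Delta> (dataset n T \<omega>) s a m)\<^sup>2))
              \<partial>data_states G n T \<partial>P)))
          + ennreal (\<alpha> * real (CARD('m) + CARD('a))))"
proof -
  interpret front_door_m2dp G Rmax pmin
    using model front_door by (simp add: front_door_m2dp_def front_door_m2dp_axioms_def)
  define V where "V = Vmax G Rmax"
  define g where "g = 1 / (1 - disc G)"
  have V: "0 \<le> V" unfolding V_def by (rule Vmax_nonneg)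
  have g: "0 < g" using disc by (simp add: g_def)
  \<comment> \<open>\<open>C\<close> is chosen before the sampling scheme, so \<open>k\<close> is
    the coverage of any one scheme with finite \<open>c1\<close>. If there is none, the coverage
    hypothesis is never met and \<open>k = 0\<close> serves.\<close>
  obtain k where k: "0 \<le> k" "\<And>n T. 0 < n \<Longrightarrow> \<forall>i<n. 0 < T i \<Longrightarrow> c1 G n T < \<top> \<Longrightarrow>
      \<exists>n0 T0. 0 < n0 \<and> (\<forall>i<n0. 0 < T0 i) \<and> c1 G n0 T0 = ennreal k"
  proof (cases "\<exists>n T. 0 < n \<and> (\<forall>i<n. 0 < T i) \<and> c1 G n T < \<top>")
    case True
    then obtain n0 T0 where n0: "0 < n0" "\<forall>i<n0. 0 < T0 i" "c1 G n0 T0 < \<top>" by blast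
    then have "c1 G n0 T0 = ennreal (enn2real (c1 G n0 T0))" by simp
    show ?thesis
    proof (rule that)
      show "0 \<le> enn2real (c1 G n0 T0)" by simp
    qed (use n0 \<open>c1 G n0 T0 = ennreal (enn2real (c1 G n0 T0))\<close> in blast)
  next
    case False
    show ?thesis by (rule that[of 0]) (simp, use False in blast)
  qed
  \<comment> \<open>The summands dominate the coefficients of the error terms:
    \<open>2 / pmin\<close> for \<open>Qh\<close>, \<open>8\<close> for the relative entropy and for
    \<open>\<Delta>\<close> (whose coefficient is 4), and the last for the failure
    probability.\<close>
  define C where "C = 2 / pmin + 8 + 2 * k * real (CARD('a) * CARD('m))"
  have C: "2 / pmin \<le> C" "8 \<le> C" "2 * k * real (CARD('a) * CARD('m)) \<le> C" "0 < C"
  proof -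
    have "0 < 2 / pmin" "0 \<le> 2 * k * real (CARD('a) * CARD('m))" using k(1) pmin_pos by simp_all
    then show "2 / pmin \<le> C" "8 \<le> C" "2 * k * real (CARD('a) * CARD('m)) \<le> C" "0 < C"
      unfolding C_def by linarith+
  qed
  show ?thesis
  proof (intro exI[of _ C] conjI allI impI, rule C(4), elim conjE, goal_cases)
    case (1 n T P \<alpha> pbh pmh Qh \<Delta> \<pi>_til)
    note h = this
    from k(2)[OF h(1,2) h(11)] obtain n0 T0 where n0: "0 < n0" "\<forall>i<n0. 0 < T0 i" "c1 G n0 T0 = ennreal k"
      by blast
    define L where "L = (\<integral>\<^sup>+\<omega>. ennreal (J G (deterministic \<pi>_opt) - J G (deterministic (\<pi>_til (dataset n T \<omega>)))) \<partial>P)"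
    define E1 where "E1 = esqrt (c1 G n T * (\<integral>\<^sup>+\<omega>. norm_sq G (data_states G n T)
            (\<lambda>s a m. Qstar G s a m - Qh (dataset n T \<omega>) s a m) \<partial>P))"
    define E2 where "E2 = esqrt (c1 G n T * (\<integral>\<^sup>+\<omega>. \<integral>\<^sup>+s.
              KL (p_b G s) (pmf (pbh (dataset n T \<omega>) s)) \<partial>data_states G n T \<partial>P))"
    define E3 where "E3 = (\<Sum>m\<in>UNIV. esqrt (c1 G n T * c3 G \<pi>_opt * (\<integral>\<^sup>+\<omega>. \<integral>\<^sup>+s.
              (\<Sum>a\<in>UNIV. ennreal (p_b G s a * (\<Delta> (dataset n T \<omega>) s a m)\<^sup>2))
              \<partial>data_states G n T \<partial>P)))"
    have main: "ennreal (1 - disc G) * L \<le> ennreal (2 / pmin) * E1 + ennreal (8 * V) * E2 + ennreal (4 * V) * E3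
      + ennreal (2 * V) * (of_nat (CARD('a) * CARD('m)) * (ennreal k * ennreal \<alpha>))"
      unfolding L_def E1_def E2_def E3_def V_def n0(3)[symmetric]
    proof (rule pescal_regret[OF optimal c3_finite])
      show "prob_space P" using h(3) by (simp add: data_law_def)
      show "c1 G n0 T0 < \<top>" using n0(3) by simp
      show "pescal_policy G (pbh (dataset n T w)) (pmh (dataset n T w)) (Qh (dataset n T w)) (\<Delta> (dataset n T w)) (\<pi>_til (dataset n T w))"
        if "w \<in> space P" for w
        using h(13) that by (simp add: Let_def)
    qed (use h n0 in blast)+
    have "ennreal (2 * V) * (of_nat (CARD('a) * CARD('m)) * (ennreal k * ennreal \<alpha>)) =
        ennreal (V * (2 * k * real (CARD('a) * CARD('m))) * \<alpha>)"
      using V k(1) h(9) by (simp add: ennreal_of_nat_eq_real_of_nat ennreal_mult[symmetric] ac_simps)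
    also have "\<dots> \<le> ennreal (C * V * (\<alpha> * real (CARD('m) + CARD('a))))"
    proof (rule ennreal_leI)
      have "V * (2 * k * real (CARD('a) * CARD('m))) * \<alpha> \<le> V * C * (\<alpha> * 1)"
        using V C h(9) by (simp add: mult_left_mono mult_right_mono)
      \<comment> \<open>The number of pairs \<open>(a, m)\<close> is already part of
        \<open>C\<close>, so it remains to insert a factor that is at least 1.\<close>
      also have "\<dots> \<le> V * C * (\<alpha> * real (CARD('m) + CARD('a)))"
      proof -
        have "0 < CARD('m)" by simp
        then have "1 \<le> real (CARD('m) + CARD('a))" by linarith
        then show ?thesis using V C(4) h(9) by (intro mult_left_mono) auto
      qed
      finally show "V * (2 * k * real (CARD('a) * CARD('m))) * \<alpha> \<le> C * V * (\<alpha> * real (CARD('m) + CARD('a)))"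
        by (simp add: mult.commute)
    qed
    also have "\<dots> = ennreal (C * V) * ennreal (\<alpha> * real (CARD('m) + CARD('a)))"
      using V C(4) h(9) by (intro ennreal_mult) auto
    finally have conf: "ennreal (2 * V) * (of_nat (CARD('a) * CARD('m)) * (ennreal k * ennreal \<alpha>))
      \<le> ennreal (C * V) * ennreal (\<alpha> * real (CARD('m) + CARD('a)))" .
    have "ennreal (1 - disc G) * L \<le> ennreal C * E1 + ennreal (C * V) * E2 + ennreal (C * V) * E3
      + ennreal (C * V) * ennreal (\<alpha> * real (CARD('m) + CARD('a)))"
      using C V by (intro order_trans[OF main] add_mono conf mult_right_mono ennreal_leI) auto
    then have "ennreal g * (ennreal (1 - disc G) * L) \<le> ennreal g * (ennreal C * E1 + ennreal (C * V) * E2 + ennreal (C * V) * E3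
      + ennreal (C * V) * ennreal (\<alpha> * real (CARD('m) + CARD('a))))"
      by (rule mult_left_mono) simp
    also have "ennreal g * (ennreal (1 - disc G) * L) = L"
      using disc by (simp add: g_def mult.assoc[symmetric] ennreal_mult[symmetric])
    also have "ennreal g * (ennreal C * E1 + ennreal (C * V) * E2 + ennreal (C * V) * E3
      + ennreal (C * V) * ennreal (\<alpha> * real (CARD('m) + CARD('a)))) =
      (ennreal g * ennreal C) * E1 + (ennreal g * ennreal (C * V)) * (E2 + E3 + ennreal (\<alpha> * real (CARD('m) + CARD('a))))"
      by (simp only: distrib_left mult.assoc add.assoc)
    also have "ennreal g * ennreal C = ennreal (C / (1 - disc G))"
      using g C(4) by (subst ennreal_mult[symmetric]) (auto simp: g_def)
    also have "ennreal g * ennreal (C * V) = ennreal (C * Vmax G Rmax / (1 - disc G))"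
      using g C(4) V by (subst ennreal_mult[symmetric]) (auto simp: g_def V_def)
    finally show ?case
      unfolding L_def E1_def E2_def E3_def
      by (rule order_trans[OF ennreal_integral_le_nn_integral])
  qed
qed

end
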